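(* Consider the system and notation described in the context, and suppose $0<a_1<\sqrt{4d_1r}$ and $L>L_1^*$. (i) If $x_1\ge L^*$ (large protection zone), $m\le p^{-1}e^{-|\frac{a_1}{d_1}-\frac{a_2}{d_2}|L}$ and $\tilde w^2(L)\le h$, then the system possesses a unique coexistence steady state $(u,w)$, and it is globally asymptotically stable. (ii) If $x_1<L^*$ (small protection zone), $m<\min\{m^*,\,p^{-1}e^{-|\frac{a_1}{d_1}-\frac{a_2}{d_2}|L}\}$ and $\tilde w^2(L)\le h$, then the system possesses a unique coexistence steady state $(u,w)$, and it is globally asymptotically stable.
   Context: Let $d_1,d_2,r,m,p,q,h,L>0$, $a_1>0$, $a_2\ge0$ and $0\le x_1<L$. Let $\chi_{(x_1,L]}(x)=1$ for $x_1<x\le L$ and $0$ for $0\le x\le x_1$. Consider the system $u_t=d_1u_{xx}-a_1u_x+u(r-u-m\chi_{(x_1,L]}w)$, $x\in(0,L)$; $w_t=d_2w_{xx}-a_2w_x+h-qw-puw$, $x\in(x_1,L)$; $d_1u_x(0,t)-a_1u(0,t)=u_x(L,t)=0$, $d_2w_x(x_1,t)-a_2w(x_1,t)=w_x(L,t)=0$; nonnegative, not identically zero initial data. A coexistence steady state is a time-independent solution $(u,w)$ with $u>0$ on $[0,L]$ and $w>0$ on $[x_1,L]$; it is globally asymptotically stable if every solution with nonnegative nontrivial initial data converges to it uniformly as $t\to\infty$. Let $\tilde w$ be the unique positive solution of $d_2w''-a_2w'+h-qw=0$ on $(x_1,L)$, $d_2w'(x_1)-a_2w(x_1)=w'(L)=0$.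 For $0\le y_1<y_2\le L$, $d>0$, $a\ge0$, bounded $s$, $\lambda_1(d,a,s,(y_1,y_2))$ is the principal eigenvalue of $d\varphi''-a\varphi'+s\varphi=\lambda\varphi$ on $(y_1,y_2)$, $d\varphi'(y_1)-a\varphi(y_1)=\varphi'(y_2)=0$. When $x_1<L^*$ (and the other hypotheses hold), $m^*=m^*(x_1)>0$ denotes the value of $m$ at which $\lambda_1(d_1,a_1,r-m\chi_{(x_1,L]}\tilde w,(0,L))=0$ (this eigenvalue is strictly decreasing in $m$). For $0<a_1<\sqrt{4d_1r}$: $L^*=2d_1\big(\pi-\arctan\frac{\sqrt{4d_1r-a_1^2}}{a_1}\big)/\sqrt{4d_1r-a_1^2}$; $L_1^*=2d_1\arctan\big(\frac{a_1\sqrt{4d_1r-a_1^2}}{2d_1r-a_1^2}\big)/\sqrt{4d_1r-a_1^2}$ if $a_1\le\sqrt{2d_1r}$ and $L_1^*=2d_1\big(\pi+\arctan\frac{a_1\sqrt{4d_1r-a_1^2}}{2d_1r-a_1^2}\big)/\sqrt{4d_1r-a_1^2}$ if $\sqrt{2d_1r}<a_1<\sqrt{4d_1r}$. *)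

theory Defs
  imports "HOL-Analysis.Analysis"
begin

definition chi :: "real \<Rightarrow> real \<Rightarrow> real \<Rightarrow> real" where
  "chi x1 L x = (if x1 < x \<and> x \<le> L then 1 else 0)"

text \<open>Classical solution of the u-equation (u x t, for x in [0,L], t \<ge> 0).
  Because of the jump of chi at x1, second x-derivative and time derivative are only
  required off x = x1; u and u_x are continuous across x1.\<close>
definition u_solution ::
  "real \<Rightarrow> real \<Rightarrow> real \<Rightarrow> real \<Rightarrow> real \<Rightarrow> real \<Rightarrow>
   (real \<Rightarrow> real \<Rightarrow> real) \<Rightarrow> (real \<Rightarrow> real \<Rightarrow> real) \<Rightarrow> bool" where
  "u_solution d1 a1 r m L x1 u w \<longleftrightarrow>
     continuous_on ({0..L} \<times> {0..}) (\<lambda>(x, t). u x t) \<and>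
     (\<exists>ux uxx ut.
        continuous_on ({0..L} \<times> {0<..}) (\<lambda>(x, t). ux x t) \<and>
        continuous_on (({0<..<L} - {x1}) \<times> {0<..}) (\<lambda>(x, t). uxx x t) \<and>
        continuous_on (({0<..<L} - {x1}) \<times> {0<..}) (\<lambda>(x, t). ut x t) \<and>
        (\<forall>t>0. \<forall>x\<in>{0..L}. ((\<lambda>y. u y t) has_real_derivative ux x t) (at x within {0..L})) \<and>
        (\<forall>t>0. \<forall>x\<in>{0<..<L} - {x1}.
            ((\<lambda>y. ux y t) has_real_derivative uxx x t) (at x) \<and>
            ((\<lambda>s. u x s) has_real_derivative ut x t) (at t) \<and>
            ut x t = d1 * uxx x t - a1 * ux x t + u x t * (r - u x t - m * chi x1 L x * w x t)) \<and>
        (\<forall>t>0. d1 * ux 0 t - a1 * u 0 t = 0 \<and> ux L t = 0))"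

definition w_solution ::
  "real \<Rightarrow> real \<Rightarrow> real \<Rightarrow> real \<Rightarrow> real \<Rightarrow> real \<Rightarrow> real \<Rightarrow>
   (real \<Rightarrow> real \<Rightarrow> real) \<Rightarrow> (real \<Rightarrow> real \<Rightarrow> real) \<Rightarrow> bool" where
  "w_solution d2 a2 p q h L x1 u w \<longleftrightarrow>
     continuous_on ({x1..L} \<times> {0..}) (\<lambda>(x, t). w x t) \<and>
     (\<exists>wx wxx wt.
        continuous_on ({x1..L} \<times> {0<..}) (\<lambda>(x, t). wx x t) \<and>
        continuous_on ({x1<..<L} \<times> {0<..}) (\<lambda>(x, t). wxx x t) \<and>
        continuous_on ({x1<..<L} \<times> {0<..}) (\<lambda>(x, t). wt x t) \<and>
        (\<forall>t>0. \<forall>x\<in>{x1..L}. ((\<lambda>y. w y t) has_real_derivative wx x t) (at x within {x1..L})) \<and>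
        (\<forall>t>0. \<forall>x\<in>{x1<..<L}.
            ((\<lambda>y. wx y t) has_real_derivative wxx x t) (at x) \<and>
            ((\<lambda>s. w x s) has_real_derivative wt x t) (at t) \<and>
            wt x t = d2 * wxx x t - a2 * wx x t + h - q * w x t - p * u x t * w x t) \<and>
        (\<forall>t>0. d2 * wx x1 t - a2 * w x1 t = 0 \<and> wx L t = 0))"

definition is_solution ::
  "real \<Rightarrow> real \<Rightarrow> real \<Rightarrow> real \<Rightarrow> real \<Rightarrow> real \<Rightarrow> real \<Rightarrow> real \<Rightarrow> real \<Rightarrow> real \<Rightarrow> real \<Rightarrow>
   (real \<Rightarrow> real \<Rightarrow> real) \<Rightarrow> (real \<Rightarrow> real \<Rightarrow> real) \<Rightarrow> bool" where
  "is_solution d1 d2 a1 a2 r m p q h L x1 u w \<longleftrightarrow>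
     u_solution d1 a1 r m L x1 u w \<and> w_solution d2 a2 p q h L x1 u w"

definition coexistence_steady_state ::
  "real \<Rightarrow> real \<Rightarrow> real \<Rightarrow> real \<Rightarrow> real \<Rightarrow> real \<Rightarrow> real \<Rightarrow> real \<Rightarrow> real \<Rightarrow> real \<Rightarrow> real \<Rightarrow>
   (real \<Rightarrow> real) \<Rightarrow> (real \<Rightarrow> real) \<Rightarrow> bool" where
  "coexistence_steady_state d1 d2 a1 a2 r m p q h L x1 U W \<longleftrightarrow>
     is_solution d1 d2 a1 a2 r m p q h L x1 (\<lambda>x t. U x) (\<lambda>x t. W x) \<and>
     (\<forall>x\<in>{0..L}. U x > 0) \<and> (\<forall>x\<in>{x1..L}. W x > 0)"

definition globally_asymptotically_stable ::
  "real \<Rightarrow> real \<Rightarrow> real \<Rightarrow> real \<Rightarrow> real \<Rightarrow> real \<Rightarrow> real \<Rightarrow> real \<Rightarrow> real \<Rightarrow> real \<Rightarrow> real \<Rightarrow>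
   (real \<Rightarrow> real) \<Rightarrow> (real \<Rightarrow> real) \<Rightarrow> bool" where
  "globally_asymptotically_stable d1 d2 a1 a2 r m p q h L x1 U W \<longleftrightarrow>
     (\<forall>u w. is_solution d1 d2 a1 a2 r m p q h L x1 u w \<and>
            (\<forall>x\<in>{0..L}. u x 0 \<ge> 0) \<and> (\<exists>x\<in>{0..L}. u x 0 \<noteq> 0) \<and>
            (\<forall>x\<in>{x1..L}. w x 0 \<ge> 0) \<and> (\<exists>x\<in>{x1..L}. w x 0 \<noteq> 0) \<longrightarrow>
        (\<forall>\<epsilon>>0. \<exists>T. \<forall>t\<ge>T.
            (\<forall>x\<in>{0..L}. \<bar>u x t - U x\<bar> < \<epsilon>) \<and> (\<forall>x\<in>{x1..L}. \<bar>w x t - W x\<bar> < \<epsilon>)))"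

text \<open>Principal eigenvalue of  d phi'' - a phi' + s phi = lambda phi  on (y1,y2),
  d phi'(y1) - a phi(y1) = phi'(y2) = 0: the eigenvalue admitting a positive eigenfunction.
  The eigenfunction is C^1, and phi'' exists (equation holds) off a finite set
  (s may be piecewise continuous).\<close>
definition principal_eigenvalue ::
  "real \<Rightarrow> real \<Rightarrow> (real \<Rightarrow> real) \<Rightarrow> real \<Rightarrow> real \<Rightarrow> real \<Rightarrow> bool" where
  "principal_eigenvalue d a s y1 y2 lam \<longleftrightarrow>
     (\<exists>\<phi> \<phi>' \<phi>'' S. finite S \<and>
        (\<forall>x\<in>{y1..y2}. \<phi> x > 0) \<and>
        continuous_on {y1..y2} \<phi>' \<and>
        (\<forall>x\<in>{y1..y2}. (\<phi> has_real_derivative \<phi>' x) (at x within {y1..y2})) \<and>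
        (\<forall>x\<in>{y1<..<y2} - S. (\<phi>' has_real_derivative \<phi>'' x) (at x) \<and>
            d * \<phi>'' x - a * \<phi>' x + s x * \<phi> x = lam * \<phi> x) \<and>
        d * \<phi>' y1 - a * \<phi> y1 = 0 \<and> \<phi>' y2 = 0)"

definition lambda1 :: "real \<Rightarrow> real \<Rightarrow> (real \<Rightarrow> real) \<Rightarrow> real \<Rightarrow> real \<Rightarrow> real" where
  "lambda1 d a s y1 y2 = (THE lam. principal_eigenvalue d a s y1 y2 lam)"

text \<open>The unique positive solution w~ of d2 w'' - a2 w' + h - q w = 0 on (x1,L),
  d2 w'(x1) - a2 w(x1) = w'(L) = 0 (determined on [x1,L]).\<close>
definition w_tilde :: "real \<Rightarrow> real \<Rightarrow> real \<Rightarrow> real \<Rightarrow> real \<Rightarrow> real \<Rightarrow> real \<Rightarrow> real" where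
  "w_tilde d2 a2 h q L x1 = (SOME w. (\<forall>x\<in>{x1..L}. w x > 0) \<and>
     (\<exists>w' w''. (\<forall>x\<in>{x1..L}. (w has_real_derivative w' x) (at x within {x1..L}) \<and>
                              (w' has_real_derivative w'' x) (at x within {x1..L})) \<and>
               (\<forall>x\<in>{x1<..<L}. d2 * w'' x - a2 * w' x + h - q * w x = 0) \<and>
               d2 * w' x1 - a2 * w x1 = 0 \<and> w' L = 0))"

definition L_star :: "real \<Rightarrow> real \<Rightarrow> real \<Rightarrow> real" where
  "L_star d1 a1 r = 2 * d1 * (pi - arctan (sqrt (4 * d1 * r - a1^2) / a1)) / sqrt (4 * d1 * r - a1^2)"

text \<open>At a1 = sqrt(2 d1 r) the arctan argument is +infinity; we use the limit value pi/2.\<close>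
definition L1_star :: "real \<Rightarrow> real \<Rightarrow> real \<Rightarrow> real" where
  "L1_star d1 a1 r =
     (if a1 < sqrt (2 * d1 * r) then
        2 * d1 * arctan (a1 * sqrt (4 * d1 * r - a1^2) / (2 * d1 * r - a1^2)) / sqrt (4 * d1 * r - a1^2)
      else if a1 = sqrt (2 * d1 * r) then
        2 * d1 * (pi / 2) / sqrt (4 * d1 * r - a1^2)
      else
        2 * d1 * (pi + arctan (a1 * sqrt (4 * d1 * r - a1^2) / (2 * d1 * r - a1^2))) / sqrt (4 * d1 * r - a1^2))"

definition m_star :: "real \<Rightarrow> real \<Rightarrow> real \<Rightarrow> real \<Rightarrow> real \<Rightarrow> real \<Rightarrow> real \<Rightarrow> real \<Rightarrow> real \<Rightarrow> real" where
  "m_star d1 d2 a1 a2 r q h L x1 = (THE m. m > 0 \<and>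
     lambda1 d1 a1 (\<lambda>x. r - m * chi x1 L x * w_tilde d2 a2 h q L x1 x) 0 L = 0)"

end

theory Submission
  imports Defs
begin

text \<open>
  The system is competitive, so comparison arguments trap every solution between the two monotone
  iterations that start at \<open>(\<delta> \<phi>, w_tilde)\<close> and at \<open>(M, 0)\<close>, where \<open>\<phi>\<close> is the principal
  eigenfunction of the linearisation at \<open>(0, w_tilde)\<close>. The limits of both iterations are coexistence
  states, so that uniqueness of the coexistence state implies global convergence.

  The principal eigenvalue is positive: for a large protection zone this follows by comparison with the
  explicit solution that vanishes at \<open>L_star\<close>, and for a small one by monotonicity in \<open>m\<close>;
  existence of the eigenvalue and of \<open>m_star\<close> comes from the intermediate value theorem for the Pruefer angle.

  For two coexistence states put \<open>A = U2 - U1\<close> and \<open>B = W1 - W2\<close>. Testing the equations with the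
  increasing function \<open>(v - 1) \<bar>v - 1\<bar> / v\<close> of the quotients \<open>v = U2 / U1\<close> and \<open>v = W1 / W2\<close> gives
  that the integrals of \<open>exp (- a1 x / d1) A \<bar>A\<bar> (A - m B)\<close> and of
  \<open>exp (- a2 x / d2) B \<bar>B\<bar> (h B / (W1 W2) - p A)\<close> are nonpositive. As \<open>W1 W2 < h\<close> and
  \<open>m p \<le> exp (- \<bar>a1 / d1 - a2 / d2\<bar> L)\<close>, a suitable combination of the integrands is positive definite.
\<close>

section \<open>One-dimensional calculus\<close>

lemma le_of_deriv_nonneg_off_finite:
  fixes F F' :: "real \<Rightarrow> real"
  assumes "a \<le> b" "finite S" "continuous_on {a..b} F"
    and "\<And>x. x \<in> {a<..<b} - S \<Longrightarrow> (F has_real_derivative F' x) (at x)"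
    and "\<And>x. x \<in> {a<..<b} - S \<Longrightarrow> 0 \<le> F' x"
  shows "F a \<le> F b"
proof -
  define G where "G x = (if x \<in> {a<..<b} - S then F' x else 0)" for x
  have "(G has_integral (F b - F a)) {a..b}"
    using assms by (intro fundamental_theorem_of_calculus_interior_strong[of S])
      (auto simp: G_def has_real_derivative_iff_has_vector_derivative)
  moreover have "\<And>x. 0 \<le> G x" using assms by (auto simp: G_def)
  ultimately have "0 \<le> F b - F a" using has_integral_nonneg by blast
  then show ?thesis by simp
qed

lemma deriv_zero_of_nonneg_off_finite:
  fixes F F' :: "real \<Rightarrow> real"
  assumes "finite S" "continuous_on {a..b} F"
    and D: "\<And>x. x \<in> {a<..<b} - S \<Longrightarrow> (F has_real_derivative F' x) (at x)"
    and P: "\<And>x. x \<in> {a<..<b} - S \<Longrightarrow> 0 \<le> F' x"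
    and "F b \<le> F a" and x: "x \<in> {a<..<b} - S"
  shows "F' x = 0"
proof -
  have mono: "F y \<le> F z" if "a \<le> y" "y \<le> z" "z \<le> b" for y z
    using that assms
    by (intro le_of_deriv_nonneg_off_finite[of y z S F F']) (auto intro: continuous_on_subset)
  have const: "F y = F a" if "y \<in> {a<..<b}" for y
    using mono[of a y] mono[of y b] that assms(5) by auto
  have "((\<lambda>_. F a) has_real_derivative F' x) (at x)"
    by (rule has_field_derivative_transform_within_open[OF D[OF x], of "{a<..<b}"])
       (use x const in auto)
  then show ?thesis by (metis DERIV_const DERIV_unique)
qed

lemma has_derivative_across_finite:
  fixes R V :: "real \<Rightarrow> real"
  assumes "finite S" "continuous_on {a..b} R" "continuous_on {a..b} V"
    and D: "\<And>x. x \<in> {a<..<b} - S \<Longrightarrow> (R has_real_derivative V x) (at x)"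
    and x: "x \<in> {a..b}"
  shows "(R has_real_derivative V x) (at x within {a..b})"
proof -
  have eq: "R a + integral {a..y} V = R y" if "y \<in> {a..b}" for y
  proof -
    have "(V has_integral (R y - R a)) {a..y}"
      using that assms by (intro fundamental_theorem_of_calculus_interior_strong[of S])
       (auto simp: has_real_derivative_iff_has_vector_derivative intro: continuous_on_subset)
    then show ?thesis by (simp add: integral_unique)
  qed
  have "((\<lambda>y. R a + integral {a..y} V) has_real_derivative V x) (at x within {a..b})"
    using DERIV_add[OF DERIV_const[of "R a"] integral_has_real_derivative[OF assms(3) x]] by simp
  then show ?thesis
    by (rule has_field_derivative_transform_within[where d=1]) (use x eq in auto)
qed

lemma min_left_end_deriv_nonneg:
  fixes f :: "real \<Rightarrow> real"
  assumes "p < q" "(f has_real_derivative l) (at p within {p..q})"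
    and "\<And>x. x \<in> {p..q} \<Longrightarrow> f p \<le> f x"
  shows "l \<ge> 0"
proof (rule ccontr)
  assume "\<not> l \<ge> 0"
  then obtain e where e: "e > 0" "\<forall>h>0. p + h \<in> {p..q} \<longrightarrow> h < e \<longrightarrow> f (p + h) < f p"
    using has_real_derivative_neg_dec_right[OF assms(2)] by fastforce
  define h where "h = min (e/2) (q - p)"
  have "h > 0" "h < e" "p + h \<in> {p..q}" using e(1) assms(1) by (auto simp: h_def)
  then show False using e(2) assms(3)[of "p+h"] by auto
qed

lemma min_right_end_deriv_nonpos:
  fixes f :: "real \<Rightarrow> real"
  assumes "p < q" "(f has_real_derivative l) (at q within {p..q})"
    and "\<And>x. x \<in> {p..q} \<Longrightarrow> f q \<le> f x"
  shows "l \<le> 0"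
proof (rule ccontr)
  assume "\<not> l \<le> 0"
  then obtain e where e: "e > 0" "\<forall>h>0. q - h \<in> {p..q} \<longrightarrow> h < e \<longrightarrow> f (q - h) < f q"
    using has_real_derivative_pos_inc_left[OF assms(2)] by fastforce
  define h where "h = min (e/2) (q - p)"
  have "h > 0" "h < e" "q - h \<in> {p..q}" using e(1) assms(1) by (auto simp: h_def)
  then show False using e(2) assms(3)[of "q-h"] by auto
qed

lemma interior_min_derivs:
  fixes f f' :: "real \<Rightarrow> real"
  assumes "a < x" "x < b"
    and f: "\<And>y. y \<in> {a<..<b} \<Longrightarrow> (f has_real_derivative f' y) (at y)"
    and f': "(f' has_real_derivative l) (at x)"
    and min: "\<And>y. y \<in> {a<..<b} \<Longrightarrow> f x \<le> f y"
  shows "f' x = 0" "l \<ge> 0"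
proof -
  show z: "f' x = 0"
    by (rule DERIV_local_min[OF f[of x], of "min (x-a) (b-x)"]) (use assms in \<open>auto simp: abs_less_iff\<close>)
  show "l \<ge> 0"
  proof (rule ccontr)
    assume "\<not> l \<ge> 0"
    then obtain e where e: "e > 0" "\<And>h. 0 < h \<Longrightarrow> h < e \<Longrightarrow> f' (x + h) < 0"
      using DERIV_neg_dec_right[OF f'] z by auto
    define y where "y = x + min (e/2) ((b-x)/2)"
    have y: "x < y" "y < b" "y < x + e" using e(1) assms(2) by (auto simp: y_def min_def field_simps)
    obtain t where t: "x < t" "t < y" "f y - f x = (y - x) * f' t"
      using MVT2[of x y f f'] y f assms by force
    have "f' t < 0" using e(2)[of "t-x"] t y by auto
    then have "f y < f x" using t y by (metis diff_gt_0_iff_gt diff_less_0_iff_less mult_pos_neg)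
    then show False using min[of y] y assms(1) by simp
  qed
qed

lemma first_time_min_deriv_nonpos:
  fixes f :: "real \<Rightarrow> real"
  assumes "T < t" "(f has_real_derivative l) (at t)" "\<And>s. T \<le> s \<Longrightarrow> s \<le> t \<Longrightarrow> f t \<le> f s"
  shows "l \<le> 0"
  by (rule min_right_end_deriv_nonpos[of T t f])
     (use assms in \<open>auto intro: has_field_derivative_at_within\<close>)

section \<open>A weak maximum principle with an interface point\<close>

definition supersol where
  "supersol d a A B c T s z \<longleftrightarrow>
     continuous_on ({A..B} \<times> {T..}) (\<lambda>(x, t). z x t) \<and>
     (\<exists>zx zxx zt. \<forall>t>T::real.
        (\<forall>x\<in>{A..B}. ((\<lambda>y. z y t) has_real_derivative zx x t) (at x within {A..B})) \<and>
        (\<forall>x\<in>{A<..<B} - {c}.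
            ((\<lambda>y. zx y t) has_real_derivative zxx x t) (at x) \<and>
            ((\<lambda>\<tau>. z x \<tau>) has_real_derivative zt x t) (at t) \<and>
            zt x t \<ge> d * zxx x t - a * zx x t + s x t) \<and>
        d * zx A t \<le> a * z A t \<and> zx B t \<ge> (0::real))"

lemma supersolI:
  fixes T :: real
  assumes "continuous_on ({A..B} \<times> {T..}) (\<lambda>(x, t). z x t)"
    and "\<And>x t. t > T \<Longrightarrow> x \<in> {A..B} \<Longrightarrow> ((\<lambda>y. z y t) has_real_derivative zx x t) (at x within {A..B})"
    and "\<And>x t. t > T \<Longrightarrow> x \<in> {A<..<B} - {c} \<Longrightarrow> ((\<lambda>y. zx y t) has_real_derivative zxx x t) (at x)"
    and "\<And>x t. t > T \<Longrightarrow> x \<in> {A<..<B} - {c} \<Longrightarrow> ((\<lambda>\<tau>. z x \<tau>) has_real_derivative zt x t) (at t)"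
    and "\<And>x t. t > T \<Longrightarrow> x \<in> {A<..<B} - {c} \<Longrightarrow> zt x t \<ge> d * zxx x t - a * zx x t + s x t"
    and "\<And>t. t > T \<Longrightarrow> d * zx A t \<le> a * z A t" "\<And>t. t > T \<Longrightarrow> zx B t \<ge> 0"
  shows "supersol d a A B c T s z"
  unfolding supersol_def
  by (intro conjI exI[of _ zx] exI[of _ zxx] exI[of _ zt] allI impI ballI) (fact assms | rule assms; assumption)+

lemma supersol_add:
  assumes "supersol d a A B c T s1 z1" "supersol d a A B c T s2 z2"
  shows "supersol d a A B c T (\<lambda>x t. s1 x t + s2 x t) (\<lambda>x t. z1 x t + z2 x t)"
proof -
  obtain zx zxx zt where 1: "\<forall>t>T.
        (\<forall>x\<in>{A..B}. ((\<lambda>y. z1 y t) has_real_derivative zx x t) (at x within {A..B})) \<and>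
        (\<forall>x\<in>{A<..<B} - {c}.
            ((\<lambda>y. zx y t) has_real_derivative zxx x t) (at x) \<and>
            ((\<lambda>\<tau>. z1 x \<tau>) has_real_derivative zt x t) (at t) \<and>
            zt x t \<ge> d * zxx x t - a * zx x t + s1 x t) \<and>
        d * zx A t \<le> a * z1 A t \<and> zx B t \<ge> (0::real)"
    and c1: "continuous_on ({A..B} \<times> {T..}) (\<lambda>(x, t). z1 x t)"
    using assms(1) unfolding supersol_def by blast
  obtain yx yxx yt where 2: "\<forall>t>T.
        (\<forall>x\<in>{A..B}. ((\<lambda>y. z2 y t) has_real_derivative yx x t) (at x within {A..B})) \<and>
        (\<forall>x\<in>{A<..<B} - {c}.
            ((\<lambda>y. yx y t) has_real_derivative yxx x t) (at x) \<and>
            ((\<lambda>\<tau>. z2 x \<tau>) has_real_derivative yt x t) (at t) \<and>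
            yt x t \<ge> d * yxx x t - a * yx x t + s2 x t) \<and>
        d * yx A t \<le> a * z2 A t \<and> yx B t \<ge> (0::real)"
    and c2: "continuous_on ({A..B} \<times> {T..}) (\<lambda>(x, t). z2 x t)"
    using assms(2) unfolding supersol_def by blast
  have "continuous_on ({A..B} \<times> {T..}) (\<lambda>(x, t). z1 x t + z2 x t)"
    using continuous_on_add[OF c1 c2] by (simp add: case_prod_beta')
  moreover have "\<forall>t>T.
        (\<forall>x\<in>{A..B}. ((\<lambda>y. z1 y t + z2 y t) has_real_derivative zx x t + yx x t) (at x within {A..B})) \<and>
        (\<forall>x\<in>{A<..<B} - {c}.
            ((\<lambda>y. zx y t + yx y t) has_real_derivative zxx x t + yxx x t) (at x) \<and>
            ((\<lambda>\<tau>. z1 x \<tau> + z2 x \<tau>) has_real_derivative zt x t + yt x t) (at t) \<and>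
            zt x t + yt x t \<ge> d * (zxx x t + yxx x t) - a * (zx x t + yx x t) + (s1 x t + s2 x t)) \<and>
        d * (zx A t + yx A t) \<le> a * (z1 A t + z2 A t) \<and> zx B t + yx B t \<ge> 0"
  proof (intro allI impI conjI ballI)
    fix t assume t: "t > T"
    note h1 = 1[rule_format, OF t] and h2 = 2[rule_format, OF t]
    show "((\<lambda>y. z1 y t + z2 y t) has_real_derivative zx x t + yx x t) (at x within {A..B})"
      if "x \<in> {A..B}" for x by (rule DERIV_add) (use h1 h2 that in auto)
    show "d * (zx A t + yx A t) \<le> a * (z1 A t + z2 A t)" "zx B t + yx B t \<ge> 0"
      using h1 h2 by (auto simp: algebra_simps)
    fix x assume x: "x \<in> {A<..<B} - {c}"
    show "((\<lambda>y. zx y t + yx y t) has_real_derivative zxx x t + yxx x t) (at x)"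
         "((\<lambda>\<tau>. z1 x \<tau> + z2 x \<tau>) has_real_derivative zt x t + yt x t) (at t)"
      by (rule DERIV_add; use h1 h2 x in blast)+
    have "zt x t \<ge> d * zxx x t - a * zx x t + s1 x t" "yt x t \<ge> d * yxx x t - a * yx x t + s2 x t"
      using h1 h2 x by blast+
    then show "zt x t + yt x t \<ge> d * (zxx x t + yxx x t) - a * (zx x t + yx x t) + (s1 x t + s2 x t)"
      by (simp add: algebra_simps)
  qed
  ultimately show ?thesis unfolding supersol_def
    by (intro conjI exI[of _ "\<lambda>x t. zx x t + yx x t"] exI[of _ "\<lambda>x t. zxx x t + yxx x t"]
        exI[of _ "\<lambda>x t. zt x t + yt x t"])
qed

lemma supersol_later:
  assumes "supersol d a A B c T s z" "T \<le> T'"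
  shows "supersol d a A B c T' s z"
proof -
  obtain zx zxx zt where Z: "\<forall>t>T.
        (\<forall>x\<in>{A..B}. ((\<lambda>y. z y t) has_real_derivative zx x t) (at x within {A..B})) \<and>
        (\<forall>x\<in>{A<..<B} - {c}.
            ((\<lambda>y. zx y t) has_real_derivative zxx x t) (at x) \<and>
            ((\<lambda>\<tau>. z x \<tau>) has_real_derivative zt x t) (at t) \<and>
            zt x t \<ge> d * zxx x t - a * zx x t + s x t) \<and>
        d * zx A t \<le> a * z A t \<and> zx B t \<ge> (0::real)"
    and cz: "continuous_on ({A..B} \<times> {T..}) (\<lambda>(x, t). z x t)"
    using assms(1) unfolding supersol_def by blast
  have "continuous_on ({A..B} \<times> {T'..}) (\<lambda>(x, t). z x t)"
    by (rule continuous_on_subset[OF cz]) (use assms(2) in auto)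
  then show ?thesis unfolding supersol_def
    by (intro conjI exI[of _ zx] exI[of _ zxx] exI[of _ zt] allI impI Z[rule_format])
       (use assms(2) in auto)
qed

lemma supersol_time_only:
  fixes N N' :: "real \<Rightarrow> real"
  assumes "a \<ge> 0" "continuous_on {T..} N" "\<And>t. t > T \<Longrightarrow> (N has_real_derivative N' t) (at t)"
    and "\<And>t. t > T \<Longrightarrow> N t \<ge> 0"
  shows "supersol d a A B c T (\<lambda>x t. N' t) (\<lambda>x t. N t)"
proof -
  have "continuous_on ({A..B} \<times> {T..}) (\<lambda>(x, t). N t)"
    unfolding case_prod_beta
    by (rule continuous_on_compose2[OF assms(2) continuous_on_snd]) (auto intro!: continuous_intros)
  then show ?thesis using assms unfolding supersol_def
    by (intro conjI exI[of _ "\<lambda>x t. 0"] exI[of _ "\<lambda>x t. N' t"]) auto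
qed

text \<open>The derivative of the bump drops at \<open>c\<close> and has the strict sign at the ends, so that a
  first touching point lies neither on the boundary nor on the interface.\<close>
definition kink :: "real \<Rightarrow> real \<Rightarrow> real \<Rightarrow> real \<Rightarrow> real" where
  "kink A B c x = (if x \<le> c then (x - A) * (x - c) else (x - c) * (x - B))"

lemma kink_bounds:
  assumes "A \<le> c" "c < B" "x \<in> {A..B}"
  shows "kink A B c x \<le> 0" "kink A B c x \<ge> - (B - A)\<^sup>2"
proof -
  show "kink A B c x \<le> 0" using assms
    by (auto simp: kink_def mult_nonneg_nonpos)
  have "(x - A) * (c - x) \<le> (B - A) * (B - A)" if "x \<le> c"
    using assms that by (intro mult_mono) auto
  moreover have "(x - c) * (B - x) \<le> (B - A) * (B - A)" if "x > c"
    using assms that by (intro mult_mono) auto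
  ultimately show "kink A B c x \<ge> - (B - A)\<^sup>2"
    by (auto simp: kink_def power2_eq_square algebra_simps)
qed

lemma kink_continuous: "continuous_on UNIV (kink A B c)"
proof -
  have "continuous_on ({..c} \<union> {c..}) (\<lambda>x. if x \<le> c then (x - A) * (x - c) else (x - c) * (x - B))"
    by (rule continuous_on_If) (auto intro!: continuous_intros)
  moreover have "{..c} \<union> {c..} = (UNIV::real set)" by auto
  ultimately show ?thesis unfolding kink_def[abs_def] by simp
qed

lemma kink_deriv_left:
  assumes "A \<le> x" "x \<le> c"
  shows "(kink A B c has_real_derivative (2 * x - A - c)) (at x within {A..c})"
proof -
  have "((\<lambda>x. (x - A) * (x - c)) has_real_derivative (2 * x - A - c)) (at x within {A..c})"
    by (auto intro!: derivative_eq_intros)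
  then show ?thesis
    by (rule has_field_derivative_transform_within[where d=1]) (use assms in \<open>auto simp: kink_def\<close>)
qed

lemma kink_deriv_right:
  assumes "c \<le> x" "x \<le> B"
  shows "(kink A B c has_real_derivative (2 * x - B - c)) (at x within {c..B})"
proof -
  have "((\<lambda>x. (x - c) * (x - B)) has_real_derivative (2 * x - B - c)) (at x within {c..B})"
    by (auto intro!: derivative_eq_intros)
  then show ?thesis
    by (rule has_field_derivative_transform_within[where d=1]) (use assms in \<open>auto simp: kink_def\<close>)
qed

lemma first_touching:
  fixes y :: "real \<Rightarrow> real \<Rightarrow> real"
  assumes cont: "continuous_on ({A..B} \<times> {T..T1}) (\<lambda>(x, t). y x t)"
    and pos: "\<And>x. x \<in> {A..B} \<Longrightarrow> y x T > 0"
    and bad: "x1 \<in> {A..B}" "t1 \<in> {T..T1}" "y x1 t1 \<le> 0"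
  obtains x t where "x \<in> {A..B}" "t \<in> {T<..T1}" "y x t = 0"
    "\<And>x'. x' \<in> {A..B} \<Longrightarrow> y x' t \<ge> 0" "\<And>x' s. x' \<in> {A..B} \<Longrightarrow> T \<le> s \<Longrightarrow> s < t \<Longrightarrow> y x' s > 0"
proof -
  define S where "S = {p \<in> {A..B} \<times> {T..T1}. (\<lambda>(x, t). y x t) p \<le> 0}"
  have "compact ({A..B} \<times> {T..T1})" by (intro compact_Times) auto
  moreover have "closed (({A..B} \<times> {T..T1}) \<inter> (\<lambda>(x, t). y x t) -` {..0})"
    by (rule continuous_closed_preimage[OF cont]) (auto intro!: closed_Times)
  moreover have "S = ({A..B} \<times> {T..T1}) \<inter> (({A..B} \<times> {T..T1}) \<inter> (\<lambda>(x, t). y x t) -` {..0})"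
    by (auto simp: S_def)
  ultimately have "compact S" using compact_Int_closed by metis
  moreover have "S \<noteq> {}" using bad by (auto simp: S_def)
  ultimately obtain p where p: "p \<in> S" "\<And>q. q \<in> S \<Longrightarrow> snd p \<le> snd q"
    using continuous_attains_inf[of S snd] continuous_on_snd[OF continuous_on_id, of S] by (auto simp: id_def)
  obtain x t where pe: "p = (x, t)" by force
  have xt: "x \<in> {A..B}" "t \<in> {T..T1}" "y x t \<le> 0" using p pe by (auto simp: S_def)
  have before: "y x' s > 0" if "x' \<in> {A..B}" "T \<le> s" "s < t" for x' s
    using p(2)[of "(x',s)"] that xt pe by (force simp: S_def)
  have tT: "t > T" using xt pos[of x] by (metis atLeastAtMost_iff leD less_eq_real_def)
  have at: "y x' t \<ge> 0" if x': "x' \<in> {A..B}" for x'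
  proof -
    have c: "continuous_on {T..t} (\<lambda>s. (\<lambda>(x, t). y x t) (x', s))"
      by (rule continuous_on_compose2[OF cont]) (use x' xt in \<open>auto intro!: continuous_intros\<close>)
    then have "((\<lambda>s. y x' s) \<longlongrightarrow> y x' t) (at t within {T..t})"
      using tT by (auto simp: continuous_on_def)
    then have "((\<lambda>s. y x' s) \<longlongrightarrow> y x' t) (at_left t)"
      using tT by (simp add: at_within_Icc_at_left)
    moreover have "eventually (\<lambda>s. y x' s \<ge> 0) (at_left t)"
      using eventually_at_left_real[OF tT] by eventually_elim (use before x' in \<open>auto intro: less_imp_le\<close>)
    ultimately show ?thesis by (intro tendsto_lowerbound) auto
  qed
  show ?thesis
    by (rule that[of x t]) (use xt tT at before in \<open>auto intro: order.antisym\<close>)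
qed

lemma weak_maximum_principle:
  assumes "d > 0" "a \<ge> 0" "A \<le> c" "c < B" "K \<ge> 0"
    and sup: "supersol d a A B c T s z"
    and init: "\<And>x. x \<in> {A..B} \<Longrightarrow> z x T \<ge> 0"
    and src: "\<And>x t. x \<in> {A<..<B} - {c} \<Longrightarrow> T < t \<Longrightarrow> t \<le> T1 \<Longrightarrow> z x t < 0 \<Longrightarrow> s x t \<ge> K * z x t"
    and x: "x \<in> {A..B}" and t: "t \<in> {T..T1}"
  shows "z x t \<ge> 0"
proof (rule ccontr)
  assume neg: "\<not> z x t \<ge> 0"
  define l where "l = B - A"
  have l: "l > 0" using assms by (simp add: l_def)
  define \<eta> where "\<eta> = 1 / (2 * l\<^sup>2)"
  have \<eta>: "\<eta> > 0" using l by (simp add: \<eta>_def)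
  define \<Lambda> where "\<Lambda> = 2 * (2 * d * \<eta> + a * \<eta> * l + K) + 1"
  define \<epsilon> where "\<epsilon> = - z x t / exp (\<Lambda> * (t - T))"
  have \<epsilon>: "\<epsilon> > 0" using neg by (simp add: \<epsilon>_def divide_neg_pos)
  define g where "g = kink A B c"
  define E where "E t = \<epsilon> * exp (\<Lambda> * (t - T))" for t
  have Epos: "E t > 0" for t using \<epsilon> by (simp add: E_def)
  have hg: "1 + \<eta> * g x \<ge> 1/2" "1 + \<eta> * g x \<le> 1" if "x \<in> {A..B}" for x
  proof -
    have "g x \<le> 0" "g x \<ge> - l\<^sup>2" using kink_bounds[of A c B x] assms that by (auto simp: g_def l_def)
    then have "\<eta> * g x \<ge> \<eta> * (- l\<^sup>2)" "\<eta> * g x \<le> 0" using \<eta> 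
      by (intro mult_left_mono mult_nonneg_nonpos; simp)+
    moreover have "\<eta> * (- l\<^sup>2) = - 1/2" using l by (simp add: \<eta>_def)
    ultimately show "1 + \<eta> * g x \<ge> 1/2" "1 + \<eta> * g x \<le> 1" by auto
  qed
  define y where "y x t = z x t + E t * (1 + \<eta> * g x)" for x t
  obtain zx zxx zt where Z: "\<And>t. t > T \<Longrightarrow>
        (\<forall>x\<in>{A..B}. ((\<lambda>y. z y t) has_real_derivative zx x t) (at x within {A..B})) \<and>
        (\<forall>x\<in>{A<..<B} - {c}.
            ((\<lambda>y. zx y t) has_real_derivative zxx x t) (at x) \<and>
            ((\<lambda>\<tau>. z x \<tau>) has_real_derivative zt x t) (at t) \<and>
            zt x t \<ge> d * zxx x t - a * zx x t + s x t) \<and>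
        d * zx A t \<le> a * z A t \<and> zx B t \<ge> (0::real)"
    and contz: "continuous_on ({A..B} \<times> {T..}) (\<lambda>(x, t). z x t)"
    using sup unfolding supersol_def by blast
  have conty: "continuous_on ({A..B} \<times> {T..T1}) (\<lambda>(x, t). y x t)"
  proof -
    have "continuous_on ({A..B} \<times> {T..T1}) (\<lambda>p. z (fst p) (snd p))"
      using continuous_on_subset[OF contz, of "{A..B} \<times> {T..T1}"] by (force simp: case_prod_beta')
    moreover have "continuous_on ({A..B} \<times> {T..T1}) (\<lambda>p. g (fst p))"
      unfolding g_def by (rule continuous_on_compose2[OF kink_continuous]) (auto intro!: continuous_intros)
    ultimately show ?thesis unfolding y_def E_def case_prod_beta'
      by (intro continuous_intros)
  qed
  have y0: "y x T > 0" if "x \<in> {A..B}" for x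
  proof -
    have "0 < E T * (1 + \<eta> * g x)" using hg[OF that] Epos[of T] by (intro mult_pos_pos) auto
    then show ?thesis using init[OF that] unfolding y_def by simp
  qed
  have Et: "E t = - z x t" using neg by (simp add: E_def \<epsilon>_def)
  have "y x t \<le> 0"
    unfolding y_def using mult_left_mono[OF hg(2)[OF x], of "E t"] Epos[of t] Et by simp
  from first_touching[OF conty y0 x t this]
  obtain x0 t0 where x0: "x0 \<in> {A..B}" and t0: "t0 \<in> {T<..T1}" and y00: "y x0 t0 = 0"
    and ymin: "\<And>x'. x' \<in> {A..B} \<Longrightarrow> y x' t0 \<ge> 0"
    and ybefore: "\<And>x' s. x' \<in> {A..B} \<Longrightarrow> T \<le> s \<Longrightarrow> s < t0 \<Longrightarrow> y x' s > 0"
    by blast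
  have tT: "t0 > T" using t0 by simp
  note Z0 = Z[OF tT]
  have zneg: "z x0 t0 = - E t0 * (1 + \<eta> * g x0)" using y00 by (simp add: y_def)
  have zneg': "z x0 t0 < 0" unfolding zneg using hg[OF x0] Epos[of t0] 
    by (simp add: mult_pos_pos)
  have dyl: "((\<lambda>x. y x t0) has_real_derivative zx x t0 + E t0 * (\<eta> * (2 * x - A - c))) (at x within {A..c})"
    if "x \<in> {A..c}" for x
  proof -
    have 1: "((\<lambda>y. z y t0) has_real_derivative zx x t0) (at x within {A..c})"
      by (rule has_field_derivative_subset[of _ _ x "{A..B}"]) (use Z0 that assms in auto)
    have 2: "(g has_real_derivative (2 * x - A - c)) (at x within {A..c})"
      unfolding g_def using that by (intro kink_deriv_left) auto
    show ?thesis unfolding y_def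
      by (rule derivative_eq_intros 1 2 refl)+ simp
  qed
  have dyr: "((\<lambda>x. y x t0) has_real_derivative zx x t0 + E t0 * (\<eta> * (2 * x - B - c))) (at x within {c..B})"
    if "x \<in> {c..B}" for x
  proof -
    have 1: "((\<lambda>y. z y t0) has_real_derivative zx x t0) (at x within {c..B})"
      by (rule has_field_derivative_subset[of _ _ x "{A..B}"]) (use Z0 that assms in auto)
    have 2: "(g has_real_derivative (2 * x - B - c)) (at x within {c..B})"
      unfolding g_def using that by (intro kink_deriv_right) auto
    show ?thesis unfolding y_def
      by (rule derivative_eq_intros 1 2 refl)+ simp
  qed
  have zxA: "zx A t0 \<le> 0" if "x0 = A"
  proof -
    have "d * zx A t0 \<le> a * z A t0" using Z0 by blast
    also have "\<dots> \<le> 0" using zneg' that assms by (simp add: mult_nonneg_nonpos)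
    finally show "zx A t0 \<le> 0" using assms by (simp add: mult_le_0_iff)
  qed
  consider "x0 = A" | "x0 = B" | "A < c" "x0 = c" | "x0 \<in> {A<..<c}" | "x0 \<in> {c<..<B}"
    using x0 assms by (cases "x0 < c") fastforce+
  then show False
  proof cases
    case 1
    from zxA[OF 1] have neg: "zx A t0 \<le> 0" .
    show False
    proof (cases "A < c")
      case True
      have "zx A t0 + E t0 * (\<eta> * (2 * A - A - c)) \<ge> 0"
        by (rule min_left_end_deriv_nonneg[OF True dyl]) (use True 1 y00 ymin assms in auto)
      moreover have "E t0 * (\<eta> * (2 * A - A - c)) < 0"
        using True Epos[of t0] \<eta> by (simp add: mult_pos_neg)
      ultimately show False using neg by simp
    next
      case False
      then have c: "c = A" using assms by simp
      have "zx c t0 + E t0 * (\<eta> * (2 * c - B - c)) \<ge> 0"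
        by (rule min_left_end_deriv_nonneg[OF \<open>c < B\<close> dyr]) (use c 1 y00 ymin assms in auto)
      moreover have "E t0 * (\<eta> * (2 * c - B - c)) < 0"
        using Epos[of t0] \<eta> assms by (simp add: mult_pos_neg)
      ultimately show False using neg c by simp
    qed
  next
    case 2
    have "zx B t0 + E t0 * (\<eta> * (2 * B - B - c)) \<le> 0"
      by (rule min_right_end_deriv_nonpos[OF \<open>c < B\<close> dyr]) (use 2 y00 ymin assms in auto)
    moreover have "E t0 * (\<eta> * (2 * B - B - c)) > 0" "zx B t0 \<ge> 0"
      using Epos[of t0] \<eta> assms Z0 by auto
    ultimately show False by simp
  next
    case 3
    have "zx c t0 + E t0 * (\<eta> * (2 * c - B - c)) \<ge> 0"
      by (rule min_left_end_deriv_nonneg[OF \<open>c < B\<close> dyr]) (use 3 y00 ymin assms in auto)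
    moreover have "E t0 * (\<eta> * (2 * c - B - c)) < 0"
      using Epos[of t0] \<eta> assms by (simp add: mult_pos_neg)
    moreover have "zx c t0 + E t0 * (\<eta> * (2 * c - A - c)) \<le> 0"
      by (rule min_right_end_deriv_nonpos[OF \<open>A < c\<close> dyl]) (use 3 y00 ymin assms in auto)
    moreover have "E t0 * (\<eta> * (2 * c - A - c)) > 0"
      using Epos[of t0] \<eta> 3 by simp
    ultimately show False by simp
  next
    have key: False if ab: "x0 \<in> {\<alpha><..<\<beta>}" "{\<alpha><..<\<beta>} \<subseteq> {A<..<B} - {c}"
      and dy: "\<And>x. x \<in> {\<alpha><..<\<beta>} \<Longrightarrow> ((\<lambda>x. y x t0) has_real_derivative zx x t0 + E t0 * (\<eta> * (2 * x - \<mu>))) (at x)"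
      and \<mu>: "\<bar>2 * x0 - \<mu>\<bar> \<le> l" for \<alpha> \<beta> \<mu>
    proof -
      have x0': "x0 \<in> {A<..<B} - {c}" using ab by blast
      have d2: "((\<lambda>x. zx x t0 + E t0 * (\<eta> * (2 * x - \<mu>))) has_real_derivative zxx x0 t0 + E t0 * (\<eta> * 2)) (at x0)"
        using Z0 x0' by (auto intro!: derivative_eq_intros)
      have m: "y x0 t0 \<le> y x t0" if "x \<in> {\<alpha><..<\<beta>}" for x 
        using ymin[of x] y00 that ab(2) by fastforce
      have e1: "zx x0 t0 + E t0 * (\<eta> * (2 * x0 - \<mu>)) = 0"
        and e2: "zxx x0 t0 + E t0 * (\<eta> * 2) \<ge> 0"
        using interior_min_derivs[OF _ _ dy d2 m] ab by auto
      have dt: "((\<lambda>\<tau>. y x0 \<tau>) has_real_derivative zt x0 t0 + \<Lambda> * E t0 * (1 + \<eta> * g x0)) (at t0)"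
        unfolding y_def E_def using Z0 x0' by (auto intro!: derivative_eq_intros)
      have e3: "zt x0 t0 + \<Lambda> * E t0 * (1 + \<eta> * g x0) \<le> 0"
      proof (rule first_time_min_deriv_nonpos[OF tT dt])
        fix s assume "T \<le> s" "s \<le> t0"
        then show "y x0 t0 \<le> y x0 s" using ybefore[of x0 s] x0 y00 by (cases "s = t0") auto
      qed
      have "\<Lambda> * E t0 * (1 + \<eta> * g x0) \<ge> \<Lambda> * E t0 * (1/2)"
        using hg[OF x0] Epos[of t0] \<eta> assms l
        by (intro mult_left_mono mult_nonneg_nonneg) (auto simp: \<Lambda>_def)
      then have e4: "zt x0 t0 \<le> - (\<Lambda> / 2) * E t0" using e3 by simp
      have "s x0 t0 \<ge> K * z x0 t0" using src[OF x0'] t0 zneg' by auto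
      moreover have "K * z x0 t0 \<ge> - K * E t0"
      proof -
        have "z x0 t0 \<ge> - E t0"
          using mult_left_mono[OF hg(2)[OF x0], of "E t0"] Epos[of t0] zneg by simp
        then show ?thesis using mult_left_mono[of "- E t0" "z x0 t0" K] assms by simp
      qed
      moreover have "d * zxx x0 t0 \<ge> d * (- 2 * \<eta> * E t0)"
        using e2 assms(1) by (intro mult_left_mono) (simp_all add: algebra_simps)
      moreover have "a * zx x0 t0 \<le> a * (\<eta> * l * E t0)"
      proof (rule mult_left_mono)
        have "zx x0 t0 = E t0 * \<eta> * (\<mu> - 2 * x0)" using e1 by (simp add: algebra_simps)
        also have "\<dots> \<le> E t0 * \<eta> * l" using \<mu> Epos[of t0] \<eta> by (intro mult_left_mono) auto
        finally show "zx x0 t0 \<le> \<eta> * l * E t0" by (simp add: mult_ac)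
      qed (use assms in auto)
      moreover have "zt x0 t0 \<ge> d * zxx x0 t0 - a * zx x0 t0 + s x0 t0" using Z0 x0' by blast
      ultimately have "- (\<Lambda> / 2) * E t0 \<ge> - (2 * d * \<eta> + a * \<eta> * l + K) * E t0"
        using e4 by (simp add: algebra_simps)
      then have "- (\<Lambda> / 2) \<ge> - (2 * d * \<eta> + a * \<eta> * l + K)"
        using Epos[of t0] mult_le_cancel_right_pos by blast
      then show False by (simp add: \<Lambda>_def field_simps)
    qed
    {
      case 4
      show False
      proof (rule key[of A c "A + c"])
        fix x assume x: "x \<in> {A<..<c}"
        then have "((\<lambda>x. y x t0) has_real_derivative zx x t0 + E t0 * (\<eta> * (2 * x - A - c))) (at x within {A..c})"
          by (intro dyl) auto
        moreover have "at x within {A..c} = at x" using x by (intro at_within_Icc_at) auto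
        ultimately show "((\<lambda>x. y x t0) has_real_derivative zx x t0 + E t0 * (\<eta> * (2 * x - (A + c)))) (at x)"
          by (simp add: algebra_simps)
      qed (use 4 assms l_def in auto)
    next
      case 5
      show False
      proof (rule key[of c B "B + c"])
        fix x assume x: "x \<in> {c<..<B}"
        then have "((\<lambda>x. y x t0) has_real_derivative zx x t0 + E t0 * (\<eta> * (2 * x - B - c))) (at x within {c..B})"
          by (intro dyr) auto
        moreover have "at x within {c..B} = at x" using x by (intro at_within_Icc_at) auto
        ultimately show "((\<lambda>x. y x t0) has_real_derivative zx x t0 + E t0 * (\<eta> * (2 * x - (B + c)))) (at x)"
          by (simp add: algebra_simps)
      qed (use 5 assms l_def in auto)
    }
  qed
qed

lemma continuous_on_Icc_bounded:
  fixes f :: "real \<Rightarrow> real"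
  assumes "continuous_on {A..B} f"
  obtains M where "M > 0" "\<And>x. x \<in> {A..B} \<Longrightarrow> \<bar>f x\<bar> \<le> M"
proof -
  have "compact (f ` {A..B})" using assms by (intro compact_continuous_image) auto
  then obtain M where "\<forall>y\<in>f ` {A..B}. norm y \<le> M"
    using compact_imp_bounded bounded_iff by metis
  then have "\<bar>f x\<bar> \<le> max M 1" if "x \<in> {A..B}" for x using that by force
  then show thesis using that[of "max M 1"] by simp
qed

lemma supersol_eventually_ge:
  assumes "d > 0" "a \<ge> 0" "A \<le> c" "c < B" "k > 0" "\<epsilon> \<ge> 0" "e > 0"
    and sup: "supersol d a A B c T s z"
    and src: "\<And>x t. x \<in> {A<..<B} - {c} \<Longrightarrow> T < t \<Longrightarrow> s x t \<ge> - k * z x t - \<epsilon>"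
  shows "\<exists>T'. \<forall>t\<ge>T'. \<forall>x\<in>{A..B}. z x t \<ge> - (\<epsilon> / k) - e"
proof -
  have "continuous_on ({A..B} \<times> {T..}) (\<lambda>(x, t). z x t)" using sup by (simp add: supersol_def)
  then have "continuous_on {A..B} (\<lambda>x. (\<lambda>(x, t). z x t) (x, T))"
    by (rule continuous_on_compose2) (auto intro!: continuous_intros)
  then obtain M where M0: "M > 0" "\<And>x. x \<in> {A..B} \<Longrightarrow> \<bar>z x T\<bar> \<le> M"
    using continuous_on_Icc_bounded[of A B "\<lambda>x. z x T"] by auto
  have M: "M > 0" "\<And>x. x \<in> {A..B} \<Longrightarrow> z x T \<ge> - M" using M0 by force+
  define N where "N t = M * exp (- k * (t - T)) + \<epsilon> / k" for t
  have supN: "supersol d a A B c T (\<lambda>x t. - k * (M * exp (- k * (t - T)))) (\<lambda>x t. N t)"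
    by (rule supersol_time_only) (use assms M in \<open>auto simp: N_def intro!: derivative_eq_intros continuous_intros\<close>)
  have ge: "z x t + N t \<ge> 0" if "x \<in> {A..B}" "t \<ge> T" for x t
  proof (rule weak_maximum_principle[OF assms(1-4) order.refl supersol_add[OF sup supN], of t])
    show "z x T + N T \<ge> 0" if "x \<in> {A..B}" for x
    proof -
      have "\<epsilon> / k \<ge> 0" using assms by simp
      then show ?thesis using M(2)[OF that] by (simp add: N_def)
    qed
    fix x t assume h: "x \<in> {A<..<B} - {c}" "T < t" "z x t + N t < 0"
    have "s x t + - k * (M * exp (- k * (t - T))) \<ge> - k * (z x t + N t)"
      using src[OF h(1,2)] assms by (simp add: N_def algebra_simps)
    moreover have "- k * (z x t + N t) > 0" using h(3) \<open>k > 0\<close> by (intro mult_neg_neg) auto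
    ultimately show "s x t + - k * (M * exp (- k * (t - T))) \<ge> 0 * (z x t + N t)" by simp
  qed (use that in auto)
  define T' where "T' = T + ln (M / e + 1) / k"
  have T': "T' \<ge> T" using M assms by (auto simp: T'_def intro!: divide_nonneg_pos ln_ge_zero)
  have "z x t \<ge> - (\<epsilon> / k) - e" if t: "t \<ge> T'" and x: "x \<in> {A..B}" for x t
  proof -
    have "ln (M / e + 1) \<le> k * (t - T)" using t assms by (simp add: T'_def field_simps)
    then have "exp (ln (M / e + 1)) \<le> exp (k * (t - T))" by simp
    moreover have "M / e + 1 > 0" using M assms by (intro add_pos_pos) auto
    ultimately have "M / e \<le> exp (k * (t - T))" by simp
    then have "M \<le> e * exp (k * (t - T))" using assms by (simp add: field_simps)
    then have "M * exp (- k * (t - T)) \<le> e * exp (k * (t - T)) * exp (- k * (t - T))"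
      by (intro mult_right_mono) auto
    then have "M * exp (- k * (t - T)) \<le> e" by (simp add: mult.assoc exp_add[symmetric])
    then show ?thesis using ge[OF x, of t] t T' by (simp add: N_def)
  qed
  then show ?thesis by blast
qed

section \<open>The stationary problem\<close>

definition bvp where
  "bvp d a A B c s Z \<longleftrightarrow> (\<exists>Z'. (\<forall>x\<in>{A..B}. (Z has_real_derivative Z' x) (at x within {A..B})) \<and>
     continuous_on {A..B} Z' \<and>
     (\<forall>x\<in>{A<..<B} - {c}. (Z' has_real_derivative (a * Z' x - s x) / d) (at x)) \<and>
     d * Z' A = a * Z A \<and> Z' B = (0::real))"

lemma bvp_continuous: "bvp d a A B c s Z \<Longrightarrow> continuous_on {A..B} Z"
  unfolding bvp_def by (meson DERIV_continuous continuous_on_eq_continuous_within)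

lemma bvp_supersol:
  assumes "bvp d a A B c s Z" "d > 0"
  shows "supersol d a A B c T (\<lambda>x t. \<sigma> * s x) (\<lambda>x t. \<sigma> * Z x)"
proof -
  obtain Z' where Z': "\<forall>x\<in>{A..B}. (Z has_real_derivative Z' x) (at x within {A..B})"
     "continuous_on {A..B} Z'"
     "\<forall>x\<in>{A<..<B} - {c}. (Z' has_real_derivative (a * Z' x - s x) / d) (at x)"
     "d * Z' A = a * Z A" "Z' B = 0"
    using assms unfolding bvp_def by blast
  have "continuous_on ({A..B} \<times> {T..}) (\<lambda>(x, t). \<sigma> * Z x)"
    unfolding case_prod_beta
    by (intro continuous_intros continuous_on_compose2[OF bvp_continuous[OF assms(1)] continuous_on_fst])
       (auto intro!: continuous_intros)
  moreover have "d * (\<sigma> * Z' A) \<le> a * (\<sigma> * Z A)" using Z'(4) by (metis mult.left_commute order.refl)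
  moreover have "0 \<ge> d * (\<sigma> * ((a * Z' x - s x) / d)) - a * (\<sigma> * Z' x) + \<sigma> * s x" for x
  proof -
    have "d * ((a * Z' x - s x) / d) = a * Z' x - s x" using assms(2) by simp
    then have "d * (\<sigma> * ((a * Z' x - s x) / d)) = \<sigma> * (a * Z' x - s x)"
      by (metis mult.left_commute)
    then show ?thesis by (simp add: algebra_simps)
  qed
  moreover have "((\<lambda>y. \<sigma> * Z y) has_real_derivative \<sigma> * Z' x) (at x within {A..B})" if "x \<in> {A..B}" for x
    using Z' that by (intro DERIV_cmult) auto
  moreover have "((\<lambda>y. \<sigma> * Z' y) has_real_derivative \<sigma> * ((a * Z' x - s x) / d)) (at x)"
    if "x \<in> {A<..<B} - {c}" for x
    using Z' that by (intro DERIV_cmult) auto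
  moreover have "((\<lambda>\<tau>. \<sigma> * Z x) has_real_derivative 0) (at t)" for x t by simp
  moreover have "\<sigma> * Z' B \<ge> 0" using Z' by simp
  ultimately show ?thesis
    by (intro supersolI[where zx = "\<lambda>x t. \<sigma> * Z' x" and zxx = "\<lambda>x t. \<sigma> * ((a * Z' x - s x) / d)" and zt = "\<lambda>x t. 0"])
qed

lemma stationary_comparison:
  assumes "d > 0" "a \<ge> 0" "A \<le> c" "c < B" "k > 0"
    and sup: "supersol d a A B c T (\<lambda>x t. s x) (\<lambda>x t. z x)"
    and src: "\<And>x. x \<in> {A<..<B} - {c} \<Longrightarrow> s x \<ge> - k * z x"
    and x: "x \<in> {A..B}"
  shows "z x \<ge> 0"
proof (rule ccontr)
  assume "\<not> z x \<ge> 0"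
  then have "- z x / 2 > 0" by simp
  from supersol_eventually_ge[OF assms(1-5) order.refl this sup] src
  have "\<exists>T'. \<forall>t\<ge>T'. \<forall>x'\<in>{A..B}. z x' \<ge> z x / 2" by fastforce
  then have "z x \<ge> z x / 2" using x by blast
  then show False using \<open>\<not> z x \<ge> 0\<close> by simp
qed

text \<open>Piecewise continuity with at most one jump, at \<open>c\<close>; as for \<open>chi\<close>, the value at \<open>c\<close> is the left limit.\<close>
definition pc where
  "pc A B c f \<longleftrightarrow> continuous_on {A..c} f \<and>
     (\<exists>f2. continuous_on {c..B} f2 \<and> (\<forall>x\<in>{c<..B}. f x = (f2 x :: real)))"
  for A B c :: real

lemma pc_continuous_on: "A \<le> c \<Longrightarrow> c \<le> B \<Longrightarrow> continuous_on {A..B} f \<Longrightarrow> pc A B c f"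
  unfolding pc_def by (auto intro!: exI[of _ f] intro: continuous_on_subset)

lemma pc_mult:
  assumes "pc A B c f" "pc A B c g" shows "pc A B c (\<lambda>x. f x * g x)"
proof -
  obtain f2 g2 where "continuous_on {c..B} f2" "\<forall>x\<in>{c<..B}. f x = f2 x"
    "continuous_on {c..B} g2" "\<forall>x\<in>{c<..B}. g x = g2 x" using assms unfolding pc_def by blast
  then show ?thesis using assms unfolding pc_def
    by (auto intro!: exI[of _ "\<lambda>x. f2 x * g2 x"] continuous_intros)
qed

lemma pc_diff:
  assumes "pc A B c f" "pc A B c g" shows "pc A B c (\<lambda>x. f x - g x)"
proof -
  obtain f2 g2 where "continuous_on {c..B} f2" "\<forall>x\<in>{c<..B}. f x = f2 x"
    "continuous_on {c..B} g2" "\<forall>x\<in>{c<..B}. g x = g2 x" using assms unfolding pc_def by blast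
  then show ?thesis using assms unfolding pc_def
    by (auto intro!: exI[of _ "\<lambda>x. f2 x - g2 x"] continuous_intros)
qed

lemma pc_add:
  assumes "pc A B c f" "pc A B c g" shows "pc A B c (\<lambda>x. f x + g x)"
proof -
  obtain f2 g2 where "continuous_on {c..B} f2" "\<forall>x\<in>{c<..B}. f x = f2 x"
    "continuous_on {c..B} g2" "\<forall>x\<in>{c<..B}. g x = g2 x" using assms unfolding pc_def by blast
  then show ?thesis using assms unfolding pc_def
    by (auto intro!: exI[of _ "\<lambda>x. f2 x + g2 x"] continuous_intros)
qed

lemma pc_bounded:
  assumes "A \<le> c" "c \<le> B" "pc A B c f"
  obtains C where "C > 0" "\<And>x. x \<in> {A..B} \<Longrightarrow> \<bar>f x\<bar> \<le> C"
proof -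
  obtain f2 where f2: "continuous_on {c..B} f2" "\<And>x. x \<in> {c<..B} \<Longrightarrow> f x = f2 x"
    using assms unfolding pc_def by blast
  obtain C1 where C1: "C1 > 0" "\<And>x. x \<in> {A..c} \<Longrightarrow> \<bar>f x\<bar> \<le> C1"
    using continuous_on_Icc_bounded[of A c f] assms(3) unfolding pc_def by blast
  obtain C2 where C2: "C2 > 0" "\<And>x. x \<in> {c..B} \<Longrightarrow> \<bar>f2 x\<bar> \<le> C2"
    using continuous_on_Icc_bounded[OF f2(1)] by blast
  show thesis
  proof (rule that[of "max C1 C2"])
    show "\<bar>f x\<bar> \<le> max C1 C2" if "x \<in> {A..B}" for x
      using C1(2)[of x] C2(2)[of x] f2(2)[of x] that by (cases "x \<le> c") auto
  qed (use C1 in auto)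
qed

lemma pc_chi:
  assumes "continuous_on {c..B} g" shows "pc A B c (\<lambda>x. chi c B x * g x)"
proof -
  have "continuous_on {A..c} (\<lambda>x. chi c B x * g x) \<longleftrightarrow> continuous_on {A..c} (\<lambda>x. 0::real)"
    by (rule continuous_on_cong) (auto simp: chi_def)
  then show ?thesis unfolding pc_def using assms by (auto simp: chi_def intro!: exI[of _ g])
qed

lemma pc_integrable:
  assumes "A \<le> c" "c \<le> B" "pc A B c f" shows "f integrable_on {A..B}"
proof -
  obtain f2 where f2: "continuous_on {c..B} f2" "\<And>x. x \<in> {c<..B} \<Longrightarrow> f x = f2 x"
    using assms unfolding pc_def by blast
  have "f integrable_on {A..c}" using assms by (auto simp: pc_def intro: integrable_continuous_real)
  moreover have "f integrable_on {c..B}"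
    by (rule integrable_spike_finite[of "{c}" _ _ f2]) (use f2 in \<open>auto intro: integrable_continuous_real\<close>)
  ultimately show ?thesis using Henstock_Kurzweil_Integration.integrable_combine[OF assms(1,2)] by blast
qed

lemma pc_isCont:
  assumes "pc A B c f" "x \<in> {A<..<B} - {c}" shows "isCont f x"
proof -
  obtain f2 where f2: "continuous_on {c..B} f2" "\<And>x. x \<in> {c<..B} \<Longrightarrow> f x = f2 x"
    using assms unfolding pc_def by blast
  show ?thesis
  proof (cases "x < c")
    case True
    have "continuous_on {A<..<c} f" using assms by (auto simp: pc_def intro: continuous_on_subset)
    then show ?thesis using True assms by (auto simp: continuous_on_eq_continuous_at)
  next
    case False
    have "continuous_on {c<..<B} f2" using f2 by (auto intro: continuous_on_subset)
    then have "continuous_on {c<..<B} f" 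
      by (subst continuous_on_cong[of _ "{c<..<B}" f f2]) (use f2 in auto)
    then show ?thesis using False assms by (auto simp: continuous_on_eq_continuous_at)
  qed
qed

definition fundamental_pair where
  "fundamental_pair d a k A B P P' Q Q' \<omega> \<longleftrightarrow>
     (\<forall>x. (P has_real_derivative P' x) (at x) \<and> (P' has_real_derivative (a * P' x + k * P x) / d) (at x) \<and>
          (Q has_real_derivative Q' x) (at x) \<and> (Q' has_real_derivative (a * Q' x + k * Q x) / d) (at x) \<and>
          P x > 0 \<and> Q x > 0 \<and> P' x * Q x - Q' x * P x = \<omega> * exp (a / d * x)) \<and>
     d * P' A = a * P A \<and> Q' B = 0 \<and> \<omega> > (0::real)"

lemma fundamental_pair_exists:
  fixes d a k A B :: real
  assumes "d > 0" "a \<ge> 0" "k > 0" "A < B"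
  shows "\<exists>P P' Q Q' \<omega>. fundamental_pair d a k A B P P' Q Q' \<omega>"
proof -
  define D where "D = sqrt (a\<^sup>2 + 4 * d * k)"
  have D2: "D\<^sup>2 = a\<^sup>2 + 4 * d * k" using assms by (simp add: D_def)
  have Da: "D > a" unfolding D_def using assms by (intro real_less_rsqrt) simp
  define \<rho> where "\<rho> = (a + D) / (2 * d)"
  define \<nu> where "\<nu> = (D - a) / (2 * d)"
  have pos: "\<rho> > 0" "\<nu> > 0" "\<rho> \<ge> \<nu>" using assms Da by (auto simp: \<rho>_def \<nu>_def divide_right_mono intro!: divide_pos_pos)
  have sum: "d * (\<rho> - \<nu>) = a" using assms by (simp add: \<rho>_def \<nu>_def field_simps)
  have prod: "d * \<rho> * \<nu> = k" 
  proof -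
    have "(a + D) * (D - a) = 4 * d * k" using D2 by (simp add: power2_eq_square algebra_simps)
    moreover have "d * \<rho> * \<nu> = (a + D) * (D - a) / (4 * d)" using assms by (simp add: \<rho>_def \<nu>_def)
    ultimately show ?thesis using assms by simp
  qed
  have r1: "\<rho> * \<rho> = (a * \<rho> + k) / d" and r2: "\<nu> * \<nu> = (- a * \<nu> + k) / d"
    using assms by (auto simp: sum[symmetric] prod[symmetric] field_simps)
  define P where "P x = \<rho> * exp (\<rho> * (x - A)) + \<nu> * exp (- \<nu> * (x - A))" for x
  define P' where "P' x = \<rho> * (\<rho> * exp (\<rho> * (x - A))) - \<nu> * (\<nu> * exp (- \<nu> * (x - A)))" for x
  define Q where "Q x = \<nu> * exp (\<rho> * (x - B)) + \<rho> * exp (- \<nu> * (x - B))" for x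
  define Q' where "Q' x = \<nu> * (\<rho> * exp (\<rho> * (x - B))) - \<rho> * (\<nu> * exp (- \<nu> * (x - B)))" for x
  define \<omega> where "\<omega> = (\<rho> + \<nu>) * (\<rho>\<^sup>2 * exp (- \<rho> * A + \<nu> * B) - \<nu>\<^sup>2 * exp (\<nu> * A - \<rho> * B))"
  have second: "\<rho> * (\<rho> * (\<rho> * u)) + \<nu> * (\<nu> * (\<nu> * v)) = (a * (\<rho> * (\<rho> * u) - \<nu> * (\<nu> * v)) + k * (\<rho> * u + \<nu> * v)) / d" for u v
    using r1 r2 assms(1) by (simp add: field_simps) algebra
  have second': "\<nu> * (\<rho> * (\<rho> * u)) + \<rho> * (\<nu> * (\<nu> * v)) = (a * (\<nu> * (\<rho> * u) - \<rho> * (\<nu> * v)) + k * (\<nu> * u + \<rho> * v)) / d" for u v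
    using r1 r2 assms(1) by (simp add: field_simps) algebra
  have "\<omega> > 0"
  proof -
    have "(\<rho> + \<nu>) * (B - A) > 0" using pos assms by simp
    then have "exp (\<nu> * A - \<rho> * B) < exp (- \<rho> * A + \<nu> * B)" by (simp add: algebra_simps)
    moreover have "\<nu>\<^sup>2 \<le> \<rho>\<^sup>2" using pos by (intro power_mono) auto
    ultimately have "\<nu>\<^sup>2 * exp (\<nu> * A - \<rho> * B) < \<rho>\<^sup>2 * exp (- \<rho> * A + \<nu> * B)"
      using pos by (intro mult_le_less_imp_less) auto
    then show ?thesis using pos by (simp add: \<omega>_def)
  qed
  moreover have "P' x * Q x - Q' x * P x = \<omega> * exp (a / d * x)" for x
  proof -
    have ad: "a / d = \<rho> - \<nu>" using sum assms by (simp add: field_simps)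
    have e: "exp (\<rho> * (x - A)) * exp (- \<nu> * (x - B)) = exp (- \<rho> * A + \<nu> * B) * exp (a / d * x)"
      "exp (- \<nu> * (x - A)) * exp (\<rho> * (x - B)) = exp (\<nu> * A - \<rho> * B) * exp (a / d * x)"
      unfolding ad by (simp_all add: exp_add[symmetric] algebra_simps)
    have "P' x * Q x - Q' x * P x = (\<rho> + \<nu>) * (\<rho>\<^sup>2 * (exp (\<rho> * (x - A)) * exp (- \<nu> * (x - B))) -
       \<nu>\<^sup>2 * (exp (- \<nu> * (x - A)) * exp (\<rho> * (x - B))))"
      by (simp add: P_def P'_def Q_def Q'_def power2_eq_square algebra_simps)
    then show ?thesis unfolding e \<omega>_def by (simp add: algebra_simps)
  qed
  moreover have "(P has_real_derivative P' x) (at x)" "(P' has_real_derivative (a * P' x + k * P x) / d) (at x)"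
    "(Q has_real_derivative Q' x) (at x)" "(Q' has_real_derivative (a * Q' x + k * Q x) / d) (at x)" for x
    unfolding P_def P'_def Q_def Q'_def second[symmetric] second'[symmetric]
    by (auto intro!: derivative_eq_intros simp: algebra_simps)
  moreover have "P x > 0" "Q x > 0" for x using pos by (auto simp: P_def Q_def intro!: add_pos_pos)
  moreover have "d * P' A = a * P A" by (simp add: P'_def P_def sum[symmetric] algebra_simps)
  moreover have "Q' B = 0" by (simp add: Q'_def)
  ultimately show ?thesis unfolding fundamental_pair_def by blast
qed

definition green where
  "green d a A B P Q \<omega> f x =
     (Q x * integral {A..x} (\<lambda>y. P y * exp (- (a / d) * y) * f y) +
      P x * integral {x..B} (\<lambda>y. Q y * exp (- (a / d) * y) * f y)) / (d * \<omega> :: real)"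

context
  fixes d a k A B c :: real and P P' Q Q' \<omega>
  assumes d: "d > 0" and AB: "A \<le> c" "c < B" and fp: "fundamental_pair d a k A B P P' Q Q' \<omega>"
begin

lemma contPQ: "continuous_on X P" "continuous_on X P'" "continuous_on X Q" "continuous_on X Q'"
  using fp unfolding fundamental_pair_def
  by (meson DERIV_isCont continuous_at_imp_continuous_on)+

lemma green_weights_pc: 
  assumes "pc A B c f"
  shows "(\<lambda>y. P y * exp (- (a / d) * y) * f y) integrable_on {A..B}"
        "(\<lambda>y. Q y * exp (- (a / d) * y) * f y) integrable_on {A..B}"
proof -
  have "pc A B c (\<lambda>y. P y * exp (- (a / d) * y))" "pc A B c (\<lambda>y. Q y * exp (- (a / d) * y))"
    using AB by (intro pc_continuous_on continuous_intros contPQ; simp)+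
  then show "(\<lambda>y. P y * exp (- (a / d) * y) * f y) integrable_on {A..B}"
        "(\<lambda>y. Q y * exp (- (a / d) * y) * f y) integrable_on {A..B}"
    using pc_integrable[of A c B, OF _ _ pc_mult[OF _ assms]] AB by auto
qed

lemma green_continuous:
  assumes "(\<lambda>y. P y * exp (- (a / d) * y) * f y) integrable_on {A..B}"
          "(\<lambda>y. Q y * exp (- (a / d) * y) * f y) integrable_on {A..B}"
  shows "continuous_on {A..B} (green d a A B P Q \<omega> f)"
  unfolding green_def
  by (intro continuous_intros contPQ indefinite_integral_continuous_1[OF assms(1)]
      indefinite_integral_continuous_1'[OF assms(2)]) (use d fp in \<open>auto simp: fundamental_pair_def\<close>)

lemma green_bvp:
  assumes f: "pc A B c f"
  shows "bvp d a A B c (\<lambda>x. f x - k * green d a A B P Q \<omega> f x) (green d a A B P Q \<omega> f)"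
proof -
  define p where "p y = P y * exp (- (a / d) * y) * f y" for y
  define q where "q y = Q y * exp (- (a / d) * y) * f y" for y
  have int: "p integrable_on {A..B}" "q integrable_on {A..B}"
    using green_weights_pc[OF f] by (auto simp: p_def[abs_def] q_def[abs_def])
  define I where "I x = integral {A..x} p" for x
  define J where "J x = integral {x..B} q" for x
  have contI: "continuous_on {A..B} I" "continuous_on {A..B} J"
    unfolding I_def J_def by (intro indefinite_integral_continuous_1 indefinite_integral_continuous_1' int)+
  define Z where "Z = green d a A B P Q \<omega> f"
  have Z: "Z x = (Q x * I x + P x * J x) / (d * \<omega>)" for x
    by (simp add: Z_def green_def I_def J_def p_def[abs_def] q_def[abs_def])
  define V where "V x = (Q' x * I x + P' x * J x) / (d * \<omega>)" for x
  have \<omega>: "\<omega> > 0" using fp by (simp add: fundamental_pair_def)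
  have contV: "continuous_on {A..B} V" "continuous_on {A..B} Z"
    unfolding V_def[abs_def] Z[abs_def] by (intro continuous_intros contI contPQ; use d \<omega> in simp)+
  have pq: "P x * q x = Q x * p x" for x by (simp add: p_def q_def)
  have DPQ: "(P has_real_derivative P' x) (at x)" "(P' has_real_derivative (a * P' x + k * P x) / d) (at x)"
          "(Q has_real_derivative Q' x) (at x)" "(Q' has_real_derivative (a * Q' x + k * Q x) / d) (at x)" 
          "P' x * Q x - Q' x * P x = \<omega> * exp (a / d * x)" for x
    using fp by (auto simp: fundamental_pair_def)
  have DIJ: "(I has_real_derivative p x) (at x)" "(J has_real_derivative - q x) (at x)" 
    if x: "x \<in> {A<..<B} - {c}" for x
  proof -
    have cf: "isCont p x" "isCont q x"
      unfolding p_def[abs_def] q_def[abs_def]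
      by (intro continuous_intros pc_isCont[OF f x] DERIV_isCont[OF DPQ(1)] DERIV_isCont[OF DPQ(3)])+
    have at: "at x within {A..B} = at x" using x by (intro at_within_Icc_at) auto
    show "(I has_real_derivative p x) (at x)"
      using integral_has_vector_derivative_continuous_at[OF int(1), of x "{}"] cf x
      unfolding I_def[abs_def] by (auto simp: has_real_derivative_iff_has_vector_derivative at)
    have q: "((\<lambda>u. integral {A..u} q) has_real_derivative q x) (at x)"
      using integral_has_vector_derivative_continuous_at[OF int(2), of x "{}"] cf x
      by (auto simp: has_real_derivative_iff_has_vector_derivative at)
    have Jeq: "integral {A..B} q - integral {A..u} q = J u" if "u \<in> {A<..<B}" for u
      using Henstock_Kurzweil_Integration.integral_combine[of A u B q] int that unfolding J_def by simp
    have "((\<lambda>u. integral {A..B} q - integral {A..u} q) has_real_derivative 0 - q x) (at x)"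
      by (intro DERIV_diff DERIV_const q)
    then have "((\<lambda>u. integral {A..B} q - integral {A..u} q) has_real_derivative - q x) (at x)" by simp
    then show "(J has_real_derivative - q x) (at x)"
      by (rule has_field_derivative_transform_within_open[of _ _ _ "{A<..<B}"]) (use x Jeq in auto)
  qed
  have DZ: "(Z has_real_derivative V x) (at x)" if x: "x \<in> {A<..<B} - {c}" for x
  proof -
    have "((\<lambda>x. (Q x * I x + P x * J x) / (d * \<omega>)) has_real_derivative
       (Q' x * I x + p x * Q x + (P' x * J x + (- q x) * P x)) / (d * \<omega>)) (at x)"
      by (intro DERIV_cdivide DERIV_add DERIV_mult DPQ DIJ x)
    moreover have "(Q' x * I x + p x * Q x + (P' x * J x + (- q x) * P x)) / (d * \<omega>) = V x"
      using pq[of x] by (simp add: V_def mult_ac)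
    ultimately show ?thesis unfolding Z[abs_def] by simp
  qed
  have DV: "(V has_real_derivative (a * V x - (f x - k * Z x)) / d) (at x)" if x: "x \<in> {A<..<B} - {c}" for x
  proof -
    have 1: "((\<lambda>x. (Q' x * I x + P' x * J x) / (d * \<omega>)) has_real_derivative
       (((a * Q' x + k * Q x) / d) * I x + p x * Q' x + (((a * P' x + k * P x) / d) * J x + (- q x) * P' x)) / (d * \<omega>)) (at x)"
      by (intro DERIV_cdivide DERIV_add DERIV_mult DPQ DIJ x)
    have "p x * Q' x - q x * P' x = - (P' x * Q x - Q' x * P x) * exp (- (a / d) * x) * f x"
      by (simp add: p_def q_def algebra_simps)
    also have "\<dots> = - \<omega> * f x" unfolding DPQ(5) by (simp add: exp_minus field_simps)
    finally have 2: "q x * P' x = p x * Q' x + \<omega> * f x" by simp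
    have "(((a * Q' x + k * Q x) / d) * I x + p x * Q' x + (((a * P' x + k * P x) / d) * J x + (- q x) * P' x)) / (d * \<omega>)
       = (a * V x - (f x - k * Z x)) / d"
      unfolding V_def Z mult_minus_left 2 using d \<omega> by (simp add: field_simps)
    then show ?thesis using 1 unfolding V_def[abs_def] by simp
  qed
  have "I A = 0" "J B = 0" by (simp_all add: I_def J_def)
  moreover have "d * P' A = a * P A" "Q' B = 0" using fp by (auto simp: fundamental_pair_def)
  ultimately have bc: "d * V A = a * Z A" "V B = 0"
    by (simp_all add: V_def Z mult.assoc[symmetric])
  have "\<forall>x\<in>{A..B}. (Z has_real_derivative V x) (at x within {A..B})"
    using has_derivative_across_finite[OF _ contV(2,1) DZ] by blast
  then show ?thesis unfolding bvp_def Z_def[symmetric] using contV DV bc by blast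
qed

lemma green_pos:
  assumes "pc A B c f" "\<And>x. x \<in> {A..B} \<Longrightarrow> f x \<ge> \<epsilon>" "\<epsilon> > 0" "x \<in> {A..B}"
  shows "green d a A B P Q \<omega> f x > 0"
proof -
  define w where "w y = P y * exp (- (a / d) * y)" for y
  define v where "v y = Q y * exp (- (a / d) * y)" for y
  have wv: "w y > 0" "v y > 0" for y using fp by (auto simp: w_def v_def fundamental_pair_def)
  have int: "(\<lambda>y. w y * f y) integrable_on {A..B}" "(\<lambda>y. v y * f y) integrable_on {A..B}"
    using green_weights_pc[OF assms(1)] by (auto simp: w_def v_def)
  have cwv: "continuous_on X w" "continuous_on X v" for X
    unfolding w_def[abs_def] v_def[abs_def] by (intro continuous_intros contPQ)+
  have bound: "integral {l..u} (\<lambda>y. g y * f y) \<ge> 0 \<and> (l < u \<longrightarrow> integral {l..u} (\<lambda>y. g y * f y) > 0)"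
    if "{l..u} \<subseteq> {A..B}" "l \<le> u" "\<And>y. g y > 0" "continuous_on {l..u} g" "(\<lambda>y. g y * f y) integrable_on {A..B}" for g :: "real \<Rightarrow> real" and l u
  proof -
    have i: "(\<lambda>y. g y * f y) integrable_on {l..u}" using that(1,5) integrable_on_subinterval by blast
    obtain y0 where y0: "y0 \<in> {l..u}" "\<And>y. y \<in> {l..u} \<Longrightarrow> g y0 \<le> g y"
      using continuous_attains_inf[of "{l..u}" g] \<open>l \<le> u\<close> \<open>continuous_on {l..u} g\<close>
      by (metis atLeastAtMost_iff compact_Icc empty_iff order.refl)
    have "integral {l..u} (\<lambda>y. g y0 * \<epsilon>) \<le> integral {l..u} (\<lambda>y. g y * f y)"
    proof (rule integral_le[OF _ i])
      fix y assume y: "y \<in> {l..u}"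
      then show "g y0 * \<epsilon> \<le> g y * f y"
        using y0(2)[OF y] assms(2)[of y] that(1) that(3)[of y] assms(3) by (intro mult_mono) (auto intro: less_imp_le)
    qed auto
    moreover have "integral {l..u} (\<lambda>y. g y0 * \<epsilon>) = (u - l) * (g y0 * \<epsilon>)"
      unfolding integral_const_real using \<open>l \<le> u\<close> by simp
    ultimately have "(u - l) * (g y0 * \<epsilon>) \<le> integral {l..u} (\<lambda>y. g y * f y)" by linarith
    moreover have "(u - l) * (g y0 * \<epsilon>) \<ge> 0" "l < u \<Longrightarrow> (u - l) * (g y0 * \<epsilon>) > 0"
      using that(2) that(3)[of y0] assms(3) by auto
    ultimately show ?thesis by linarith
  qed
  have PQ: "P x > 0" "Q x > 0" "\<omega> > 0" using fp by (auto simp: fundamental_pair_def)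
  have "integral {A..x} (\<lambda>y. w y * f y) \<ge> 0 \<and> (A < x \<longrightarrow> integral {A..x} (\<lambda>y. w y * f y) > 0)"
    by (rule bound) (use assms(4) wv cwv int in auto)
  moreover have "integral {x..B} (\<lambda>y. v y * f y) \<ge> 0 \<and> (x < B \<longrightarrow> integral {x..B} (\<lambda>y. v y * f y) > 0)"
    by (rule bound) (use assms(4) wv cwv int in auto)
  moreover have "A < x \<or> x < B" using AB assms(4) by auto
  ultimately have "Q x * integral {A..x} (\<lambda>y. w y * f y) + P x * integral {x..B} (\<lambda>y. v y * f y) > 0"
    using PQ by (auto intro: add_pos_nonneg add_nonneg_pos)
  then show ?thesis using d PQ unfolding green_def w_def v_def by (simp add: mult_ac)
qed

lemma green_tendsto:
  assumes f: "\<And>n. pc A B c (f n)" and bd: "\<And>n x. x \<in> {A..B} \<Longrightarrow> \<bar>f n x\<bar> \<le> C"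
    and lim: "\<And>x. x \<in> {A..B} \<Longrightarrow> (\<lambda>n. f n x) \<longlonglongrightarrow> g x"
  shows "continuous_on {A..B} (green d a A B P Q \<omega> g)"
    and "x \<in> {A..B} \<Longrightarrow> (\<lambda>n. green d a A B P Q \<omega> (f n) x) \<longlonglongrightarrow> green d a A B P Q \<omega> g x"
proof -
  have dc: "(\<lambda>y. h y * g y) integrable_on {l..u} \<and>
      (\<lambda>n. integral {l..u} (\<lambda>y. h y * f n y)) \<longlonglongrightarrow> integral {l..u} (\<lambda>y. h y * g y)"
    if h: "continuous_on {A..B} h" and i: "\<And>n. (\<lambda>y. h y * f n y) integrable_on {A..B}" and lu: "{l..u} \<subseteq> {A..B}"
    for h :: "real \<Rightarrow> real" and l u
  proof -
    obtain H where H: "H > 0" "\<And>y. y \<in> {A..B} \<Longrightarrow> \<bar>h y\<bar> \<le> H"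
      using continuous_on_Icc_bounded[OF h] by blast
    have b: "norm (h y * f n y) \<le> H * C" if "y \<in> {l..u}" for n y
      unfolding real_norm_def abs_mult
      using H(1) H(2)[of y] bd[of y n] that lu by (intro mult_mono) auto
    have i': "(\<lambda>y. h y * f n y) integrable_on {l..u}" for n using integrable_on_subinterval[OF i lu] .
    have c': "(\<lambda>y. H * C) integrable_on {l..u}" by (rule integrable_const_ivl)
    have l': "(\<lambda>n. h y * f n y) \<longlonglongrightarrow> h y * g y" if "y \<in> {l..u}" for y
      using lim[of y] that lu by (intro tendsto_mult tendsto_const) auto
    show ?thesis
      using dominated_convergence[of "\<lambda>n y. h y * f n y" "{l..u}" "\<lambda>_. H * C", OF i' c' b l'] by blast
  qed
  have cw: "continuous_on {A..B} (\<lambda>y. P y * exp (- (a / d) * y))" "continuous_on {A..B} (\<lambda>y. Q y * exp (- (a / d) * y))"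
    by (intro continuous_intros contPQ)+
  note dcP = dc[OF cw(1) green_weights_pc(1)[OF f]] and dcQ = dc[OF cw(2) green_weights_pc(2)[OF f]]
  show "continuous_on {A..B} (green d a A B P Q \<omega> g)"
    using dcP[of A B] dcQ[of A B] by (intro green_continuous) auto
  show "(\<lambda>n. green d a A B P Q \<omega> (f n) x) \<longlonglongrightarrow> green d a A B P Q \<omega> g x" if "x \<in> {A..B}"
  proof -
    have "{A..x} \<subseteq> {A..B}" "{x..B} \<subseteq> {A..B}" using that by auto
    note 1 = dcP[OF this(1), THEN conjunct2] and 2 = dcQ[OF this(2), THEN conjunct2]
    show ?thesis unfolding green_def
      by (rule tendsto_divide[OF tendsto_add[OF tendsto_mult[OF tendsto_const 1] tendsto_mult[OF tendsto_const 2]] tendsto_const])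
         (use d fp in \<open>auto simp: fundamental_pair_def\<close>)
  qed
qed

end

lemma monotone_convergence_uniform_on_interval:
  fixes f :: "nat \<Rightarrow> real \<Rightarrow> real"
  assumes cf: "\<And>n. continuous_on {A..B} (f n)" and cg: "continuous_on {A..B} g"
    and mono: "\<And>n x. x \<in> {A..B} \<Longrightarrow> \<bar>f (Suc n) x - g x\<bar> \<le> \<bar>f n x - g x\<bar>"
    and lim: "\<And>x. x \<in> {A..B} \<Longrightarrow> (\<lambda>n. f n x) \<longlonglongrightarrow> g x" and "\<epsilon> > 0"
  shows "\<exists>n. \<forall>x\<in>{A..B}. \<bar>f n x - g x\<bar> < \<epsilon>"
proof (rule ccontr)
  assume no: "\<not> ?thesis"
  define K where "K n = {A..B} \<inter> (\<lambda>x. \<bar>f n x - g x\<bar>) -` {\<epsilon>..}" for n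
  have "closed (K n)" for n unfolding K_def
    by (rule continuous_closed_preimage) (auto intro!: continuous_intros cf cg)
  moreover have "K n = {A..B} \<inter> K n" for n by (auto simp: K_def)
  ultimately have "compact (K n)" for n using compact_Int_closed[of "{A..B}" "K n"] by simp
  moreover have "K n \<noteq> {}" for n using no unfolding K_def by (force simp: not_less)
  moreover have "K n \<subseteq> K m" if "m \<le> n" for m n
  proof -
    have "\<bar>f n x - g x\<bar> \<le> \<bar>f m x - g x\<bar>" if "x \<in> {A..B}" for x
      using lift_Suc_antimono_le[of "\<lambda>n. \<bar>f n x - g x\<bar>" m n] mono that \<open>m \<le> n\<close> by auto
    then show ?thesis unfolding K_def by force
  qed
  ultimately have "(\<Inter>n. K n) \<noteq> {}" by (intro compact_nest) auto
  then obtain x where x: "\<And>n. x \<in> K n" by blast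
  have "x \<in> {A..B}" using x by (auto simp: K_def)
  from LIMSEQ_D[OF lim[OF this] \<open>\<epsilon> > 0\<close>] obtain n where "norm (f n x - g x) < \<epsilon>" by blast
  then show False using x[of n] by (auto simp: K_def)
qed

section \<open>Initial value problems with discontinuous right-hand side\<close>

lemma integral_exp_weight:
  fixes M x :: real
  assumes "M > 0" "x \<ge> 0"
  shows "((\<lambda>z. M * exp (2 * M * z)) has_integral (exp (2 * M * x) - 1) / 2) {0..x}"
proof -
  have "((\<lambda>z. M * exp (2 * M * z)) has_integral (exp (2 * M * x) / 2 - exp (2 * M * 0) / 2)) {0..x}"
    using assms by (intro fundamental_theorem_of_calculus)
      (auto simp: has_real_derivative_iff_has_vector_derivative[symmetric] intro!: derivative_eq_intros)
  then show ?thesis by (simp add: diff_divide_distrib)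
qed

text \<open>Banach's fixed point theorem in the sup norm with weight \<open>exp (- 2 M x)\<close>, in which the
  Picard operator contracts by \<open>1/2\<close>.\<close>
lemma picard_lindeloef:
  fixes F :: "real \<Rightarrow> real \<Rightarrow> real" and X M \<theta>0 :: real
  assumes "X > 0" "M > 0"
    and Lip: "\<And>x y z. x \<in> {0..X} \<Longrightarrow> \<bar>F x y - F x z\<bar> \<le> M * \<bar>y - z\<bar>"
    and int: "\<And>\<psi>. continuous_on {0..X} \<psi> \<Longrightarrow> (\<lambda>x. F x (\<psi> x)) integrable_on {0..X}"
  shows "\<exists>\<theta>. continuous_on {0..X} \<theta> \<and> (\<forall>x\<in>{0..X}. \<theta> x = \<theta>0 + integral {0..x} (\<lambda>z. F z (\<theta> z)))"
proof -
  define cl where "cl x = max 0 (min X x)" for x :: real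
  have cl: "cl x \<in> {0..X}" "x \<in> {0..X} \<Longrightarrow> cl x = x" for x using assms by (auto simp: cl_def)
  have ccl: "continuous_on UNIV cl" unfolding cl_def by (intro continuous_intros)
  define R where "R \<psi> x = exp (- 2 * M * x) * (\<theta>0 + integral {0..x} (\<lambda>z. F z (exp (2 * M * z) * \<psi> z)))"
    for \<psi> :: "real \<Rightarrow> real" and x
  have i: "(\<lambda>z. F z (exp (2 * M * z) * \<psi> z)) integrable_on {0..X}" if "continuous_on {0..X} \<psi>" for \<psi>
    by (rule int) (intro continuous_intros that)
  have cR: "continuous_on {0..X} (R \<psi>)" if "continuous_on {0..X} \<psi>" for \<psi>
    unfolding R_def by (intro continuous_intros indefinite_integral_continuous_1 i that)
  define TT where "TT \<psi> = Bcontfun (\<lambda>x. R (apply_bcontfun \<psi>) (cl x))" for \<psi> :: "real \<Rightarrow>\<^sub>C real"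
  have TT: "apply_bcontfun (TT \<psi>) x = R (apply_bcontfun \<psi>) (cl x)" for \<psi> x
  proof -
    have c0: "continuous_on {0..X} (R (apply_bcontfun \<psi>))" by (intro cR) simp
    obtain K where "\<And>x. x \<in> {0..X} \<Longrightarrow> \<bar>R (apply_bcontfun \<psi>) x\<bar> \<le> K"
      using continuous_on_Icc_bounded[OF c0] by blast
    then have "bounded (range (\<lambda>x. R (apply_bcontfun \<psi>) (cl x)))"
      unfolding bounded_iff using cl by (intro exI[of _ K]) auto
    moreover have "continuous_on UNIV (\<lambda>x. R (apply_bcontfun \<psi>) (cl x))"
      by (rule continuous_on_compose2[OF c0 ccl]) (use cl in auto)
    ultimately have "(\<lambda>x. R (apply_bcontfun \<psi>) (cl x)) \<in> bcontfun" by (simp add: bcontfun_def)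
    then show ?thesis by (simp add: TT_def Bcontfun_inverse)
  qed
  have "dist (TT \<phi>) (TT \<psi>) \<le> 1/2 * dist \<phi> \<psi>" for \<phi> \<psi>
  proof (rule dist_bound)
    fix x0
    define x where "x = cl x0"
    have x: "x \<in> {0..X}" using cl by (simp add: x_def)
    define D where "D = dist \<phi> \<psi>"
    have D: "\<bar>apply_bcontfun \<phi> z - apply_bcontfun \<psi> z\<bar> \<le> D" for z
      using dist_bounded[of \<phi> z \<psi>] by (simp add: D_def dist_real_def)
    have sub: "{0..x} \<subseteq> {0..X}" using x by auto
    note i1 = integrable_on_subinterval[OF i[OF continuous_on_apply_bcontfun, of \<phi>] sub]
     and i2 = integrable_on_subinterval[OF i[OF continuous_on_apply_bcontfun, of \<psi>] sub]
    have w: "((\<lambda>z. M * exp (2 * M * z) * D) has_integral (exp (2 * M * x) - 1) / 2 * D) {0..x}"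
      using integral_exp_weight[of M x] x assms by (intro has_integral_mult_left) auto
    have "\<bar>integral {0..x} (\<lambda>z. F z (exp (2 * M * z) * \<phi> z)) - integral {0..x} (\<lambda>z. F z (exp (2 * M * z) * \<psi> z))\<bar>
      = norm (integral {0..x} (\<lambda>z. F z (exp (2 * M * z) * \<phi> z) - F z (exp (2 * M * z) * \<psi> z)))"
      by (simp add: integral_diff[OF i1 i2])
    also have "\<dots> \<le> integral {0..x} (\<lambda>z. M * exp (2 * M * z) * D)"
    proof (rule integral_norm_bound_integral)
      fix z assume z: "z \<in> {0..x}"
      have "norm (F z (exp (2 * M * z) * \<phi> z) - F z (exp (2 * M * z) * \<psi> z))
        \<le> M * \<bar>exp (2 * M * z) * \<phi> z - exp (2 * M * z) * \<psi> z\<bar>"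
        unfolding real_norm_def by (rule Lip) (use z sub in auto)
      also have "\<bar>exp (2 * M * z) * \<phi> z - exp (2 * M * z) * \<psi> z\<bar> = exp (2 * M * z) * \<bar>\<phi> z - \<psi> z\<bar>"
        by (simp add: right_diff_distrib[symmetric] abs_mult)
      also have "M * (exp (2 * M * z) * \<bar>\<phi> z - \<psi> z\<bar>) \<le> M * (exp (2 * M * z) * D)"
        using D[of z] assms by (intro mult_left_mono) auto
      finally show "norm (F z (exp (2 * M * z) * \<phi> z) - F z (exp (2 * M * z) * \<psi> z)) \<le> M * exp (2 * M * z) * D"
        by (simp add: mult.assoc)
    qed (use integrable_diff[OF i1 i2] w in auto)
    also have "\<dots> = (exp (2 * M * x) - 1) / 2 * D" using w by (rule integral_unique)
    also have "\<dots> \<le> exp (2 * M * x) / 2 * D"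
      by (intro mult_right_mono) (auto simp: D_def)
    finally have "\<bar>R \<phi> x - R \<psi> x\<bar> \<le> exp (- 2 * M * x) * (exp (2 * M * x) / 2 * D)"
      unfolding R_def right_diff_distrib[symmetric] abs_mult
      by (simp add: mult_left_mono)
    also have "\<dots> = 1/2 * D" by (simp add: exp_minus)
    finally show "dist (TT \<phi> x0) (TT \<psi> x0) \<le> 1/2 * dist \<phi> \<psi>"
      by (simp add: TT x_def D_def dist_real_def)
  qed
  then obtain \<psi> where \<psi>: "TT \<psi> = \<psi>" using banach_fix_type[of "1/2" TT] by auto
  define \<theta> where "\<theta> x = exp (2 * M * x) * apply_bcontfun \<psi> x" for x
  have "continuous_on {0..X} \<theta>" unfolding \<theta>_def by (intro continuous_intros) simp
  moreover have "\<theta> x = \<theta>0 + integral {0..x} (\<lambda>z. F z (\<theta> z))" if "x \<in> {0..X}" for x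
  proof -
    have "\<psi> x = R \<psi> x" using TT[of \<psi> x] \<psi> cl(2)[OF that] by simp
    then show ?thesis unfolding \<theta>_def R_def by (simp add: exp_minus)
  qed
  ultimately show ?thesis by blast
qed

lemma ode_dependence:
  fixes F G :: "real \<Rightarrow> real \<Rightarrow> real" and X M \<theta>0 \<eta> :: real
  assumes "X > 0" "M > 0" "\<eta> \<ge> 0" "finite S"
    and Lip: "\<And>x y z. x \<in> {0..X} \<Longrightarrow> \<bar>F x y - F x z\<bar> \<le> M * \<bar>y - z\<bar>"
    and FG: "\<And>x y. x \<in> {0<..<X} - S \<Longrightarrow> \<bar>F x y - G x y\<bar> \<le> \<eta>"
    and c1: "continuous_on {0..X} \<theta>" and c2: "continuous_on {0..X} \<zeta>" and "\<theta> 0 = \<zeta> 0"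
    and d1: "\<And>x. x \<in> {0<..<X} - S \<Longrightarrow> (\<theta> has_real_derivative F x (\<theta> x)) (at x)"
    and d2: "\<And>x. x \<in> {0<..<X} - S \<Longrightarrow> (\<zeta> has_real_derivative G x (\<zeta> x)) (at x)"
    and x: "x \<in> {0..X}"
  shows "\<bar>\<theta> x - \<zeta> x\<bar> \<le> 2 * \<eta> * X * exp (2 * M * X)"
proof -
  define \<delta> where "\<delta> x = \<bar>\<theta> x - \<zeta> x\<bar>" for x
  have c\<delta>: "continuous_on {0..X} (\<lambda>x. exp (- 2 * M * x) * \<delta> x)"
    unfolding \<delta>_def by (intro continuous_intros c1 c2)
  have "{0..X} \<noteq> {}" using assms by auto
  then obtain x0 where x0: "x0 \<in> {0..X}" "\<And>y. y \<in> {0..X} \<Longrightarrow> exp (- 2 * M * y) * \<delta> y \<le> exp (- 2 * M * x0) * \<delta> x0"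
    using continuous_attains_sup[OF compact_Icc _ c\<delta>] by blast
  define D where "D = exp (- 2 * M * x0) * \<delta> x0"
  have \<delta>D: "\<delta> y \<le> exp (2 * M * y) * D" if "y \<in> {0..X}" for y
  proof -
    have "exp (2 * M * y) * (exp (- 2 * M * y) * \<delta> y) \<le> exp (2 * M * y) * D"
      using x0(2)[OF that] by (intro mult_left_mono) (auto simp: D_def)
    then show ?thesis by (simp add: mult.assoc[symmetric] exp_add[symmetric])
  qed
  define H where "H z = (if z \<in> {0<..<X} - S then F z (\<theta> z) - G z (\<zeta> z) else 0)" for z
  have "(H has_integral ((\<theta> x0 - \<zeta> x0) - (\<theta> 0 - \<zeta> 0))) {0..x0}"
    using x0 assms(4)
    by (intro fundamental_theorem_of_calculus_interior_strong[of S])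
       (auto simp: H_def has_real_derivative_iff_has_vector_derivative[symmetric]
         intro!: DERIV_diff d1 d2 continuous_intros continuous_on_subset[OF c1] continuous_on_subset[OF c2])
  then have H: "(H has_integral (\<theta> x0 - \<zeta> x0)) {0..x0}" using \<open>\<theta> 0 = \<zeta> 0\<close> by simp
  have D0: "D \<ge> 0" by (simp add: D_def \<delta>_def)
  have w: "((\<lambda>z. M * exp (2 * M * z) * D + \<eta>) has_integral ((exp (2 * M * x0) - 1) / 2 * D + \<eta> * (x0 - 0))) {0..x0}"
    using integral_exp_weight[of M x0] x0 assms has_integral_const_real[of \<eta> 0 x0]
    by (intro has_integral_add has_integral_mult_left) (auto simp: mult_ac)
  have "\<delta> x0 = norm (integral {0..x0} H)" using integral_unique[OF H] by (simp add: \<delta>_def)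
  also have "\<dots> \<le> integral {0..x0} (\<lambda>z. M * exp (2 * M * z) * D + \<eta>)"
  proof (rule integral_norm_bound_integral)
    fix z assume z: "z \<in> {0..x0}"
    have "\<bar>F z (\<theta> z) - G z (\<zeta> z)\<bar> \<le> M * exp (2 * M * z) * D + \<eta>" if zz: "z \<in> {0<..<X} - S"
    proof -
      have "M * \<delta> z \<le> M * (exp (2 * M * z) * D)" using \<delta>D[of z] zz assms by (intro mult_left_mono) auto
      moreover have "\<bar>F z (\<theta> z) - F z (\<zeta> z)\<bar> \<le> M * \<delta> z" unfolding \<delta>_def using zz by (intro Lip) auto
      moreover have "\<bar>F z (\<zeta> z) - G z (\<zeta> z)\<bar> \<le> \<eta>" using zz by (rule FG)
      ultimately show ?thesis by (simp add: mult.assoc)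
    qed
    then show "norm (H z) \<le> M * exp (2 * M * z) * D + \<eta>"
      using D0 assms by (auto simp: H_def)
  qed (use H w in auto)
  also have "\<dots> = (exp (2 * M * x0) - 1) / 2 * D + \<eta> * x0" using integral_unique[OF w] by simp
  also have "\<dots> \<le> exp (2 * M * x0) / 2 * D + \<eta> * X"
    using D0 x0 assms by (intro add_mono mult_right_mono mult_left_mono) auto
  finally have "exp (- 2 * M * x0) * \<delta> x0 \<le> exp (- 2 * M * x0) * (exp (2 * M * x0) / 2 * D + \<eta> * X)"
    by (intro mult_left_mono) auto
  also have "\<dots> = D / 2 + exp (- 2 * M * x0) * (\<eta> * X)" by (simp add: distrib_left exp_minus)
  also have "\<dots> \<le> D / 2 + 1 * (\<eta> * X)" using x0 assms by (intro add_mono mult_right_mono) auto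
  finally have DD: "D \<le> 2 * \<eta> * X" by (simp add: D_def)
  have "\<delta> x \<le> exp (2 * M * x) * D" using \<delta>D x by simp
  also have "\<dots> \<le> exp (2 * M * X) * (2 * \<eta> * X)" using DD x D0 assms by (intro mult_mono) auto
  finally show ?thesis by (simp add: \<delta>_def mult_ac)
qed

lemma barrier_above:
  fixes f f' :: "real \<Rightarrow> real"
  assumes "a \<le> b" "finite S" "continuous_on {a..b} f" "f a \<le> lv" "\<eta> > 0"
    and D: "\<And>x. x \<in> {a<..<b} - S \<Longrightarrow> (f has_real_derivative f' x) (at x)"
    and N: "\<And>x. x \<in> {a<..<b} - S \<Longrightarrow> lv < f x \<Longrightarrow> f x < lv + \<eta> \<Longrightarrow> f' x \<le> 0"
  shows "f b \<le> lv"
proof (rule ccontr)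
  assume nb: "\<not> f b \<le> lv"
  define K where "K = {a..b} \<inter> f -` {..lv}"
  have "closed K" unfolding K_def by (rule continuous_closed_preimage) (use assms in auto)
  moreover have "bdd_above K" "K \<noteq> {}" using assms by (auto simp: K_def bdd_above_def)
  ultimately have "Sup K \<in> K" by (intro closed_contains_Sup)
  define x0 where "x0 = Sup K"
  have x0: "x0 \<in> {a..b}" "f x0 \<le> lv" using \<open>Sup K \<in> K\<close> by (auto simp: x0_def K_def)
  have after: "f x > lv" if "x0 < x" "x \<le> b" for x
  proof (rule ccontr)
    assume "\<not> f x > lv"
    then have "x \<in> K" using that x0 by (auto simp: K_def)
    then have "x \<le> x0" unfolding x0_def using \<open>bdd_above K\<close> by (rule cSup_upper)
    then show False using that by simp
  qed
  have "x0 < b" using x0 nb by (cases "x0 = b") auto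
  obtain e where e: "e > 0" "\<And>x. x \<in> {a..b} \<Longrightarrow> \<bar>x - x0\<bar> < e \<Longrightarrow> \<bar>f x - f x0\<bar> < \<eta>"
    using assms(3) x0(1) \<open>\<eta> > 0\<close> unfolding continuous_on_iff dist_real_def by blast
  define x3 where "x3 = min b (x0 + e / 2)"
  have x3: "x0 < x3" "x3 \<le> b" "x3 < x0 + e" using e \<open>x0 < b\<close> by (auto simp: x3_def)
  have "- f x0 \<le> - f x3"
  proof (rule le_of_deriv_nonneg_off_finite[of x0 x3 S "\<lambda>x. - f x" "\<lambda>x. - f' x"])
    fix x assume x: "x \<in> {x0<..<x3} - S"
    then have x': "x \<in> {a<..<b} - S" using x0 x3 by auto
    show "((\<lambda>x. - f x) has_real_derivative - f' x) (at x)" using D[OF x'] by (rule DERIV_minus)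
    have "\<bar>f x - f x0\<bar> < \<eta>" using x x' x3 by (intro e) auto
    then have "f x < lv + \<eta>" using x0(2) by linarith
    then show "0 \<le> - f' x" using N[OF x'] after[of x] x x3 by auto
  qed (use x3 x0 assms in \<open>auto intro!: continuous_intros intro: continuous_on_subset\<close>)
  then show False using after[of x3] x3 x0 by auto
qed

lemma barrier_below:
  fixes f f' :: "real \<Rightarrow> real"
  assumes "a \<le> b" "finite S" "continuous_on {a..b} f" "f a \<ge> lv" "\<eta> > 0"
    and D: "\<And>x. x \<in> {a<..<b} - S \<Longrightarrow> (f has_real_derivative f' x) (at x)"
    and N: "\<And>x. x \<in> {a<..<b} - S \<Longrightarrow> f x < lv \<Longrightarrow> lv - \<eta> < f x \<Longrightarrow> f' x \<ge> 0"
  shows "f b \<ge> lv"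
proof -
  have "- f b \<le> - lv"
    by (rule barrier_above[of a b S "\<lambda>x. - f x" "-lv" \<eta> "\<lambda>x. - f' x"])
       (use assms in \<open>auto intro!: continuous_intros DERIV_minus\<close>)
  then show ?thesis by simp
qed

section \<open>The Pruefer angle\<close>

text \<open>If \<open>\<phi>'' = \<alpha> \<phi>' + \<sigma> \<phi>\<close> and \<open>(\<phi>, \<phi>') = \<rho> (cos \<theta>, sin \<theta>)\<close>, then \<open>\<theta>' = pruefer \<alpha> \<sigma> x \<theta>\<close>.\<close>
definition pruefer :: "real \<Rightarrow> (real \<Rightarrow> real) \<Rightarrow> real \<Rightarrow> real \<Rightarrow> real" where
  "pruefer \<alpha> \<sigma> x y = \<alpha> * (sin y * cos y) + \<sigma> x * (cos y)\<^sup>2 - (sin y)\<^sup>2"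

definition pruefer_angle where
  "pruefer_angle \<alpha> \<sigma> L c \<theta> \<longleftrightarrow> continuous_on {0..L} \<theta> \<and> \<theta> 0 = arctan \<alpha> \<and>
     (\<forall>x\<in>{0<..<L} - {c}. (\<theta> has_real_derivative pruefer \<alpha> \<sigma> x (\<theta> x)) (at x))"

lemma pruefer_lipschitz:
  assumes "\<alpha> \<ge> 0" "\<bar>\<sigma> x\<bar> \<le> C"
  shows "\<bar>pruefer \<alpha> \<sigma> x y - pruefer \<alpha> \<sigma> x z\<bar> \<le> (\<alpha> + 2 * C + 2) * \<bar>y - z\<bar>"
proof -
  define D where "D y = \<alpha> * (cos y * cos y - sin y * sin y) - \<sigma> x * (2 * cos y * sin y) - 2 * sin y * cos y" for y
  have "norm (pruefer \<alpha> \<sigma> x y - pruefer \<alpha> \<sigma> x z) \<le> (\<alpha> + 2 * C + 2) * norm (y - z)"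
  proof (rule field_differentiable_bound[of UNIV])
    fix y :: real
    show "(pruefer \<alpha> \<sigma> x has_real_derivative D y) (at y within UNIV)"
      unfolding pruefer_def[abs_def] D_def by (auto intro!: derivative_eq_intros simp: algebra_simps)
    have sc: "\<bar>cos y * sin y\<bar> \<le> 1" unfolding abs_mult by (rule mult_le_one) auto
    have "\<bar>cos y * cos y - sin y * sin y\<bar> \<le> 1" using cos_add[of y y] abs_cos_le_one[of "y + y"] by simp
    then have "\<bar>\<alpha> * (cos y * cos y - sin y * sin y)\<bar> \<le> \<alpha> * 1"
      unfolding abs_mult[of \<alpha>] using assms by (intro mult_mono) auto
    moreover have "\<bar>\<sigma> x * (2 * cos y * sin y)\<bar> \<le> C * 2"
      unfolding abs_mult[of "\<sigma> x"] using assms sc by (intro mult_mono) (auto simp: abs_mult)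
    moreover have "\<bar>2 * sin y * cos y\<bar> \<le> 2" using sc by (simp add: abs_mult mult_ac)
    ultimately show "norm (D y) \<le> \<alpha> + 2 * C + 2" unfolding D_def real_norm_def by linarith
  qed auto
  then show ?thesis by simp
qed

lemma pruefer_pc:
  assumes "0 \<le> c" "c \<le> L" "pc 0 L c \<sigma>" "continuous_on {0..L} \<psi>"
  shows "pc 0 L c (\<lambda>x. pruefer \<alpha> \<sigma> x (\<psi> x))"
  unfolding pruefer_def
  by (intro pc_diff pc_add pc_mult[OF assms(3)] pc_continuous_on assms continuous_intros)

lemma pruefer_angle_exists:
  assumes "\<alpha> \<ge> 0" "L > 0" "0 \<le> c" "c \<le> L" "pc 0 L c \<sigma>"
  shows "\<exists>\<theta>. pruefer_angle \<alpha> \<sigma> L c \<theta>"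
proof -
  obtain C where C: "C > 0" "\<And>x. x \<in> {0..L} \<Longrightarrow> \<bar>\<sigma> x\<bar> \<le> C"
    using pc_bounded[OF assms(3-5)] by blast
  have "\<exists>\<theta>. continuous_on {0..L} \<theta> \<and> (\<forall>x\<in>{0..L}. \<theta> x = arctan \<alpha> + integral {0..x} (\<lambda>z. pruefer \<alpha> \<sigma> z (\<theta> z)))"
  proof (rule picard_lindeloef[of L "\<alpha> + 2 * C + 2"])
    show "(\<lambda>x. pruefer \<alpha> \<sigma> x (\<psi> x)) integrable_on {0..L}" if "continuous_on {0..L} \<psi>" for \<psi>
      by (rule pc_integrable[OF assms(3,4) pruefer_pc]) (use assms that in auto)
  qed (use assms C pruefer_lipschitz in auto)
  then obtain \<theta> where c\<theta>: "continuous_on {0..L} \<theta>"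
    and \<theta>: "\<And>x. x \<in> {0..L} \<Longrightarrow> \<theta> x = arctan \<alpha> + integral {0..x} (\<lambda>z. pruefer \<alpha> \<sigma> z (\<theta> z))" by blast
  have p: "pc 0 L c (\<lambda>x. pruefer \<alpha> \<sigma> x (\<theta> x))" using assms c\<theta> by (intro pruefer_pc)
  have "(\<theta> has_real_derivative pruefer \<alpha> \<sigma> x (\<theta> x)) (at x)" if x: "x \<in> {0<..<L} - {c}" for x
  proof -
    have at: "at x within {0..L} = at x" using x by (intro at_within_Icc_at) auto
    have "((\<lambda>u. integral {0..u} (\<lambda>z. pruefer \<alpha> \<sigma> z (\<theta> z))) has_real_derivative pruefer \<alpha> \<sigma> x (\<theta> x)) (at x)"
      using integral_has_vector_derivative_continuous_at[OF pc_integrable[OF assms(3,4) p], of x "{}"] pc_isCont[OF p x] x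
      by (auto simp: has_real_derivative_iff_has_vector_derivative at)
    from DERIV_add[OF DERIV_const[of "arctan \<alpha>"] this]
    have "((\<lambda>u. arctan \<alpha> + integral {0..u} (\<lambda>z. pruefer \<alpha> \<sigma> z (\<theta> z))) has_real_derivative pruefer \<alpha> \<sigma> x (\<theta> x)) (at x)" by simp
    then show ?thesis
      by (rule has_field_derivative_transform_within_open[of _ _ _ "{0<..<L}"]) (use x \<theta> in auto)
  qed
  moreover have "\<theta> 0 = arctan \<alpha>" using \<theta>[of 0] assms by simp
  ultimately show ?thesis unfolding pruefer_angle_def using c\<theta> by blast
qed

lemma pruefer_angle_dependence:
  assumes "\<alpha> \<ge> 0" "L > 0" "\<And>x. x \<in> {0..L} \<Longrightarrow> \<bar>\<sigma> x\<bar> \<le> C" "\<eta> \<ge> 0"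
    and "\<And>x. x \<in> {0<..<L} - {c} \<Longrightarrow> \<bar>\<sigma> x - \<tau> x\<bar> \<le> \<eta>"
    and "pruefer_angle \<alpha> \<sigma> L c \<theta>" "pruefer_angle \<alpha> \<tau> L c \<zeta>" "x \<in> {0..L}"
  shows "\<bar>\<theta> x - \<zeta> x\<bar> \<le> 2 * \<eta> * L * exp (2 * (\<alpha> + 2 * C + 2) * L)"
proof (rule ode_dependence[where F = "pruefer \<alpha> \<sigma>" and G = "pruefer \<alpha> \<tau>" and S = "{c}"
      and \<theta> = \<theta> and \<zeta> = \<zeta> and x = x])
  have "C \<ge> 0" using assms(3)[of 0] assms(2) by auto
  then show "\<alpha> + 2 * C + 2 > 0" using assms(1) by simp
  show "\<bar>pruefer \<alpha> \<sigma> x y - pruefer \<alpha> \<tau> x y\<bar> \<le> \<eta>" if "x \<in> {0<..<L} - {c}" for x y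
  proof -
    have "pruefer \<alpha> \<sigma> x y - pruefer \<alpha> \<tau> x y = (\<sigma> x - \<tau> x) * (cos y)\<^sup>2"
      by (simp add: pruefer_def algebra_simps)
    moreover have "(cos y)\<^sup>2 \<le> 1" using abs_cos_le_one[of y] by (simp add: abs_square_le_1)
    ultimately show ?thesis using assms(5)[OF that] mult_mono[of "\<bar>\<sigma> x - \<tau> x\<bar>" \<eta> "(cos y)\<^sup>2" 1] assms(4)
      by (simp add: abs_mult)
  qed
  show "\<bar>pruefer \<alpha> \<sigma> x y - pruefer \<alpha> \<sigma> x z\<bar> \<le> (\<alpha> + 2 * C + 2) * \<bar>y - z\<bar>" if "x \<in> {0..L}" for x y z
    using assms(1) assms(3)[OF that] by (rule pruefer_lipschitz)
qed (use assms(2,4,6-8) in \<open>simp_all add: pruefer_angle_def\<close>)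

lemma pruefer_linear:
  assumes "0 \<le> c" "c \<le> L" "L > 0" "pc 0 L c \<sigma>" and P: "pruefer_angle \<alpha> \<sigma> L c \<theta>"
  obtains \<rho> where "\<And>x. \<rho> x > (0::real)" "continuous_on {0..L} \<rho>"
    "\<And>x. x \<in> {0..L} \<Longrightarrow> ((\<lambda>x. \<rho> x * cos (\<theta> x)) has_real_derivative \<rho> x * sin (\<theta> x)) (at x within {0..L})"
    "\<And>x. x \<in> {0<..<L} - {c} \<Longrightarrow> ((\<lambda>x. \<rho> x * sin (\<theta> x)) has_real_derivative
        \<alpha> * (\<rho> x * sin (\<theta> x)) + \<sigma> x * (\<rho> x * cos (\<theta> x))) (at x)"
proof -
  have c\<theta>: "continuous_on {0..L} \<theta>" using P by (simp add: pruefer_angle_def)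
  define H where "H x = sin (\<theta> x) * cos (\<theta> x) + \<alpha> * (sin (\<theta> x))\<^sup>2 + \<sigma> x * (sin (\<theta> x) * cos (\<theta> x))" for x
  have pH: "pc 0 L c H" unfolding H_def[abs_def]
    by (intro pc_add pc_mult[OF assms(4)] pc_continuous_on assms continuous_intros c\<theta>)
  note iH = pc_integrable[OF assms(1,2) pH]
  define \<rho> where "\<rho> x = exp (integral {0..x} H)" for x
  have c\<rho>: "continuous_on {0..L} \<rho>" unfolding \<rho>_def
    by (intro continuous_intros indefinite_integral_continuous_1 iH)
  have d\<rho>: "(\<rho> has_real_derivative \<rho> x * H x) (at x)" if x: "x \<in> {0<..<L} - {c}" for x
  proof -
    have at: "at x within {0..L} = at x" using x by (intro at_within_Icc_at) auto
    have "((\<lambda>u. integral {0..u} H) has_real_derivative H x) (at x)"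
      using integral_has_vector_derivative_continuous_at[OF iH, of x "{}"] pc_isCont[OF pH x] x
      by (auto simp: has_real_derivative_iff_has_vector_derivative at)
    then show ?thesis unfolding \<rho>_def by (auto intro!: derivative_eq_intros)
  qed
  have d\<theta>: "(\<theta> has_real_derivative pruefer \<alpha> \<sigma> x (\<theta> x)) (at x)" if "x \<in> {0<..<L} - {c}" for x
    using P that by (simp add: pruefer_angle_def)
  have d1: "((\<lambda>x. \<rho> x * cos (\<theta> x)) has_real_derivative \<rho> x * sin (\<theta> x)) (at x)" if x: "x \<in> {0<..<L} - {c}" for x
  proof -
    have "((\<lambda>x. \<rho> x * cos (\<theta> x)) has_real_derivative
       \<rho> x * H x * cos (\<theta> x) + (- sin (\<theta> x) * pruefer \<alpha> \<sigma> x (\<theta> x)) * \<rho> x) (at x)"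
      by (intro DERIV_mult d\<rho> DERIV_chain2[OF DERIV_cos d\<theta>] x)
    also have "\<rho> x * H x * cos (\<theta> x) + (- sin (\<theta> x) * pruefer \<alpha> \<sigma> x (\<theta> x)) * \<rho> x
      = \<rho> x * sin (\<theta> x) * ((sin (\<theta> x))\<^sup>2 + (cos (\<theta> x))\<^sup>2)"
      unfolding H_def pruefer_def by algebra
    finally show ?thesis by simp
  qed
  show thesis
  proof (rule that[of \<rho>])
    show "((\<lambda>x. \<rho> x * cos (\<theta> x)) has_real_derivative \<rho> x * sin (\<theta> x)) (at x within {0..L})" if "x \<in> {0..L}" for x
      by (rule has_derivative_across_finite[where S = "{c}"]) (use that d1 in \<open>auto intro!: continuous_intros c\<rho> c\<theta>\<close>)
    show "((\<lambda>x. \<rho> x * sin (\<theta> x)) has_real_derivative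
        \<alpha> * (\<rho> x * sin (\<theta> x)) + \<sigma> x * (\<rho> x * cos (\<theta> x))) (at x)" if x: "x \<in> {0<..<L} - {c}" for x
    proof -
      have "((\<lambda>x. \<rho> x * sin (\<theta> x)) has_real_derivative
         \<rho> x * H x * sin (\<theta> x) + (cos (\<theta> x) * pruefer \<alpha> \<sigma> x (\<theta> x)) * \<rho> x) (at x)"
        by (intro DERIV_mult d\<rho> DERIV_chain2[OF DERIV_sin d\<theta>] x)
      also have "\<rho> x * H x * sin (\<theta> x) + (cos (\<theta> x) * pruefer \<alpha> \<sigma> x (\<theta> x)) * \<rho> x
        = (\<alpha> * (\<rho> x * sin (\<theta> x)) + \<sigma> x * (\<rho> x * cos (\<theta> x))) * ((sin (\<theta> x))\<^sup>2 + (cos (\<theta> x))\<^sup>2)"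
        unfolding H_def pruefer_def by algebra
      finally show ?thesis by simp
    qed
  qed (auto simp: \<rho>_def c\<rho>[unfolded \<rho>_def])
qed

lemma pruefer_neg_near_half_pi:
  assumes "\<alpha> \<ge> 0"
  obtains \<eta> where "\<eta> > (0::real)"
    "\<And>y \<sigma> x. \<bar>\<sigma> x\<bar> \<le> C \<Longrightarrow> \<bar>\<bar>y\<bar> - pi / 2\<bar> < \<eta> \<Longrightarrow> pruefer \<alpha> \<sigma> x y < 0"
proof -
  define g where "g y = \<alpha> * \<bar>sin y * cos y\<bar> + C * (cos y)\<^sup>2 - (sin y)\<^sup>2" for y :: real
  have "isCont g (pi/2)" unfolding g_def by (intro continuous_intros)
  moreover have "g (pi/2) < 0" by (simp add: g_def)
  ultimately have "eventually (\<lambda>y. g y < 0) (at (pi/2))"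
    unfolding isCont_def by (rule order_tendstoD(2))
  then obtain \<eta> where \<eta>: "\<eta> > 0" "\<And>y. y \<noteq> pi/2 \<Longrightarrow> \<bar>y - pi/2\<bar> < \<eta> \<Longrightarrow> g y < 0"
    unfolding eventually_at dist_real_def by blast
  show thesis
  proof (rule that[OF \<eta>(1)])
    fix y x :: real and \<sigma> :: "real \<Rightarrow> real" assume s: "\<bar>\<sigma> x\<bar> \<le> C" and y: "\<bar>\<bar>y\<bar> - pi / 2\<bar> < \<eta>"
    have "g \<bar>y\<bar> < 0" using \<eta>(2)[OF _ y] \<open>g (pi/2) < 0\<close> by metis
    moreover have "g \<bar>y\<bar> = g y" by (auto simp: g_def abs_if)
    moreover have "\<alpha> * (sin y * cos y) \<le> \<alpha> * \<bar>sin y * cos y\<bar>" using assms by (intro mult_left_mono) auto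
    moreover have "\<sigma> x * (cos y)\<^sup>2 \<le> C * (cos y)\<^sup>2" using s by (intro mult_right_mono) auto
    ultimately show "pruefer \<alpha> \<sigma> x y < 0" unfolding pruefer_def g_def by linarith
  qed
qed

lemma pruefer_angle_less_half_pi:
  assumes "\<alpha> \<ge> 0" "L > 0" "\<And>x. x \<in> {0..L} \<Longrightarrow> \<bar>\<sigma> x\<bar> \<le> C" and P: "pruefer_angle \<alpha> \<sigma> L c \<theta>"
    and x: "x \<in> {0..L}"
  shows "\<theta> x < pi / 2"
proof -
  obtain \<eta> where \<eta>: "\<eta> > 0" "\<And>y \<sigma> x. \<bar>\<sigma> x\<bar> \<le> C \<Longrightarrow> \<bar>\<bar>y\<bar> - pi / 2\<bar> < \<eta> \<Longrightarrow> pruefer \<alpha> \<sigma> x y < 0"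
    using pruefer_neg_near_half_pi[OF assms(1)] by blast
  define lv where "lv = max (arctan \<alpha>) (pi / 2 - min (\<eta> / 2) (pi/4))"
  have lv: "lv < pi / 2" "lv \<ge> pi / 2 - \<eta> / 2" "lv \<ge> pi / 4"
    using \<eta>(1) arctan_ubound[of \<alpha>] pi_gt_zero unfolding lv_def by linarith+
  have "\<theta> x \<le> lv"
  proof (rule barrier_above[of 0 x "{c}" \<theta> lv "\<eta>/2" "\<lambda>x. pruefer \<alpha> \<sigma> x (\<theta> x)"])
    fix y assume y: "y \<in> {0<..<x} - {c}" "lv < \<theta> y" "\<theta> y < lv + \<eta> / 2"
    have "pruefer \<alpha> \<sigma> y (\<theta> y) < 0"
    proof (rule \<eta>(2))
      show "\<bar>\<sigma> y\<bar> \<le> C" using y x by (intro assms) auto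
      have "\<theta> y > 0" using y lv pi_gt_zero by linarith
      then show "\<bar>\<bar>\<theta> y\<bar> - pi / 2\<bar> < \<eta>" using y lv \<eta>(1) by (auto simp: abs_if)
    qed
    then show "pruefer \<alpha> \<sigma> y (\<theta> y) \<le> 0" by simp
  qed (use P x \<eta>(1) in \<open>auto simp: pruefer_angle_def lv_def intro: continuous_on_subset\<close>)
  then show ?thesis using lv by simp
qed

lemma pruefer_angle_stays_below:
  assumes "\<alpha> \<ge> 0" "L > 0" "\<And>x. x \<in> {0..L} \<Longrightarrow> \<bar>\<sigma> x\<bar> \<le> C" and P: "pruefer_angle \<alpha> \<sigma> L c \<theta>"
    and x: "0 \<le> x" "x \<le> y" "y \<le> L" "\<theta> x \<le> - pi / 2"
  shows "\<theta> y \<le> - pi / 2"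
proof -
  obtain \<eta> where \<eta>: "\<eta> > 0" "\<And>y \<sigma> x. \<bar>\<sigma> x\<bar> \<le> C \<Longrightarrow> \<bar>\<bar>y\<bar> - pi / 2\<bar> < \<eta> \<Longrightarrow> pruefer \<alpha> \<sigma> x y < 0"
    using pruefer_neg_near_half_pi[OF assms(1)] by blast
  show ?thesis
  proof (rule barrier_above[of x y "{c}" \<theta> _ "min \<eta> (pi/2)" "\<lambda>x. pruefer \<alpha> \<sigma> x (\<theta> x)"])
    fix z assume z: "z \<in> {x<..<y} - {c}" "- pi / 2 < \<theta> z" "\<theta> z < - pi / 2 + min \<eta> (pi / 2)"
    have "pruefer \<alpha> \<sigma> z (\<theta> z) < 0"
    proof (rule \<eta>(2))
      show "\<bar>\<sigma> z\<bar> \<le> C" using z x by (intro assms) auto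
      show "\<bar>\<bar>\<theta> z\<bar> - pi / 2\<bar> < \<eta>" using z by (auto simp: abs_if min_def split: if_splits)
    qed
    then show "pruefer \<alpha> \<sigma> z (\<theta> z) \<le> 0" by simp
  qed (use P x \<eta>(1) in \<open>auto simp: pruefer_angle_def intro: continuous_on_subset\<close>)
qed

lemma pruefer_sign_near_zero:
  assumes "\<sigma>0 > 0"
  obtains \<eta> where "\<eta> > (0::real)"
    "\<And>y \<sigma> x. \<sigma> x \<ge> \<sigma>0 \<Longrightarrow> \<bar>y\<bar> < \<eta> \<Longrightarrow> pruefer \<alpha> \<sigma> x y \<ge> 0"
    "\<And>y \<sigma> x. \<sigma> x \<le> - \<sigma>0 \<Longrightarrow> \<bar>y\<bar> < \<eta> \<Longrightarrow> pruefer \<alpha> \<sigma> x y \<le> 0"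
proof -
  define g1 where "g1 y = pruefer \<alpha> (\<lambda>_. \<sigma>0) 0 y" for y
  define g2 where "g2 y = pruefer \<alpha> (\<lambda>_. - \<sigma>0) 0 y" for y
  have "isCont g1 0" "isCont g2 0" unfolding g1_def g2_def pruefer_def by (intro continuous_intros)+
  moreover have g0: "g1 0 > 0" "g2 0 < 0" using assms by (auto simp: g1_def g2_def pruefer_def)
  ultimately have "eventually (\<lambda>y. g1 y > 0 \<and> g2 y < 0) (at 0)"
    unfolding isCont_def by (intro eventually_conj order_tendstoD[of g1] order_tendstoD[of g2])
  then obtain \<eta> where \<eta>: "\<eta> > 0" "\<And>y. y \<noteq> 0 \<Longrightarrow> \<bar>y\<bar> < \<eta> \<Longrightarrow> g1 y > 0 \<and> g2 y < 0"
    unfolding eventually_at dist_real_def by auto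
  have \<eta>': "g1 y > 0 \<and> g2 y < 0" if "\<bar>y\<bar> < \<eta>" for y using \<eta>(2)[OF _ that] g0 by (cases "y = 0") auto
  show thesis
  proof (rule that[OF \<eta>(1)])
    show "pruefer \<alpha> \<sigma> x y \<ge> 0" if "\<sigma> x \<ge> \<sigma>0" "\<bar>y\<bar> < \<eta>" for y \<sigma> x
      using \<eta>'[OF that(2)] mult_right_mono[OF that(1), of "(cos y)\<^sup>2"] by (simp add: g1_def pruefer_def)
    show "pruefer \<alpha> \<sigma> x y \<le> 0" if "\<sigma> x \<le> - \<sigma>0" "\<bar>y\<bar> < \<eta>" for y \<sigma> x
      using \<eta>'[OF that(2)] mult_right_mono[OF that(1), of "(cos y)\<^sup>2"] by (simp add: g2_def pruefer_def)
  qed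
qed

lemma pruefer_angle_stays_nonneg:
  assumes P: "pruefer_angle \<alpha> \<sigma> L c \<theta>" and "0 \<le> x" "x \<le> y" "y \<le> L" "\<theta> x \<ge> 0"
    and "\<sigma>0 > 0" "\<And>z. z \<in> {x<..<y} - {c} \<Longrightarrow> \<sigma> z \<ge> \<sigma>0"
  shows "\<theta> y \<ge> 0"
proof -
  obtain \<eta> where \<eta>: "\<eta> > 0" "\<And>y \<sigma> x. \<sigma> x \<ge> \<sigma>0 \<Longrightarrow> \<bar>y\<bar> < \<eta> \<Longrightarrow> pruefer \<alpha> \<sigma> x y \<ge> 0"
    "\<And>y \<sigma> x. \<sigma> x \<le> - \<sigma>0 \<Longrightarrow> \<bar>y\<bar> < \<eta> \<Longrightarrow> pruefer \<alpha> \<sigma> x y \<le> 0"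
    by (rule pruefer_sign_near_zero[OF assms(6), of \<alpha>], rule that)
  show ?thesis
  proof (rule barrier_below[of x y "{c}" \<theta> 0 \<eta> "\<lambda>x. pruefer \<alpha> \<sigma> x (\<theta> x)"])
    show "pruefer \<alpha> \<sigma> z (\<theta> z) \<ge> 0" if "z \<in> {x<..<y} - {c}" "\<theta> z < 0" "0 - \<eta> < \<theta> z" for z
      using that assms(7)[of z] by (intro \<eta>(2)) auto
  qed (use assms(1-5) \<eta>(1) in \<open>auto simp: pruefer_angle_def intro: continuous_on_subset\<close>)
qed

lemma pruefer_angle_stays_nonpos:
  assumes P: "pruefer_angle \<alpha> \<sigma> L c \<theta>" and "0 \<le> x" "x \<le> y" "y \<le> L" "\<theta> x \<le> 0"
    and "\<sigma>0 > 0" "\<And>z. z \<in> {x<..<y} - {c} \<Longrightarrow> \<sigma> z \<le> - \<sigma>0"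
  shows "\<theta> y \<le> 0"
proof -
  obtain \<eta> where \<eta>: "\<eta> > 0" "\<And>y \<sigma> x. \<sigma> x \<ge> \<sigma>0 \<Longrightarrow> \<bar>y\<bar> < \<eta> \<Longrightarrow> pruefer \<alpha> \<sigma> x y \<ge> 0"
    "\<And>y \<sigma> x. \<sigma> x \<le> - \<sigma>0 \<Longrightarrow> \<bar>y\<bar> < \<eta> \<Longrightarrow> pruefer \<alpha> \<sigma> x y \<le> 0"
    by (rule pruefer_sign_near_zero[OF assms(6), of \<alpha>], rule that)
  show ?thesis
  proof (rule barrier_above[of x y "{c}" \<theta> 0 \<eta> "\<lambda>x. pruefer \<alpha> \<sigma> x (\<theta> x)"])
    show "pruefer \<alpha> \<sigma> z (\<theta> z) \<le> 0" if "z \<in> {x<..<y} - {c}" "0 < \<theta> z" "\<theta> z < 0 + \<eta>" for z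
      using that assms(7)[of z] by (intro \<eta>(3)) auto
  qed (use assms(1-5) \<eta>(1) in \<open>auto simp: pruefer_angle_def intro: continuous_on_subset\<close>)
qed

lemma pruefer_angle_intermediate:
  fixes \<sigma> :: "real \<Rightarrow> real \<Rightarrow> real"
  assumes "\<alpha> \<ge> 0" "L > 0" "0 \<le> c" "c \<le> L" "\<tau>0 \<le> \<tau>1" "B \<ge> 0"
    and pc: "\<And>\<tau>. \<tau> \<in> {\<tau>0..\<tau>1} \<Longrightarrow> pc 0 L c (\<sigma> \<tau>)"
    and bd: "\<And>\<tau> x. \<tau> \<in> {\<tau>0..\<tau>1} \<Longrightarrow> x \<in> {0..L} \<Longrightarrow> \<bar>\<sigma> \<tau> x\<bar> \<le> C"
    and lip: "\<And>\<tau> \<tau>' x. x \<in> {0..L} \<Longrightarrow> \<bar>\<sigma> \<tau> x - \<sigma> \<tau>' x\<bar> \<le> B * \<bar>\<tau> - \<tau>'\<bar>"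
    and lo: "\<And>\<theta>. pruefer_angle \<alpha> (\<sigma> \<tau>0) L c \<theta> \<Longrightarrow> \<theta> L \<le> 0"
    and hi: "\<And>\<theta>. pruefer_angle \<alpha> (\<sigma> \<tau>1) L c \<theta> \<Longrightarrow> \<theta> L \<ge> 0"
  obtains \<tau> \<theta> where "\<tau> \<in> {\<tau>0..\<tau>1}" "pruefer_angle \<alpha> (\<sigma> \<tau>) L c \<theta>" "\<theta> L = 0"
proof -
  define \<Theta> where "\<Theta> \<tau> = (SOME \<theta>. pruefer_angle \<alpha> (\<sigma> \<tau>) L c \<theta>)" for \<tau>
  have \<Theta>: "pruefer_angle \<alpha> (\<sigma> \<tau>) L c (\<Theta> \<tau>)" if "\<tau> \<in> {\<tau>0..\<tau>1}" for \<tau>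
    unfolding \<Theta>_def using pruefer_angle_exists[OF assms(1-4) pc[OF that]] by (rule someI_ex)
  define K where "K = 2 * B * L * exp (2 * (\<alpha> + 2 * C + 2) * L)"
  have "\<bar>\<Theta> \<tau> L - \<Theta> \<tau>' L\<bar> \<le> K * \<bar>\<tau> - \<tau>'\<bar>" if "\<tau> \<in> {\<tau>0..\<tau>1}" "\<tau>' \<in> {\<tau>0..\<tau>1}" for \<tau> \<tau>'
    using pruefer_angle_dependence[OF assms(1,2) bd[OF that(1)] _ lip \<Theta>[OF that(1)] \<Theta>[OF that(2)], where x = L] assms
    by (simp add: K_def mult_ac)
  then have "K-lipschitz_on {\<tau>0..\<tau>1} (\<lambda>\<tau>. \<Theta> \<tau> L)"
    using assms by (intro lipschitz_onI) (auto simp: dist_real_def K_def)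
  then have "continuous_on {\<tau>0..\<tau>1} (\<lambda>\<tau>. \<Theta> \<tau> L)" by (rule lipschitz_on_continuous_on)
  then obtain \<tau> where "\<tau>0 \<le> \<tau>" "\<tau> \<le> \<tau>1" "\<Theta> \<tau> L = 0"
    using IVT'[of "\<lambda>\<tau>. \<Theta> \<tau> L" \<tau>0 0 \<tau>1] lo[OF \<Theta>] hi[OF \<Theta>] assms(5) by auto
  then show thesis using \<Theta>[of \<tau>] by (intro that[of \<tau> "\<Theta> \<tau>"]) auto
qed

section \<open>Principal eigenvalues\<close>

definition eigenpair where
  "eigenpair d a s L c lam \<phi> \<longleftrightarrow> (\<forall>x\<in>{0..L}. \<phi> x > 0) \<and> bvp d a 0 L c (\<lambda>x. (s x - lam) * \<phi> x) \<phi>"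

lemma eigenpair_principal:
  assumes "eigenpair d a s L c lam \<phi>" "d > 0"
  shows "principal_eigenvalue d a s 0 L lam"
proof -
  obtain \<phi>' where Z': "\<forall>x\<in>{0..L}. (\<phi> has_real_derivative \<phi>' x) (at x within {0..L})"
     "continuous_on {0..L} \<phi>'"
     "\<forall>x\<in>{0<..<L} - {c}. (\<phi>' has_real_derivative (a * \<phi>' x - (s x - lam) * \<phi> x) / d) (at x)"
     "d * \<phi>' 0 = a * \<phi> 0" "\<phi>' L = 0"
    using assms unfolding eigenpair_def bvp_def by blast
  moreover have "d * ((a * \<phi>' x - (s x - lam) * \<phi> x) / d) - a * \<phi>' x + s x * \<phi> x = lam * \<phi> x" for x
  proof -
    have "d * ((a * \<phi>' x - (s x - lam) * \<phi> x) / d) = a * \<phi>' x - (s x - lam) * \<phi> x" using assms(2) by simp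
    then show ?thesis by (simp add: algebra_simps)
  qed
  moreover have "\<forall>x\<in>{0..L}. \<phi> x > 0" using assms(1) by (simp add: eigenpair_def)
  ultimately show ?thesis unfolding principal_eigenvalue_def
    by (intro exI[of _ \<phi>] exI[of _ \<phi>'] exI[of _ "\<lambda>x. (a * \<phi>' x - (s x - lam) * \<phi> x) / d"] exI[of _ "{c}"])
       simp
qed

lemma eigenpair_of_pruefer:
  assumes "d > 0" "a \<ge> 0" "L > 0" "0 \<le> c" "c \<le> L" "pc 0 L c \<sigma>"
    and P: "pruefer_angle (a / d) \<sigma> L c \<theta>" and "\<theta> L = 0"
    and \<sigma>: "\<And>x. x \<in> {0<..<L} - {c} \<Longrightarrow> \<sigma> x = (lam - s x) / d"
  shows "\<exists>\<phi>. eigenpair d a s L c lam \<phi>"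
proof -
  have \<alpha>: "a / d \<ge> 0" using assms by simp
  obtain C where C: "C > 0" "\<And>x. x \<in> {0..L} \<Longrightarrow> \<bar>\<sigma> x\<bar> \<le> C" using pc_bounded[OF assms(4-6)] by blast
  have range: "- pi / 2 < \<theta> x \<and> \<theta> x < pi / 2" if "x \<in> {0..L}" for x
  proof -
    have "\<not> \<theta> x \<le> - pi / 2"
      using pruefer_angle_stays_below[OF \<alpha> assms(3) C(2) P, of x L] that \<open>\<theta> L = 0\<close> pi_gt_zero by auto
    then show ?thesis using pruefer_angle_less_half_pi[OF \<alpha> assms(3) C(2) P that] by simp
  qed
  obtain \<rho> where \<rho>: "\<And>x. \<rho> x > (0::real)" "continuous_on {0..L} \<rho>"
    "\<And>x. x \<in> {0..L} \<Longrightarrow> ((\<lambda>x. \<rho> x * cos (\<theta> x)) has_real_derivative \<rho> x * sin (\<theta> x)) (at x within {0..L})"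
    "\<And>x. x \<in> {0<..<L} - {c} \<Longrightarrow> ((\<lambda>x. \<rho> x * sin (\<theta> x)) has_real_derivative
        (a / d) * (\<rho> x * sin (\<theta> x)) + \<sigma> x * (\<rho> x * cos (\<theta> x))) (at x)"
    by (rule pruefer_linear[OF assms(4,5,3,6) P], rule that)
  have c\<theta>: "continuous_on {0..L} \<theta>" and \<theta>0: "\<theta> 0 = arctan (a / d)" using P by (auto simp: pruefer_angle_def)
  have "bvp d a 0 L c (\<lambda>x. (s x - lam) * (\<rho> x * cos (\<theta> x))) (\<lambda>x. \<rho> x * cos (\<theta> x))"
    unfolding bvp_def
  proof (intro exI[of _ "\<lambda>x. \<rho> x * sin (\<theta> x)"] conjI ballI)
    fix x assume x: "x \<in> {0<..<L} - {c}"
    have "(a / d) * (\<rho> x * sin (\<theta> x)) + \<sigma> x * (\<rho> x * cos (\<theta> x)) =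
      (a * (\<rho> x * sin (\<theta> x)) - (s x - lam) * (\<rho> x * cos (\<theta> x))) / d"
      unfolding \<sigma>[OF x] using assms(1) by (simp add: field_simps)
    then show "((\<lambda>x. \<rho> x * sin (\<theta> x)) has_real_derivative
      (a * (\<rho> x * sin (\<theta> x)) - (s x - lam) * (\<rho> x * cos (\<theta> x))) / d) (at x)" using \<rho>(4)[OF x] by simp
  next
    have "sin (arctan (a / d)) = (a / d) * cos (arctan (a / d))"
      by (simp add: sin_arctan cos_arctan)
    then show "d * (\<rho> 0 * sin (\<theta> 0)) = a * (\<rho> 0 * cos (\<theta> 0))" using assms(1) by (simp add: \<theta>0)
  qed (use \<rho> c\<theta> \<open>\<theta> L = 0\<close> in \<open>auto intro!: continuous_intros\<close>)
  moreover have "\<rho> x * cos (\<theta> x) > 0" if "x \<in> {0..L}" for x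
    using \<rho>(1) range[OF that] by (intro mult_pos_pos cos_gt_zero_pi) auto
  ultimately show ?thesis unfolding eigenpair_def
    by (intro exI[of _ "\<lambda>x. \<rho> x * cos (\<theta> x)"] conjI ballI)
qed

lemma pruefer_angle_very_negative:
  assumes "\<alpha> \<ge> 0" "L > 0" "\<And>x. x \<in> {0..L} \<Longrightarrow> \<bar>\<sigma> x\<bar> \<le> C"
    and P: "pruefer_angle \<alpha> \<sigma> L c \<theta>"
    and N: "\<And>x. x \<in> {0<..<L} - {c} \<Longrightarrow> \<sigma> x \<le> - ((\<alpha> + 2 / L) * (1 + \<alpha>\<^sup>2))"
  shows "\<theta> L \<le> 0"
proof (rule ccontr)
  assume pos: "\<not> \<theta> L \<le> 0"
  define N0 where "N0 = (\<alpha> + 2 / L) * (1 + \<alpha>\<^sup>2)"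
  have "1 + \<alpha>\<^sup>2 > 0" "\<alpha> + 2 / L > 0" using assms(1,2) by (auto simp: add_pos_nonneg add_nonneg_pos)
  then have N0: "N0 > 0" by (simp add: N0_def)
  have c\<theta>: "continuous_on {0..L} \<theta>" and \<theta>0: "\<theta> 0 = arctan \<alpha>"
    and d\<theta>: "\<And>x. x \<in> {0<..<L} - {c} \<Longrightarrow> (\<theta> has_real_derivative pruefer \<alpha> \<sigma> x (\<theta> x)) (at x)"
    using P by (auto simp: pruefer_angle_def)
  have gt: "\<theta> x > 0" if "x \<in> {0..L}" for x
    using pruefer_angle_stays_nonpos[OF P, of x L N0] that pos N N0 by (force simp: N0_def)
  have lt: "\<theta> x < pi / 2" if "x \<in> {0..L}" for x
    by (rule pruefer_angle_less_half_pi[OF assms(1,2,3) P that])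
  have le: "\<theta> x \<le> arctan \<alpha>" if x: "x \<in> {0..L}" for x
  proof (rule barrier_above[of 0 x "{c}" \<theta> _ 1 "\<lambda>x. pruefer \<alpha> \<sigma> x (\<theta> x)"])
    fix y assume y: "y \<in> {0<..<x} - {c}" "arctan \<alpha> < \<theta> y"
    have y': "y \<in> {0..L}" using y x by auto
    have c: "cos (\<theta> y) > 0" using gt[OF y'] lt[OF y'] by (intro cos_gt_zero_pi) auto
    have s: "sin (\<theta> y) > 0" using gt[OF y'] lt[OF y'] pi_gt_zero by (intro sin_gt_zero) linarith+
    have "tan (arctan \<alpha>) < tan (\<theta> y)"
      using y lt[OF y'] arctan_lbound[of \<alpha>] by (intro tan_monotone) auto
    then have "\<alpha> < sin (\<theta> y) / cos (\<theta> y)" unfolding tan_arctan by (simp add: tan_def)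
    then have "\<alpha> * cos (\<theta> y) \<le> sin (\<theta> y)" using c by (simp add: pos_less_divide_eq)
    then have "sin (\<theta> y) * (\<alpha> * cos (\<theta> y) - sin (\<theta> y)) \<le> 0" using s by (simp add: mult_nonneg_nonpos)
    moreover have "\<sigma> y * (cos (\<theta> y))\<^sup>2 \<le> 0" using N[of y] N0 y x by (intro mult_nonpos_nonneg) (auto simp: N0_def)
    ultimately show "pruefer \<alpha> \<sigma> y (\<theta> y) \<le> 0" by (simp add: pruefer_def algebra_simps power2_eq_square)
  qed (use x d\<theta> \<theta>0 c\<theta> in \<open>auto intro: continuous_on_subset\<close>)
  have "- \<theta> 0 - 2 / L * 0 \<le> - \<theta> L - 2 / L * L"
  proof (rule le_of_deriv_nonneg_off_finite[of 0 L "{c}" "\<lambda>x. - \<theta> x - 2 / L * x" "\<lambda>x. - pruefer \<alpha> \<sigma> x (\<theta> x) - 2 / L"])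
    fix x assume x: "x \<in> {0<..<L} - {c}"
    show "((\<lambda>x. - \<theta> x - 2 / L * x) has_real_derivative - pruefer \<alpha> \<sigma> x (\<theta> x) - 2 / L) (at x)"
      using d\<theta>[OF x] assms(2) by (auto intro!: derivative_eq_intros)
    have x': "x \<in> {0..L}" using x by auto
    have "cos (\<theta> x) \<ge> cos (arctan \<alpha>)"
      using gt[OF x'] le[OF x'] arctan_ubound[of \<alpha>] pi_gt_zero by (intro cos_monotone_0_pi_le) linarith+
    then have "(cos (\<theta> x))\<^sup>2 \<ge> (cos (arctan \<alpha>))\<^sup>2" by (intro power_mono) (auto simp: cos_arctan)
    also have "(cos (arctan \<alpha>))\<^sup>2 = 1 / (1 + \<alpha>\<^sup>2)" by (simp add: cos_arctan power_divide)
    finally have "N0 * (1 / (1 + \<alpha>\<^sup>2)) \<le> N0 * (cos (\<theta> x))\<^sup>2" using N0 by (intro mult_left_mono) auto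
    moreover have "N0 * (1 / (1 + \<alpha>\<^sup>2)) = \<alpha> + 2 / L" 
      using add_pos_nonneg[of 1 "\<alpha>\<^sup>2"] unfolding N0_def by simp
    moreover have "\<sigma> x * (cos (\<theta> x))\<^sup>2 \<le> - N0 * (cos (\<theta> x))\<^sup>2"
      using N[OF x] unfolding N0_def[symmetric] by (intro mult_right_mono) auto
    moreover have "\<alpha> * (sin (\<theta> x) * cos (\<theta> x)) \<le> \<alpha> * 1"
    proof (rule mult_left_mono)
      have "\<bar>sin (\<theta> x) * cos (\<theta> x)\<bar> \<le> 1" unfolding abs_mult by (rule mult_le_one) auto
      then show "sin (\<theta> x) * cos (\<theta> x) \<le> 1" by simp
    qed (use assms in auto)
    moreover have "(sin (\<theta> x))\<^sup>2 \<ge> 0" by simp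
    ultimately show "0 \<le> - pruefer \<alpha> \<sigma> x (\<theta> x) - 2 / L" unfolding pruefer_def by linarith
  qed (use assms c\<theta> in \<open>auto intro!: continuous_intros\<close>)
  then have "\<theta> L \<le> arctan \<alpha> - 2" using \<theta>0 assms by simp
  then show False using pos arctan_ubound[of \<alpha>] pi_less_4 by simp
qed

lemma eigenpair_exists:
  assumes "d > 0" "a \<ge> 0" "L > 0" "0 \<le> c" "c \<le> L" and s: "pc 0 L c s"
  shows "\<exists>lam \<phi>. eigenpair d a s L c lam \<phi>"
proof -
  define \<alpha> where "\<alpha> = a / d"
  have \<alpha>: "\<alpha> \<ge> 0" using assms by (simp add: \<alpha>_def)
  obtain C where C: "C > 0" "\<And>x. x \<in> {0..L} \<Longrightarrow> \<bar>s x\<bar> \<le> C" using pc_bounded[OF assms(4,5) s] by blast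
  define N where "N = (\<alpha> + 2 / L) * (1 + \<alpha>\<^sup>2)"
  have "1 + \<alpha>\<^sup>2 > 0" "\<alpha> + 2 / L > 0" using \<alpha> assms(3) by (auto simp: add_pos_nonneg add_nonneg_pos)
  then have N: "N > 0" by (simp add: N_def)
  define \<sigma> where "\<sigma> lam x = (lam - s x) / d" for lam x
  define l0 where "l0 = - C - d * N"
  define l1 where "l1 = C + d"
  have l: "l0 \<le> l1" using C N assms by (simp add: l0_def l1_def add_nonneg_nonneg) 
     (smt (verit) mult_nonneg_nonneg)
  define E where "E = (\<bar>l0\<bar> + \<bar>l1\<bar> + C) / d"
  have pc\<sigma>: "pc 0 L c (\<sigma> lam)" for lam
  proof -
    have "pc 0 L c (\<lambda>x. (lam - s x) * (1 / d))"
      by (intro pc_mult pc_diff s pc_continuous_on assms continuous_intros)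
    then show ?thesis by (simp add: \<sigma>_def[abs_def])
  qed
  have bd: "\<bar>\<sigma> lam x\<bar> \<le> E" if "lam \<in> {l0..l1}" "x \<in> {0..L}" for lam x
  proof -
    have "\<bar>lam - s x\<bar> \<le> \<bar>l0\<bar> + \<bar>l1\<bar> + C" using that C(2)[of x] by auto
    then show ?thesis using assms(1) by (simp add: \<sigma>_def E_def abs_divide divide_right_mono)
  qed
  obtain lam \<theta> where "pruefer_angle \<alpha> (\<sigma> lam) L c \<theta>" "\<theta> L = 0"
  proof (rule pruefer_angle_intermediate[OF \<alpha> assms(3-5) l, of "1 / d" \<sigma> E])
    show "\<bar>\<sigma> \<tau> x - \<sigma> \<tau>' x\<bar> \<le> 1 / d * \<bar>\<tau> - \<tau>'\<bar>" for \<tau> \<tau>' x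
      using assms(1) by (simp add: \<sigma>_def diff_divide_distrib[symmetric] abs_divide)
    show "\<theta> L \<le> 0" if P: "pruefer_angle \<alpha> (\<sigma> l0) L c \<theta>" for \<theta>
    proof (rule pruefer_angle_very_negative[OF \<alpha> assms(3) bd P])
      fix x assume x: "x \<in> {0<..<L} - {c}"
      have "l0 - s x \<le> - (d * N)" using C(2)[of x] x by (auto simp: l0_def)
      then have "\<sigma> l0 x \<le> - N" using assms(1) by (simp add: \<sigma>_def field_simps)
      then show "\<sigma> l0 x \<le> - ((\<alpha> + 2 / L) * (1 + \<alpha>\<^sup>2))" by (simp add: N_def)
    qed (use l in auto)
    show "\<theta> L \<ge> 0" if P: "pruefer_angle \<alpha> (\<sigma> l1) L c \<theta>" for \<theta>
    proof (rule pruefer_angle_stays_nonneg[OF P, of 0 L 1])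
      show "\<theta> 0 \<ge> 0" using P \<alpha> by (simp add: pruefer_angle_def)
      fix x assume x: "x \<in> {0<..<L} - {c}"
      have "l1 - s x \<ge> d" using C(2)[of x] x by (auto simp: l1_def)
      then show "\<sigma> l1 x \<ge> 1" using assms(1) by (simp add: \<sigma>_def field_simps)
    qed (use assms in auto)
  qed (use assms pc\<sigma> bd in auto)
  then show ?thesis
    using eigenpair_of_pruefer[OF assms(1-5) pc\<sigma>[of lam], of \<theta> lam s]
    by (auto simp: \<alpha>_def \<sigma>_def)
qed

lemma wronskian_deriv:
  assumes "(\<phi> has_real_derivative \<phi>' x) (at x)" "(\<psi> has_real_derivative \<psi>' x) (at x)"
    and "(\<phi>' has_real_derivative \<alpha> * \<phi>' x + \<sigma> * \<phi> x) (at x)" "(\<psi>' has_real_derivative \<alpha> * \<psi>' x + \<tau> * \<psi> x) (at x)"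
  shows "((\<lambda>x. exp (- \<alpha> * x) * (\<phi>' x * \<psi> x - \<psi>' x * \<phi> x)) has_real_derivative
     exp (- \<alpha> * x) * ((\<sigma> - \<tau>) * (\<phi> x * \<psi> x))) (at x)"
  by (rule derivative_eq_intros assms refl)+ (simp add: algebra_simps)

lemma principal_eigenvalue_unique:
  assumes "principal_eigenvalue d a s y1 y2 l1" "principal_eigenvalue d a s y1 y2 l2" "d > 0" "y1 < y2"
  shows "l1 = l2"
proof -
  have main: "l1 \<le> l2" if p1: "principal_eigenvalue d a s y1 y2 l1" and p2: "principal_eigenvalue d a s y1 y2 l2" for l1 l2
  proof (rule ccontr)
    assume "\<not> l1 \<le> l2"
    obtain \<phi> \<phi>' \<phi>'' S where 1: "finite S" "\<forall>x\<in>{y1..y2}. \<phi> x > 0" "continuous_on {y1..y2} \<phi>'"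
        "\<forall>x\<in>{y1..y2}. (\<phi> has_real_derivative \<phi>' x) (at x within {y1..y2})"
        "\<forall>x\<in>{y1<..<y2} - S. (\<phi>' has_real_derivative \<phi>'' x) (at x) \<and>
            d * \<phi>'' x - a * \<phi>' x + s x * \<phi> x = l1 * \<phi> x" "d * \<phi>' y1 - a * \<phi> y1 = 0" "\<phi>' y2 = 0"
      using p1 unfolding principal_eigenvalue_def by blast
    obtain \<psi> \<psi>' \<psi>'' R where 2: "finite R" "\<forall>x\<in>{y1..y2}. \<psi> x > 0" "continuous_on {y1..y2} \<psi>'"
        "\<forall>x\<in>{y1..y2}. (\<psi> has_real_derivative \<psi>' x) (at x within {y1..y2})"
        "\<forall>x\<in>{y1<..<y2} - R. (\<psi>' has_real_derivative \<psi>'' x) (at x) \<and>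
            d * \<psi>'' x - a * \<psi>' x + s x * \<psi> x = l2 * \<psi> x" "d * \<psi>' y1 - a * \<psi> y1 = 0" "\<psi>' y2 = 0"
      using p2 unfolding principal_eigenvalue_def by blast
    define \<alpha> where "\<alpha> = a / d"
    define W where "W x = exp (- \<alpha> * x) * (\<phi>' x * \<psi> x - \<psi>' x * \<phi> x)" for x
    have fin: "finite (S \<union> R)" using 1 2 by simp
    have cont: "continuous_on {y1..y2} \<phi>" "continuous_on {y1..y2} \<psi>"
      using 1(4) 2(4) by (meson DERIV_continuous continuous_on_eq_continuous_within)+
    have dW: "(W has_real_derivative exp (- \<alpha> * x) * (((l1 - s x) / d - (l2 - s x) / d) * (\<phi> x * \<psi> x))) (at x)"
      if x: "x \<in> {y1<..<y2} - (S \<union> R)" for x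
      unfolding W_def
    proof (rule wronskian_deriv)
      have at: "at x within {y1..y2} = at x" using x by (intro at_within_Icc_at) auto
      show "(\<phi> has_real_derivative \<phi>' x) (at x)" "(\<psi> has_real_derivative \<psi>' x) (at x)"
        using 1(4) 2(4) x at by (metis Diff_iff atLeastAtMost_iff greaterThanLessThan_iff less_imp_le)+
      have "\<phi>'' x = \<alpha> * \<phi>' x + (l1 - s x) / d * \<phi> x" "\<psi>'' x = \<alpha> * \<psi>' x + (l2 - s x) / d * \<psi> x"
        using 1(5) 2(5) x \<open>d > 0\<close> by (auto simp: \<alpha>_def field_simps)
      then show "(\<phi>' has_real_derivative \<alpha> * \<phi>' x + (l1 - s x) / d * \<phi> x) (at x)"
         "(\<psi>' has_real_derivative \<alpha> * \<psi>' x + (l2 - s x) / d * \<psi> x) (at x)" using 1(5) 2(5) x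
        by (metis DiffD1 DiffD2 DiffI UnCI)+
    qed
    have "\<phi>' y1 = \<alpha> * \<phi> y1" "\<psi>' y1 = \<alpha> * \<psi> y1" using 1(6) 2(6) \<open>d > 0\<close> by (auto simp: \<alpha>_def field_simps)
    then have W0: "W y1 = 0" "W y2 = 0" using 1(7) 2(7) by (auto simp: W_def)
    have "infinite ({y1<..<y2} - (S \<union> R))" using fin \<open>y1 < y2\<close> by (simp add: infinite_Ioo)
    then obtain x where x: "x \<in> {y1<..<y2} - (S \<union> R)" by (metis finite.emptyI ex_in_conv)
    have pos: "exp (- \<alpha> * x) * (((l1 - s x) / d - (l2 - s x) / d) * (\<phi> x * \<psi> x)) > 0"
      if "x \<in> {y1<..<y2} - (S \<union> R)" for x
      using 1(2) 2(2) that \<open>\<not> l1 \<le> l2\<close> \<open>d > 0\<close>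
      by (intro mult_pos_pos) (auto simp: diff_divide_distrib[symmetric])
    have "exp (- \<alpha> * x) * (((l1 - s x) / d - (l2 - s x) / d) * (\<phi> x * \<psi> x)) = 0"
      by (rule deriv_zero_of_nonneg_off_finite[OF fin _ dW _ _ x])
         (use pos W0 1(3) 2(3) cont in \<open>auto simp: W_def[abs_def] intro!: continuous_intros intro: less_imp_le\<close>)
    then show False using pos[OF x] by (metis less_irrefl)
  qed
  show ?thesis using main[OF assms(1,2)] main[OF assms(2,1)] by simp
qed

lemma lambda1_eq:
  assumes "principal_eigenvalue d a s y1 y2 lam" "d > 0" "y1 < y2"
  shows "lambda1 d a s y1 y2 = lam"
  unfolding lambda1_def using assms principal_eigenvalue_unique by (intro the_equality) auto

lemma eigenpair_derivs:
  assumes "eigenpair d a s L c lam \<phi>" "d > 0"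
  obtains \<phi>' where "\<And>x. x \<in> {0..L} \<Longrightarrow> \<phi> x > 0" "continuous_on {0..L} \<phi>" "continuous_on {0..L} \<phi>'"
    "\<And>x. x \<in> {0<..<L} \<Longrightarrow> (\<phi> has_real_derivative \<phi>' x) (at x)"
    "\<And>x. x \<in> {0<..<L} - {c} \<Longrightarrow> (\<phi>' has_real_derivative (a / d) * \<phi>' x + (lam - s x) / d * \<phi> x) (at x)"
    "\<phi>' 0 = (a / d) * \<phi> 0" "\<phi>' L = 0"
proof -
  obtain \<phi>' where Z': "\<forall>x\<in>{0..L}. (\<phi> has_real_derivative \<phi>' x) (at x within {0..L})"
     "continuous_on {0..L} \<phi>'"
     "\<forall>x\<in>{0<..<L} - {c}. (\<phi>' has_real_derivative (a * \<phi>' x - (s x - lam) * \<phi> x) / d) (at x)"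
     "d * \<phi>' 0 = a * \<phi> 0" "\<phi>' L = 0"
    using assms unfolding eigenpair_def bvp_def by blast
  have eq: "(a * \<phi>' x - (s x - lam) * \<phi> x) / d = (a / d) * \<phi>' x + (lam - s x) / d * \<phi> x" for x
    using assms(2) by (simp add: field_simps)
  show thesis
  proof (rule that[of \<phi>'])
    show "continuous_on {0..L} \<phi>" using assms(1) unfolding eigenpair_def by (blast intro: bvp_continuous)
    show "(\<phi> has_real_derivative \<phi>' x) (at x)" if "x \<in> {0<..<L}" for x
    proof -
      have "at x within {0..L} = at x" using that by (intro at_within_Icc_at) auto
      then show ?thesis using Z'(1) that by (metis atLeastAtMost_iff greaterThanLessThan_iff less_imp_le)
    qed
    show "\<phi>' 0 = (a / d) * \<phi> 0" using Z'(4) assms(2) by (simp add: field_simps)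
  qed (use Z' assms eq in \<open>auto simp: eigenpair_def\<close>)
qed

lemma eigenpair_strict_mono:
  assumes "eigenpair d a s1 L c lam1 \<phi>" "eigenpair d a s2 L c lam2 \<psi>" "d > 0"
    and ge: "\<And>x. x \<in> {0<..<L} \<Longrightarrow> s1 x \<ge> s2 x" and x0: "x0 \<in> {0<..<L} - {c}" "s1 x0 > s2 x0"
  shows "lam1 > lam2"
proof (rule ccontr)
  assume n: "\<not> lam1 > lam2"
  obtain \<phi>' where 1: "\<And>x. x \<in> {0..L} \<Longrightarrow> \<phi> x > 0" "continuous_on {0..L} \<phi>" "continuous_on {0..L} \<phi>'"
    "\<And>x. x \<in> {0<..<L} \<Longrightarrow> (\<phi> has_real_derivative \<phi>' x) (at x)"
    "\<And>x. x \<in> {0<..<L} - {c} \<Longrightarrow> (\<phi>' has_real_derivative (a / d) * \<phi>' x + (lam1 - s1 x) / d * \<phi> x) (at x)"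
    "\<phi>' 0 = (a / d) * \<phi> 0" "\<phi>' L = 0" by (rule eigenpair_derivs[OF assms(1,3)], rule that)
  obtain \<psi>' where 2: "\<And>x. x \<in> {0..L} \<Longrightarrow> \<psi> x > 0" "continuous_on {0..L} \<psi>" "continuous_on {0..L} \<psi>'"
    "\<And>x. x \<in> {0<..<L} \<Longrightarrow> (\<psi> has_real_derivative \<psi>' x) (at x)"
    "\<And>x. x \<in> {0<..<L} - {c} \<Longrightarrow> (\<psi>' has_real_derivative (a / d) * \<psi>' x + (lam2 - s2 x) / d * \<psi> x) (at x)"
    "\<psi>' 0 = (a / d) * \<psi> 0" "\<psi>' L = 0" by (rule eigenpair_derivs[OF assms(2,3)], rule that)
  define W where "W x = exp (- (a / d) * x) * (\<psi>' x * \<phi> x - \<phi>' x * \<psi> x)" for x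
  define V where "V x = exp (- (a / d) * x) * (((lam2 - s2 x) / d - (lam1 - s1 x) / d) * (\<psi> x * \<phi> x))" for x
  have dW: "(W has_real_derivative V x) (at x)" if "x \<in> {0<..<L} - {c}" for x
    unfolding W_def V_def by (rule wronskian_deriv) (use 1 2 that in auto)
  have pos: "\<phi> x > 0" "\<psi> x > 0" if "x \<in> {0<..<L}" for x using 1(1) 2(1) that by auto
  have diff: "(lam2 - s2 x) / d - (lam1 - s1 x) / d = ((lam2 - lam1) + (s1 x - s2 x)) / d" for x
    by (simp add: diff_divide_distrib[symmetric])
  have "V x \<ge> 0" if "x \<in> {0<..<L} - {c}" for x
    unfolding V_def diff using pos[of x] that ge[of x] n \<open>d > 0\<close>
    by (intro mult_nonneg_nonneg divide_nonneg_pos) (auto intro: less_imp_le)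
  moreover have "V x0 > 0"
    unfolding V_def diff using pos[of x0] x0 n \<open>d > 0\<close>
    by (intro mult_pos_pos divide_pos_pos) auto
  moreover have "W L \<le> W 0" using 1(6,7) 2(6,7) by (simp add: W_def)
  moreover have "continuous_on {0..L} W" unfolding W_def by (intro continuous_intros 1 2)
  ultimately show False using deriv_zero_of_nonneg_off_finite[of "{c}" 0 L W V x0] dW x0 by force
qed

section \<open>The critical lengths\<close>

text \<open>\<open>ground\<close> solves \<open>d \<phi>'' - a \<phi>' + r \<phi> = 0\<close> with the no-flux condition at \<open>0\<close>; its derivative
  first vanishes at \<open>2 \<vartheta> / \<omega> = L1_star\<close> and \<open>ground\<close> itself at \<open>(pi / 2 + \<vartheta>) / \<omega> = L_star\<close>.\<close>
context
  fixes d a r :: real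
  assumes d: "d > 0" and a: "a > 0" and r: "r > 0" and disc: "a < sqrt (4 * d * r)"
begin

definition freq :: real where "freq = sqrt (4 * d * r - a\<^sup>2) / (2 * d)"
definition phase :: real where "phase = arctan (a / sqrt (4 * d * r - a\<^sup>2))"
definition ground :: "real \<Rightarrow> real" where
  "ground x = exp (a / d / 2 * x) * cos (freq * x - phase)"
definition ground' :: "real \<Rightarrow> real" where
  "ground' x = exp (a / d / 2 * x) * (a / d / 2 * cos (freq * x - phase) - freq * sin (freq * x - phase))"

lemma disc_pos: "4 * d * r - a\<^sup>2 > 0"
proof -
  have "a\<^sup>2 < (sqrt (4 * d * r))\<^sup>2" using a disc by (intro power_strict_mono) auto
  then show ?thesis using d r by simp
qed

lemma freq_pos: "freq > 0" using disc_pos d by (simp add: freq_def)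

lemma freq_sq: "freq\<^sup>2 = r / d - (a / d / 2)\<^sup>2"
  using disc_pos d by (simp add: freq_def power_divide field_simps power2_eq_square)

lemma phase_range: "0 < phase" "phase < pi / 2"
proof -
  show "0 < phase" using disc_pos a by (simp add: phase_def)
  show "phase < pi / 2" unfolding phase_def by (rule arctan_ubound)
qed

lemma tan_phase: "tan phase = a / d / 2 / freq"
  using d by (simp add: phase_def tan_arctan freq_def)

lemma phase_sin_cos: "freq * sin phase = a / d / 2 * cos phase"
proof -
  have "cos phase > 0" using phase_range by (intro cos_gt_zero_pi) auto
  then show ?thesis using tan_phase freq_pos by (simp add: tan_def field_simps)
qed

lemma L_star_eq: "L_star d a r = (pi / 2 + phase) / freq"
proof -
  have "arctan (sqrt (4 * d * r - a\<^sup>2) / a) = pi / 2 - phase"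
    using arctan_inverse[of "a / sqrt (4 * d * r - a\<^sup>2)"] disc_pos a by (simp add: phase_def sgn_if)
  then have "L_star d a r = 2 * d * (pi / 2 + phase) / sqrt (4 * d * r - a\<^sup>2)" by (simp add: L_star_def)
  then show ?thesis using disc_pos d by (simp add: freq_def)
qed

lemma L1_star_eq: "L1_star d a r = 2 * phase / freq"
proof -
  define S where "S = sqrt (4 * d * r - a\<^sup>2)"
  have S: "S > 0" "S\<^sup>2 = 4 * d * r - a\<^sup>2" using disc_pos by (auto simp: S_def)
  define t where "t = a / S"
  have t: "t > 0" using S a by (simp add: t_def)
  have arg: "2 * t / (1 - t\<^sup>2) = a * S / (2 * d * r - a\<^sup>2)"
  proof -
    have "1 - t\<^sup>2 = (S\<^sup>2 - a\<^sup>2) / S\<^sup>2" using S(1) by (simp add: t_def power_divide diff_divide_distrib)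
    then have "2 * t / (1 - t\<^sup>2) = 2 * a * S / (S\<^sup>2 - a\<^sup>2)" using S(1) by (simp add: t_def power2_eq_square)
    also have "S\<^sup>2 - a\<^sup>2 = 2 * (2 * d * r - a\<^sup>2)" using S by simp
    also have "2 * a * S / (2 * (2 * d * r - a\<^sup>2)) = a * S / (2 * d * r - a\<^sup>2)"
      unfolding mult.assoc[of 2] by (rule mult_divide_mult_cancel_left) simp
    finally show ?thesis .
  qed
  have ph: "phase = arctan t" by (simp add: phase_def t_def S_def)
  have main: "L1_star d a r = 2 * d * (2 * arctan t) / S"
  proof (cases "a < sqrt (2 * d * r)")
    case True
    then have "a\<^sup>2 < (sqrt (2 * d * r))\<^sup>2" using a by (intro power_strict_mono) auto
    then have "a\<^sup>2 < 2 * d * r" using d r by simp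
    then have "a\<^sup>2 < S\<^sup>2" using S by simp
    then have "a < S" using less_imp_le[OF S(1)] by (rule power2_less_imp_less)
    then have "\<bar>t\<bar> < 1" using S(1) a by (simp add: t_def)
    then have "2 * arctan t = arctan (a * S / (2 * d * r - a\<^sup>2))" using arctan_double[of t] arg by simp
    then show ?thesis using True by (simp add: L1_star_def S_def)
  next
    case False
    show ?thesis
    proof (cases "a = sqrt (2 * d * r)")
      case True
      then have "a\<^sup>2 = 2 * d * r" using d r by simp
      then have "S\<^sup>2 = a\<^sup>2" using S by simp
      then have "S = a" using less_imp_le[OF S(1)] less_imp_le[OF a] by (rule power2_eq_imp_eq)
      then have "t = 1" using a by (simp add: t_def)
      then show ?thesis using True False by (simp add: L1_star_def S_def arctan_one)
    next
      case neq: False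
      then have gt: "sqrt (2 * d * r) < a" using False by simp
      then have "(sqrt (2 * d * r))\<^sup>2 < a\<^sup>2" using d r by (intro power_strict_mono) auto
      then have "2 * d * r < a\<^sup>2" using d r by simp
      then have "S\<^sup>2 < a\<^sup>2" using S by simp
      then have "S < a" using less_imp_le[OF a] by (rule power2_less_imp_less)
      then have t1: "\<bar>1 / t\<bar> < 1" using S(1) a by (simp add: t_def)
      have "arctan t = pi / 2 - arctan (1 / t)" using arctan_inverse[of "t"] t by (simp add: sgn_if inverse_eq_divide)
      moreover have "2 * arctan (1 / t) = arctan ((2 * (1 / t)) / (1 - (1 / t)\<^sup>2))" by (rule arctan_double[OF t1])
      moreover have "(2 * (1 / t)) / (1 - (1 / t)\<^sup>2) = - (2 * t / (1 - t\<^sup>2))"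
      proof -
        have "1 - (1 / t)\<^sup>2 = (t\<^sup>2 - 1) / t\<^sup>2" using t by (simp add: power_divide diff_divide_distrib)
        then have "(2 * (1 / t)) / (1 - (1 / t)\<^sup>2) = 2 * t / (t\<^sup>2 - 1)" using t by (simp add: power2_eq_square)
        then show ?thesis by (metis minus_diff_eq minus_divide_right)
      qed
      ultimately have "2 * arctan t = pi + arctan (a * S / (2 * d * r - a\<^sup>2))"
        using arg by (simp add: arctan_minus)
      then show ?thesis using False neq by (simp add: L1_star_def S_def)
    qed
  qed
  show ?thesis unfolding main ph freq_def S_def[symmetric] by simp
qed

lemma ground_derivs:
  "(ground has_real_derivative ground' x) (at x)"
  "(ground' has_real_derivative (a / d) * ground' x + (- r / d) * ground x) (at x)"
proof -
  show "(ground has_real_derivative ground' x) (at x)"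
    unfolding ground_def ground'_def by (rule derivative_eq_intros refl)+ (simp add: algebra_simps)
  define E where "E = exp (a / d / 2 * x)"
  define C where "C = cos (freq * x - phase)"
  define S where "S = sin (freq * x - phase)"
  have 1: "(ground' has_real_derivative E * (a / d / 2) * (a / d / 2 * C - freq * S)
      + (a / d / 2 * (- S * freq) - freq * (C * freq)) * E) (at x)"
    unfolding ground'_def E_def C_def S_def by (rule derivative_eq_intros refl)+ simp
  have "E * (a / d / 2) * (a / d / 2 * C - freq * S) + (a / d / 2 * (- S * freq) - freq * (C * freq)) * E
    = (a / d) * (E * (a / d / 2 * C - freq * S)) - ((a / d / 2)\<^sup>2 + freq\<^sup>2) * (E * C)"
    by (simp add: power2_eq_square algebra_simps)
  also have "\<dots> = (a / d) * ground' x + (- r / d) * ground x"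
    unfolding freq_sq ground_def ground'_def E_def[symmetric] C_def[symmetric] S_def[symmetric] by simp
  finally show "(ground' has_real_derivative (a / d) * ground' x + (- r / d) * ground x) (at x)" using 1 by simp
qed

lemma ground_flux: "ground' 0 = (a / d) * ground 0"
  using phase_sin_cos by (simp add: ground'_def ground_def)

lemma ground_pos: "0 \<le> x \<Longrightarrow> x < L_star d a r \<Longrightarrow> ground x > 0"
proof -
  assume x: "0 \<le> x" "x < L_star d a r"
  have "freq * x < pi / 2 + phase" using x(2) freq_pos unfolding L_star_eq by (simp add: field_simps)
  moreover have "freq * x \<ge> 0" using x freq_pos by simp
  ultimately show ?thesis using phase_range unfolding ground_def by (intro mult_pos_pos cos_gt_zero_pi) auto
qed

lemma ground_L_star: "ground (L_star d a r) = 0" "ground' (L_star d a r) < 0"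
proof -
  have e: "freq * L_star d a r - phase = pi / 2" using freq_pos unfolding L_star_eq by simp
  show "ground (L_star d a r) = 0" "ground' (L_star d a r) < 0"
    unfolding ground_def ground'_def e using freq_pos by auto
qed

lemma L_star_pos: "L_star d a r > 0"
  unfolding L_star_eq using freq_pos phase_range pi_gt_zero by (auto intro!: divide_pos_pos add_pos_pos)

lemma L1_less_L_star: "0 < L1_star d a r" "L1_star d a r < L_star d a r"
  unfolding L_star_eq L1_star_eq using freq_pos phase_range by (auto intro!: divide_strict_right_mono)

lemma ground'_neg: "L1_star d a r < x \<Longrightarrow> x < L_star d a r \<Longrightarrow> ground' x < 0"
proof -
  assume x: "L1_star d a r < x" "x < L_star d a r"
  have 1: "freq * x < pi / 2 + phase" using x(2) freq_pos unfolding L_star_eq by (simp add: field_simps)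
  have 2: "2 * phase < freq * x" using x(1) freq_pos unfolding L1_star_eq by (simp add: field_simps)
  define y where "y = freq * x - phase"
  have y: "phase < y" "y < pi / 2" using 1 2 by (auto simp: y_def)
  have "tan phase < tan y" using y phase_range by (intro tan_monotone) auto
  moreover have "cos y > 0" using y phase_range by (intro cos_gt_zero_pi) auto
  ultimately have "a / d / 2 / freq * cos y < sin y" unfolding tan_phase by (simp add: tan_def pos_less_divide_eq)
  then have "freq * (a / d / 2 / freq * cos y) < freq * sin y"
    using freq_pos by (rule mult_strict_left_mono)
  moreover have "freq * (a / d / 2 / freq * cos y) = a / d / 2 * cos y" using freq_pos by simp
  ultimately have "a / d / 2 * cos y < freq * sin y" by linarith
  then show ?thesis unfolding ground'_def y_def[symmetric] by (simp add: mult_pos_neg)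
qed

lemma ground_wronskian:
  assumes "0 \<le> X" "finite S" "continuous_on {0..X} \<phi>" "continuous_on {0..X} \<phi>'"
    and "\<And>x. x \<in> {0<..<X} - S \<Longrightarrow> (\<phi> has_real_derivative \<phi>' x) (at x)"
    and "\<And>x. x \<in> {0<..<X} - S \<Longrightarrow> (\<phi>' has_real_derivative (a / d) * \<phi>' x + \<tau> x * \<phi> x) (at x)"
    and "\<phi>' 0 = (a / d) * \<phi> 0"
    and sgn: "\<And>x. x \<in> {0<..<X} - S \<Longrightarrow> (- r / d - \<tau> x) * (ground x * \<phi> x) \<ge> 0"
  shows "ground' X * \<phi> X - \<phi>' X * ground X \<ge> 0"
proof -
  define W where "W x = exp (- (a / d) * x) * (ground' x * \<phi> x - \<phi>' x * ground x)" for x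
  have cg: "continuous_on A ground" "continuous_on A ground'" for A
    using ground_derivs by (meson DERIV_isCont continuous_at_imp_continuous_on)+
  have "W 0 \<le> W X"
  proof (rule le_of_deriv_nonneg_off_finite[OF assms(1,2)])
    show "continuous_on {0..X} W" unfolding W_def by (intro continuous_intros assms cg)
    fix x assume x: "x \<in> {0<..<X} - S"
    show "(W has_real_derivative exp (- (a / d) * x) * ((- r / d - \<tau> x) * (ground x * \<phi> x))) (at x)"
      unfolding W_def by (rule wronskian_deriv[OF ground_derivs(1) assms(5)[OF x] ground_derivs(2) assms(6)[OF x]])
    show "exp (- (a / d) * x) * ((- r / d - \<tau> x) * (ground x * \<phi> x)) \<ge> 0"
      by (rule mult_nonneg_nonneg[OF less_imp_le[OF exp_gt_zero] sgn[OF x]])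
  qed
  moreover have "W 0 = 0" using assms(7) ground_flux by (simp add: W_def)
  ultimately show ?thesis by (simp add: W_def zero_le_mult_iff)
qed

lemma eigenvalue_pos_large_zone:
  assumes "eigenpair d a s L c lam \<phi>" "L_star d a r \<le> c" "c < L" "\<And>x. x \<in> {0<..<c} \<Longrightarrow> s x = r"
  shows "lam > 0"
proof (rule ccontr)
  assume n: "\<not> lam > 0"
  obtain \<phi>' where 1: "\<And>x. x \<in> {0..L} \<Longrightarrow> \<phi> x > 0" "continuous_on {0..L} \<phi>" "continuous_on {0..L} \<phi>'"
    "\<And>x. x \<in> {0<..<L} \<Longrightarrow> (\<phi> has_real_derivative \<phi>' x) (at x)"
    "\<And>x. x \<in> {0<..<L} - {c} \<Longrightarrow> (\<phi>' has_real_derivative (a / d) * \<phi>' x + (lam - s x) / d * \<phi> x) (at x)"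
    "\<phi>' 0 = (a / d) * \<phi> 0" "\<phi>' L = 0" by (rule eigenpair_derivs[OF assms(1) d], rule that)
  let ?X = "L_star d a r"
  have "ground' ?X * \<phi> ?X - \<phi>' ?X * ground ?X \<ge> 0"
  proof (rule ground_wronskian[where S = "{}" and \<tau> = "\<lambda>x. (lam - s x) / d"])
    fix x assume x: "x \<in> {0<..<?X} - {}"
    then have s: "s x = r" using assms by auto
    show "(\<phi>' has_real_derivative (a / d) * \<phi>' x + (lam - s x) / d * \<phi> x) (at x)"
      by (rule 1(5)) (use x assms in auto)
    have "- r / d - (lam - s x) / d = - lam / d" unfolding s by (simp add: diff_divide_distrib)
    moreover have "ground x * \<phi> x \<ge> 0" using x ground_pos[of x] 1(1)[of x] assms by auto
    moreover have "- lam / d \<ge> 0" using n d by (intro divide_nonneg_pos) auto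
    ultimately show "(- r / d - (lam - s x) / d) * (ground x * \<phi> x) \<ge> 0" by (metis mult_nonneg_nonneg)
  qed (use assms L_star_pos 1 in \<open>auto intro: continuous_on_subset\<close>)
  moreover have "\<phi> ?X > 0" using 1(1)[of ?X] assms L_star_pos by auto
  ultimately show False using ground_L_star by (simp add: zero_le_mult_iff)
qed

lemma pruefer_angle_const_neg:
  assumes L: "L > L1_star d a r" and P: "pruefer_angle (a / d) (\<lambda>_. - r / d) L c \<theta>" and "0 \<le> c" "c \<le> L"
  shows "\<theta> L < 0"
proof (rule ccontr)
  assume n: "\<not> \<theta> L < 0"
  have \<alpha>: "a / d \<ge> 0" using a d by simp
  have L0: "L > 0" using L L1_less_L_star by simp
  have pcr: "pc 0 L c (\<lambda>_. - r / d)" using assms by (intro pc_continuous_on) auto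
  have range: "- pi / 2 < \<theta> x \<and> \<theta> x < pi / 2" if "x \<in> {0..L}" for x
  proof -
    have "\<not> \<theta> x \<le> - pi / 2"
      using pruefer_angle_stays_below[OF \<alpha> L0 order.refl P, of x L] that n pi_gt_zero by auto
    then show ?thesis using pruefer_angle_less_half_pi[OF \<alpha> L0 order.refl P that] by simp
  qed
  obtain \<rho> where \<rho>: "\<And>x. \<rho> x > (0::real)" "continuous_on {0..L} \<rho>"
    "\<And>x. x \<in> {0..L} \<Longrightarrow> ((\<lambda>x. \<rho> x * cos (\<theta> x)) has_real_derivative \<rho> x * sin (\<theta> x)) (at x within {0..L})"
    "\<And>x. x \<in> {0<..<L} - {c} \<Longrightarrow> ((\<lambda>x. \<rho> x * sin (\<theta> x)) has_real_derivative
        (a / d) * (\<rho> x * sin (\<theta> x)) + (- r / d) * (\<rho> x * cos (\<theta> x))) (at x)"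
    by (rule pruefer_linear[OF assms(3,4) L0 pcr P], rule that)
  have c\<theta>: "continuous_on {0..L} \<theta>" and \<theta>0: "\<theta> 0 = arctan (a / d)" using P by (auto simp: pruefer_angle_def)
  define \<phi> where "\<phi> x = \<rho> x * cos (\<theta> x)" for x
  define \<phi>' where "\<phi>' x = \<rho> x * sin (\<theta> x)" for x
  have pos: "\<phi> x > 0" if "x \<in> {0..L}" for x
    unfolding \<phi>_def using \<rho>(1) range[OF that] by (intro mult_pos_pos cos_gt_zero_pi) auto
  have cont: "continuous_on {0..L} \<phi>" "continuous_on {0..L} \<phi>'"
    unfolding \<phi>_def \<phi>'_def by (intro continuous_intros \<rho>(2) c\<theta>)+
  have d1: "(\<phi> has_real_derivative \<phi>' x) (at x)" if "x \<in> {0<..<L}" for x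
  proof -
    have "at x within {0..L} = at x" using that by (intro at_within_Icc_at) auto
    then show ?thesis using \<rho>(3)[of x] that unfolding \<phi>_def[abs_def] \<phi>'_def by auto
  qed
  have d2: "(\<phi>' has_real_derivative (a / d) * \<phi>' x + (- r / d) * \<phi> x) (at x)" if "x \<in> {0<..<L} - {c}" for x
    using \<rho>(4)[OF that] unfolding \<phi>_def \<phi>'_def[abs_def] .
  have fl: "\<phi>' 0 = (a / d) * \<phi> 0" by (simp add: \<phi>_def \<phi>'_def \<theta>0 sin_arctan cos_arctan)
  define X where "X = min L ((L1_star d a r + L_star d a r) / 2)"
  have X: "L1_star d a r < X" "X < L_star d a r" "X \<le> L" "0 \<le> X"
    using L L1_less_L_star L_star_pos by (auto simp: X_def min_def)
  have "ground' X * \<phi> X - \<phi>' X * ground X \<ge> 0"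
    by (rule ground_wronskian[where S = "{c}" and \<tau> = "\<lambda>_. - r / d"])
       (use X d1 d2 fl cont in \<open>auto intro: continuous_on_subset\<close>)
  moreover have "ground' X * \<phi> X < 0" using ground'_neg[OF X(1,2)] pos[of X] X by (simp add: mult_neg_pos)
  ultimately have "\<phi>' X * ground X < 0" by simp
  then have neg: "\<phi>' X < 0" using ground_pos[OF X(4,2)] by (simp add: mult_less_0_iff)
  define w where "w x = exp (- (a / d) * x) * \<phi>' x" for x
  have "- w X \<le> - w L"
  proof (rule le_of_deriv_nonneg_off_finite[of X L "{c}" "\<lambda>x. - w x" "\<lambda>x. exp (- (a / d) * x) * (r / d * \<phi> x)"])
    fix x assume x: "x \<in> {X<..<L} - {c}"
    then have x': "x \<in> {0<..<L} - {c}" using X by auto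
    have "((\<lambda>x. - w x) has_real_derivative - (- (a / d) * exp (- (a / d) * x) * \<phi>' x + ((a / d) * \<phi>' x + (- r / d) * \<phi> x) * exp (- (a / d) * x))) (at x)"
      unfolding w_def by (rule derivative_eq_intros d2[OF x'] refl)+ simp
    then show "((\<lambda>x. - w x) has_real_derivative exp (- (a / d) * x) * (r / d * \<phi> x)) (at x)"
      by (simp add: algebra_simps)
    show "exp (- (a / d) * x) * (r / d * \<phi> x) \<ge> 0" using pos[of x] x' r d by (intro mult_nonneg_nonneg) auto
  qed (use X cont d in \<open>auto simp: w_def intro!: continuous_intros intro: continuous_on_subset\<close>)
  moreover have "w X < 0" using neg by (simp add: w_def mult_pos_neg)
  ultimately have "w L < 0" by simp
  then have "sin (\<theta> L) < 0" using \<rho>(1)[of L] by (simp add: w_def \<phi>'_def mult_less_0_iff not_less[symmetric])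
  moreover have "sin (\<theta> L) \<ge> 0" using n range[of L] L0 pi_gt_zero by (intro sin_ge_zero) auto
  ultimately show False by simp
qed

lemma pruefer_angle_const_gt:
  assumes P: "pruefer_angle (a / d) (\<lambda>_. - r / d) L c \<theta>" and "0 \<le> c" "c < L" "c < L_star d a r"
  shows "- pi / 2 < \<theta> c"
proof (rule ccontr)
  assume n: "\<not> - pi / 2 < \<theta> c"
  have L0: "L > 0" using assms by simp
  have pcr: "pc 0 L c (\<lambda>_. - r / d)" using assms by (intro pc_continuous_on) auto
  have c\<theta>: "continuous_on {0..L} \<theta>" and \<theta>0: "\<theta> 0 = arctan (a / d)" using P by (auto simp: pruefer_angle_def)
  have "\<theta> 0 \<ge> 0" using a d by (simp add: \<theta>0)
  then obtain X where X: "0 \<le> X" "X \<le> c" "\<theta> X = - pi / 2"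
    using IVT2'[of \<theta> c "- pi / 2" 0] n continuous_on_subset[OF c\<theta>, of "{0..c}"] assms pi_gt_zero by auto
  obtain \<rho> where \<rho>: "\<And>x. \<rho> x > (0::real)" "continuous_on {0..L} \<rho>"
    "\<And>x. x \<in> {0..L} \<Longrightarrow> ((\<lambda>x. \<rho> x * cos (\<theta> x)) has_real_derivative \<rho> x * sin (\<theta> x)) (at x within {0..L})"
    "\<And>x. x \<in> {0<..<L} - {c} \<Longrightarrow> ((\<lambda>x. \<rho> x * sin (\<theta> x)) has_real_derivative
        (a / d) * (\<rho> x * sin (\<theta> x)) + (- r / d) * (\<rho> x * cos (\<theta> x))) (at x)"
    by (rule pruefer_linear[OF assms(2) less_imp_le[OF assms(3)] L0 pcr P], rule that)
  have neg: "ground' X * - (\<rho> X * cos (\<theta> X)) - - (\<rho> X * sin (\<theta> X)) * ground X \<ge> 0"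
  proof (rule ground_wronskian[where S = "{}" and \<tau> = "\<lambda>_. - r / d" and \<phi> = "\<lambda>x. - (\<rho> x * cos (\<theta> x))"
        and \<phi>' = "\<lambda>x. - (\<rho> x * sin (\<theta> x))"])
    fix x assume x: "x \<in> {0<..<X} - {}"
    then have "at x within {0..L} = at x" using X assms by (intro at_within_Icc_at) auto
    then show "((\<lambda>x. - (\<rho> x * cos (\<theta> x))) has_real_derivative - (\<rho> x * sin (\<theta> x))) (at x)"
      using \<rho>(3)[of x] x X assms by (intro DERIV_minus) auto
    have "((\<lambda>x. - (\<rho> x * sin (\<theta> x))) has_real_derivative - ((a / d) * (\<rho> x * sin (\<theta> x)) + (- r / d) * (\<rho> x * cos (\<theta> x)))) (at x)"
      using x X assms by (intro DERIV_minus \<rho>(4)) auto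
    then show "((\<lambda>x. - (\<rho> x * sin (\<theta> x))) has_real_derivative
        (a / d) * - (\<rho> x * sin (\<theta> x)) + (- r / d) * - (\<rho> x * cos (\<theta> x))) (at x)" by (simp add: algebra_simps)
  next
    show "- (\<rho> 0 * sin (\<theta> 0)) = (a / d) * - (\<rho> 0 * cos (\<theta> 0))" by (simp add: \<theta>0 sin_arctan cos_arctan)
  qed (use X assms in \<open>auto intro!: continuous_intros continuous_on_subset[OF \<rho>(2)] continuous_on_subset[OF c\<theta>]\<close>)
  have "cos (\<theta> X) = 0" "sin (\<theta> X) = - 1" by (simp_all add: X(3))
  then have "\<rho> X * ground X \<le> 0" using neg by simp
  moreover have "ground X > 0" using X assms by (intro ground_pos) auto
  ultimately show False using \<rho>(1)[of X] by (simp add: mult_le_0_iff)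
qed

lemma critical_coefficient_exists:
  assumes "0 \<le> c" "c < L" "L > L1_star d a r" "c < L_star d a r"
    and w: "continuous_on {c..L} w" "\<And>x. x \<in> {c..L} \<Longrightarrow> w x > 0"
  shows "\<exists>m>0. \<exists>\<phi>. eigenpair d a (\<lambda>x. r - m * chi c L x * w x) L c 0 \<phi>"
proof -
  define \<alpha> where "\<alpha> = a / d"
  have \<alpha>: "\<alpha> \<ge> 0" using a d by (simp add: \<alpha>_def)
  have L0: "L > 0" and cL: "c \<le> L" using assms by auto
  define \<sigma> where "\<sigma> m x = (- r + m * (chi c L x * w x)) / d" for m x
  have pc\<sigma>: "pc 0 L c (\<sigma> m)" for m
  proof -
    have "pc 0 L c (\<lambda>x. (- r + m * (chi c L x * w x)) * (1 / d))"
      by (intro pc_mult pc_add pc_chi w pc_continuous_on assms cL continuous_intros)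
    then show ?thesis by (simp add: \<sigma>_def[abs_def])
  qed
  obtain w0 where w0: "w0 > 0" "\<And>x. x \<in> {c..L} \<Longrightarrow> w x \<ge> w0"
  proof -
    obtain x0 where "x0 \<in> {c..L}" "\<And>x. x \<in> {c..L} \<Longrightarrow> w x0 \<le> w x"
      using continuous_attains_inf[OF compact_Icc _ w(1)] cL by (metis atLeastAtMost_iff empty_iff order.refl)
    then show thesis using w(2) that[of "w x0"] by blast
  qed
  obtain w1 where w1: "w1 > 0" "\<And>x. x \<in> {c..L} \<Longrightarrow> \<bar>w x\<bar> \<le> w1"
    using continuous_on_Icc_bounded[OF w(1)] by blast
  have chiw: "\<bar>chi c L x * w x\<bar> \<le> w1" for x using w1 by (auto simp: chi_def)
  have s0: "\<sigma> 0 = (\<lambda>_. - r / d)" by (auto simp: \<sigma>_def)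
  obtain \<theta>0 where \<theta>0: "pruefer_angle \<alpha> (\<sigma> 0) L c \<theta>0" using pruefer_angle_exists[OF \<alpha> L0 assms(1) cL pc\<sigma>] by blast
  have same: "\<theta> c = \<theta>0 c" if P: "pruefer_angle \<alpha> (\<sigma> m) L c \<theta>" for m \<theta>
  proof (cases "c = 0")
    case True then show ?thesis using P \<theta>0 by (simp add: pruefer_angle_def)
  next
    case False
    then have c0: "c > 0" using assms by simp
    have sub: "pruefer_angle \<alpha> (\<lambda>_. - r / d) c c \<theta>'" if "pruefer_angle \<alpha> (\<sigma> m') L c \<theta>'" for m' \<theta>'
    proof -
      have eq: "pruefer \<alpha> (\<sigma> m') x y = pruefer \<alpha> (\<lambda>_. - r / d) x y" if "x < c" for x y
        using that by (simp add: pruefer_def \<sigma>_def chi_def)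
      have "(\<theta>' has_real_derivative pruefer \<alpha> (\<lambda>_. - r / d) x (\<theta>' x)) (at x)" if "x \<in> {0<..<c} - {c}" for x
      proof -
        have "(\<theta>' has_real_derivative pruefer \<alpha> (\<sigma> m') x (\<theta>' x)) (at x)"
          using that \<open>pruefer_angle \<alpha> (\<sigma> m') L c \<theta>'\<close> assms(2) unfolding pruefer_angle_def by auto
        then show ?thesis using eq[of x "\<theta>' x"] that by simp
      qed
      then show ?thesis using that assms(2) unfolding pruefer_angle_def by (auto intro: continuous_on_subset)
    qed
    have "\<bar>\<theta> c - \<theta>0 c\<bar> \<le> 2 * 0 * c * exp (2 * (\<alpha> + 2 * \<bar>- r / d\<bar> + 2) * c)"
      by (rule pruefer_angle_dependence[OF \<alpha> c0 _ _ _ sub[OF P] sub[OF \<theta>0]]) (use c0 in auto)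
    then show ?thesis by simp
  qed
  define y1 where "y1 = min (\<theta>0 c) 0"
  have y1: "- pi / 2 < y1" "y1 \<le> 0"
    using pruefer_angle_const_gt[OF \<theta>0[unfolded s0 \<alpha>_def] assms(1,2,4)] pi_gt_zero by (auto simp: y1_def)
  define y0 where "y0 = (y1 - pi / 2) / 2"
  have y0: "- pi / 2 < y0" "y0 < y1" using y1 by (auto simp: y0_def field_simps)
  define \<kappa> where "\<kappa> = (cos y0)\<^sup>2"
  have "cos y0 > 0" using y0 y1 pi_gt_zero by (intro cos_gt_zero_pi) linarith+
  then have \<kappa>: "\<kappa> > 0" "\<kappa> \<le> 1" by (auto simp: \<kappa>_def abs_square_le_1)
  define N where "N = (\<alpha> + 1 + 4 / (L - c)) / \<kappa>"
  have N1: "\<alpha> + 1 + 4 / (L - c) \<ge> 1" using \<alpha> assms by simp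
  then have N: "N \<ge> 1" "N * \<kappa> = \<alpha> + 1 + 4 / (L - c)" using \<kappa> by (auto simp: N_def pos_le_divide_eq)
  define M where "M = (d * N + r) / w0"
  have M: "M > 0" using d r w0 N by (auto simp: M_def intro!: divide_pos_pos add_pos_pos mult_pos_pos)
  have \<sigma>M: "\<sigma> M x \<ge> N" if "x \<in> {c<..L}" for x
  proof -
    have "d * N + r = M * w0" using w0 by (simp add: M_def)
    also have "\<dots> \<le> M * w x" using w0(2)[of x] that M by (intro mult_left_mono) auto
    finally show ?thesis using that d by (simp add: \<sigma>_def chi_def pos_le_divide_eq mult.commute)
  qed
  have hi: "\<theta> L \<ge> 0" if P: "pruefer_angle \<alpha> (\<sigma> M) L c \<theta>" for \<theta>
  proof (rule ccontr)
    assume n: "\<not> \<theta> L \<ge> 0"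
    have c\<theta>: "continuous_on {0..L} \<theta>"
      and d\<theta>: "\<And>x. x \<in> {0<..<L} - {c} \<Longrightarrow> (\<theta> has_real_derivative pruefer \<alpha> (\<sigma> M) x (\<theta> x)) (at x)"
      using P by (auto simp: pruefer_angle_def)
    have lt: "\<theta> x < 0" if "x \<in> {c..L}" for x
    proof (rule ccontr)
      assume "\<not> \<theta> x < 0"
      then have "\<theta> L \<ge> 0"
      proof (intro pruefer_angle_stays_nonneg[OF P, of x L N])
        show "\<sigma> M z \<ge> N" if "z \<in> {x<..<L} - {c}" for z using \<sigma>M[of z] that \<open>x \<in> {c..L}\<close> by auto
      qed (use that N assms in auto)
      then show False using n by simp
    qed
    have y1': "\<theta> c = y1" using same[OF P] lt[of c] cL by (simp add: y1_def)
    have rate: "pruefer \<alpha> (\<sigma> M) x (\<theta> x) \<ge> 4 / (L - c)" if x: "x \<in> {c<..<L}" and ge: "\<theta> x \<ge> y0" for x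
    proof -
      have "cos (- \<theta> x) \<ge> cos (- y0)" using ge lt[of x] x y0 pi_gt_zero by (intro cos_monotone_0_pi_le) auto
      then have "(cos (\<theta> x))\<^sup>2 \<ge> \<kappa>" unfolding \<kappa>_def using \<open>cos y0 > 0\<close> by (intro power_mono) auto
      then have "N * \<kappa> \<le> \<sigma> M x * (cos (\<theta> x))\<^sup>2" using \<sigma>M[of x] x N \<kappa> by (intro mult_mono) auto
      moreover have "\<alpha> * (sin (\<theta> x) * cos (\<theta> x)) \<ge> \<alpha> * (- 1)"
      proof (rule mult_left_mono)
        have "\<bar>sin (\<theta> x) * cos (\<theta> x)\<bar> \<le> 1" unfolding abs_mult by (rule mult_le_one) auto
        then show "- 1 \<le> sin (\<theta> x) * cos (\<theta> x)" by simp
      qed (use \<alpha> in auto)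
      moreover have "(sin (\<theta> x))\<^sup>2 \<le> 1" by (simp add: abs_square_le_1)
      ultimately show ?thesis using N(2) unfolding pruefer_def by linarith
    qed
    have rate0: "4 / (L - c) \<ge> 0" using assms by simp
    have ge: "\<theta> x \<ge> y1" if x: "x \<in> {c..L}" for x
    proof (rule barrier_below[of c x "{}" \<theta> y1 "y1 - y0" "\<lambda>x. pruefer \<alpha> (\<sigma> M) x (\<theta> x)"])
      fix z assume "z \<in> {c<..<x} - {}" "y1 - (y1 - y0) < \<theta> z"
      then show "0 \<le> pruefer \<alpha> (\<sigma> M) z (\<theta> z)" using x by (intro order_trans[OF rate0 rate]) auto
    qed (use x y0 y1' d\<theta> assms c\<theta> in \<open>auto intro: continuous_on_subset\<close>)
    have "\<theta> c - 4 / (L - c) * c \<le> \<theta> L - 4 / (L - c) * L"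
    proof (rule le_of_deriv_nonneg_off_finite[of c L "{}" "\<lambda>x. \<theta> x - 4 / (L - c) * x" "\<lambda>x. pruefer \<alpha> (\<sigma> M) x (\<theta> x) - 4 / (L - c)"])
      fix x assume x: "x \<in> {c<..<L} - {}"
      then have "(\<theta> has_real_derivative pruefer \<alpha> (\<sigma> M) x (\<theta> x)) (at x)" using assms by (intro d\<theta>) auto
      then show "((\<lambda>x. \<theta> x - 4 / (L - c) * x) has_real_derivative pruefer \<alpha> (\<sigma> M) x (\<theta> x) - 4 / (L - c)) (at x)"
        by (rule DERIV_diff[OF _ DERIV_cmult_Id])
      show "0 \<le> pruefer \<alpha> (\<sigma> M) x (\<theta> x) - 4 / (L - c)" using rate[of x] ge[of x] x y0 by auto
    qed (use assms in \<open>auto intro!: continuous_intros continuous_on_subset[OF c\<theta>]\<close>)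
    then have "\<theta> L \<ge> y1 + 4 / (L - c) * (L - c)" using y1' unfolding right_diff_distrib by linarith
    moreover have "4 / (L - c) * (L - c) = 4"
      unfolding times_divide_eq_left using assms(2) by (intro nonzero_mult_div_cancel_right) simp
    ultimately have "\<theta> L \<ge> y1 + 4" by linarith
    then show False using n y1 pi_less_4 by simp
  qed
  obtain m \<theta> where m: "m \<in> {0..M}" "pruefer_angle \<alpha> (\<sigma> m) L c \<theta>" "\<theta> L = 0"
  proof (rule pruefer_angle_intermediate[OF \<alpha> L0 assms(1) cL less_imp_le[OF M], of "w1 / d" \<sigma> "(r + M * w1) / d"])
    show "\<bar>\<sigma> \<tau> x\<bar> \<le> (r + M * w1) / d" if "\<tau> \<in> {0..M}" for \<tau> x
    proof -
      have "\<bar>\<tau> * (chi c L x * w x)\<bar> \<le> M * w1" unfolding abs_mult[of \<tau>] using that chiw[of x] by (intro mult_mono) auto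
      then have "\<bar>- r + \<tau> * (chi c L x * w x)\<bar> \<le> r + M * w1" using r by linarith
      then show ?thesis using d by (simp add: \<sigma>_def abs_divide divide_right_mono)
    qed
    show "\<bar>\<sigma> \<tau> x - \<sigma> \<tau>' x\<bar> \<le> w1 / d * \<bar>\<tau> - \<tau>'\<bar>" for \<tau> \<tau>' x
    proof -
      have "\<sigma> \<tau> x - \<sigma> \<tau>' x = (chi c L x * w x) / d * (\<tau> - \<tau>')" using d by (simp add: \<sigma>_def field_simps)
      moreover have "\<bar>(chi c L x * w x) / d\<bar> \<le> w1 / d" using chiw[of x] d by (simp add: abs_divide divide_right_mono)
      then have "\<bar>(chi c L x * w x) / d\<bar> * \<bar>\<tau> - \<tau>'\<bar> \<le> w1 / d * \<bar>\<tau> - \<tau>'\<bar>" by (rule mult_right_mono) simp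
      ultimately show ?thesis by (metis abs_mult)
    qed
    show "\<theta> L \<le> 0" if "pruefer_angle \<alpha> (\<sigma> 0) L c \<theta>" for \<theta>
      using pruefer_angle_const_neg[OF assms(3) _ assms(1) cL] that unfolding s0 \<alpha>_def by force
  qed (use pc\<sigma> hi w1 d in auto)
  have "m \<noteq> 0"
    using pruefer_angle_const_neg[OF assms(3) _ assms(1) cL, of \<theta>] m(2,3) by (auto simp: s0 \<alpha>_def)
  then have "m > 0" using m by auto
  moreover have "\<exists>\<phi>. eigenpair d a (\<lambda>x. r - m * chi c L x * w x) L c 0 \<phi>"
    by (rule eigenpair_of_pruefer[OF d less_imp_le[OF a] L0 assms(1) cL pc\<sigma> m(2)[unfolded \<alpha>_def] m(3)])
       (simp add: \<sigma>_def mult.assoc)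
  ultimately show ?thesis by blast
qed

end

section \<open>The resource in the absence of the consumer\<close>

context
  fixes d a h q A B :: real
  assumes d: "d > 0" and a: "a \<ge> 0" and h: "h > 0" and q: "q > 0" and AB: "A < B"
begin

lemma w_tilde_props:
  shows "\<And>x. x \<in> {A..B} \<Longrightarrow> w_tilde d a h q B A x > 0"
    and "bvp d a A B A (\<lambda>x. h - q * w_tilde d a h q B A x) (w_tilde d a h q B A)"
proof -
  obtain P P' Q Q' \<omega> where fp: "fundamental_pair d a q A B P P' Q Q' \<omega>"
    using fundamental_pair_exists[OF d a q AB] by blast
  define Z where "Z = green d a A B P Q \<omega> (\<lambda>_. h)"
  have pch: "pc A B A (\<lambda>_. h)" using AB by (intro pc_continuous_on) auto
  have posZ: "Z x > 0" if "x \<in> {A..B}" for x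
    unfolding Z_def by (rule green_pos[OF d order.refl AB fp pch _ h that]) simp
  have bZ: "bvp d a A B A (\<lambda>x. h - q * Z x) Z" unfolding Z_def by (rule green_bvp[OF d order.refl AB fp pch])
  have cZ: "continuous_on {A..B} Z" by (rule bvp_continuous[OF bZ])
  obtain Z' where Z': "\<forall>x\<in>{A..B}. (Z has_real_derivative Z' x) (at x within {A..B})" "continuous_on {A..B} Z'"
     "\<forall>x\<in>{A<..<B} - {A}. (Z' has_real_derivative (a * Z' x - (h - q * Z x)) / d) (at x)"
     "d * Z' A = a * Z A" "Z' B = 0"
    using bZ unfolding bvp_def by blast
  have c2: "continuous_on {A..B} (\<lambda>x. (a * Z' x - (h - q * Z x)) / d)"
    using d by (intro continuous_intros Z' cZ) auto
  have Z2: "(Z' has_real_derivative (a * Z' x - (h - q * Z x)) / d) (at x within {A..B})" if "x \<in> {A..B}" for x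
    by (rule has_derivative_across_finite[OF finite.emptyI Z'(2) c2 _ that]) (use Z' in auto)
  have eq: "d * ((a * Z' x - (h - q * Z x)) / d) - a * Z' x + h - q * Z x = 0" for x
    using d by simp
  let ?P = "\<lambda>w. (\<forall>x\<in>{A..B}. w x > 0) \<and>
     (\<exists>w' w''. (\<forall>x\<in>{A..B}. (w has_real_derivative w' x) (at x within {A..B}) \<and>
                              (w' has_real_derivative w'' x) (at x within {A..B})) \<and>
               (\<forall>x\<in>{A<..<B}. d * w'' x - a * w' x + h - q * w x = 0) \<and>
               d * w' A - a * w A = 0 \<and> w' B = 0)"
  have "?P Z"
    by (intro conjI exI[of _ Z'] exI[of _ "\<lambda>x. (a * Z' x - (h - q * Z x)) / d"] ballI posZ Z2 eq)
       (use Z'(1,4,5) in simp_all)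
  then have wt: "?P (SOME w. ?P w)" by (rule someI[of ?P])
  define w where "w = w_tilde d a h q B A"
  have w_eq: "(SOME w. ?P w) = w" unfolding w_def w_tilde_def ..
  from wt obtain w' w'' where w: "\<forall>x\<in>{A..B}. w x > 0"
    "\<forall>x\<in>{A..B}. (w has_real_derivative w' x) (at x within {A..B}) \<and> (w' has_real_derivative w'' x) (at x within {A..B})"
    "\<forall>x\<in>{A<..<B}. d * w'' x - a * w' x + h - q * w x = 0" "d * w' A - a * w A = 0" "w' B = 0"
    unfolding w_eq by blast
  show "\<And>x. x \<in> {A..B} \<Longrightarrow> w_tilde d a h q B A x > 0" using w(1) by (simp add: w_def)
  have "bvp d a A B A (\<lambda>x. h - q * w x) w" unfolding bvp_def
  proof (intro exI[of _ w'] conjI ballI)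
    show "continuous_on {A..B} w'" using w(2) by (meson DERIV_continuous continuous_on_eq_continuous_within)
    fix x assume x: "x \<in> {A<..<B} - {A}"
    have "at x within {A..B} = at x" using x by (intro at_within_Icc_at) auto
    then have "(w' has_real_derivative w'' x) (at x)" using w(2) x by (metis Diff_iff atLeastAtMost_iff greaterThanLessThan_iff less_imp_le)
    moreover have "d * w'' x - a * w' x + h - q * w x = 0" using w(3) x by auto
    then have "w'' x = (a * w' x - (h - q * w x)) / d" using d by (simp add: field_simps)
    ultimately show "(w' has_real_derivative (a * w' x - (h - q * w x)) / d) (at x)" by simp
  qed (use w in auto)
  then show "bvp d a A B A (\<lambda>x. h - q * w_tilde d a h q B A x) (w_tilde d a h q B A)" by (simp add: w_def)
qed

lemma w_tilde_le_end:
  assumes "x \<in> {A..B}"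
  shows "w_tilde d a h q B A x \<le> w_tilde d a h q B A B"
proof -
  define w where "w = w_tilde d a h q B A"
  have bw: "bvp d a A B A (\<lambda>x. h - q * w x) w" and wpos: "\<And>x. x \<in> {A..B} \<Longrightarrow> w x > 0"
    using w_tilde_props by (auto simp: w_def)
  obtain w' where w: "\<forall>x\<in>{A..B}. (w has_real_derivative w' x) (at x within {A..B})" "continuous_on {A..B} w'"
     "\<forall>x\<in>{A<..<B} - {A}. (w' has_real_derivative (a * w' x - (h - q * w x)) / d) (at x)"
     "d * w' A = a * w A" "w' B = 0"
    using bw unfolding bvp_def by blast
  have cw: "continuous_on {A..B} w" by (rule bvp_continuous[OF bw])
  have dw: "(w has_real_derivative w' x) (at x)" if "x \<in> {A<..<B}" for x
  proof -
    have "at x within {A..B} = at x" using that by (intro at_within_Icc_at) auto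
    then show ?thesis using w(1) that by (metis atLeastAtMost_iff greaterThanLessThan_iff less_imp_le)
  qed
  define e where "e x = exp (- (a / d) * x)" for x
  have epos: "e x > 0" for x by (simp add: e_def)
  have ce: "continuous_on X e" for X unfolding e_def by (intro continuous_intros)
  have de: "((\<lambda>x. e x * w' x) has_real_derivative e x * ((q * w x - h) / d)) (at x)" if x: "x \<in> {A<..<B}" for x
  proof -
    have 1: "(w' has_real_derivative (a * w' x - (h - q * w x)) / d) (at x)" using w(3) x by auto
    have 2: "(e has_real_derivative - (a / d) * e x) (at x)" unfolding e_def using d by (auto intro!: derivative_eq_intros)
    show ?thesis by (rule DERIV_cong[OF DERIV_mult[OF 2 1]]) (use d in \<open>simp add: field_simps\<close>)
  qed
  have sgn: "e x * w' x * (q * w x - h) \<le> 0" if x: "x \<in> {A..B}" for x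
  proof -
    have "e x * w' x * (q * w x - h) \<le> e B * w' B * (q * w B - h)"
    proof (rule le_of_deriv_nonneg_off_finite[of x B "{}" "\<lambda>x. e x * w' x * (q * w x - h)"
           "\<lambda>x. e x * ((q * w x - h) / d) * (q * w x - h) + (q * w' x) * (e x * w' x)"])
      fix y assume y: "y \<in> {x<..<B} - {}"
      then have y': "y \<in> {A<..<B}" using x by auto
      have "((\<lambda>x. q * w x - h) has_real_derivative q * w' y) (at y)"
        using dw[OF y'] by (auto intro!: derivative_eq_intros)
      from DERIV_mult[OF de[OF y'] this]
      show "((\<lambda>x. e x * w' x * (q * w x - h)) has_real_derivative
         e y * ((q * w y - h) / d) * (q * w y - h) + (q * w' y) * (e y * w' y)) (at y)" .
      have "e y * ((q * w y - h) / d) * (q * w y - h) + (q * w' y) * (e y * w' y)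
         = e y * ((q * w y - h)\<^sup>2 / d) + e y * (q * (w' y)\<^sup>2)" by (simp add: power2_eq_square)
      also have "\<dots> \<ge> 0" using d q epos[of y] by (intro add_nonneg_nonneg mult_nonneg_nonneg divide_nonneg_pos) (auto intro: less_imp_le)
      finally show "0 \<le> e y * ((q * w y - h) / d) * (q * w y - h) + (q * w' y) * (e y * w' y)" .
    qed (use x in \<open>auto intro!: continuous_intros ce continuous_on_subset[OF cw] continuous_on_subset[OF w(2)]\<close>)
    then show ?thesis using w(5) by simp
  qed
  have nonneg: "e x * w' x \<ge> 0" if x: "x \<in> {A..B}" for x
  proof (rule barrier_below[of A x "{}" "\<lambda>x. e x * w' x" 0 1 "\<lambda>x. e x * ((q * w x - h) / d)"])
    have "d * w' A \<ge> 0" using w(4) a wpos[of A] AB by simp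
    then show "0 \<le> e A * w' A" using d epos[of A] by (simp add: zero_le_mult_iff)
    fix y assume y: "y \<in> {A<..<x} - {}" "e y * w' y < 0"
    have "q * w y - h \<ge> 0"
      using sgn[of y] y x by (auto simp: mult_le_0_iff)
    then show "e y * ((q * w y - h) / d) \<ge> 0" using epos[of y] d by simp
  qed (use x de in \<open>auto intro!: continuous_intros ce continuous_on_subset[OF w(2)]\<close>)
  have "w x \<le> w B"
  proof (rule le_of_deriv_nonneg_off_finite[of x B "{}" w w'])
    show "0 \<le> w' y" if "y \<in> {x<..<B} - {}" for y
      using nonneg[of y] epos[of y] that assms by (simp add: zero_le_mult_iff)
  qed (use assms dw cw in \<open>auto intro: continuous_on_subset\<close>)
  then show ?thesis by (simp add: w_def)
qed

end

section \<open>Uniqueness of coexistence states\<close>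

text \<open>The weight \<open>(v - u) \<bar>v - u\<bar> / (u v)\<close> is an increasing function of \<open>v / u\<close>, hence the second
  summand of the derivative is nonnegative; in the first one the factors \<open>u\<close> and \<open>v\<close> cancel.\<close>
lemma cubic_wronskian_deriv:
  fixes u u' v v' :: "real \<Rightarrow> real"
  assumes "(u has_real_derivative u' x) (at x)" "(v has_real_derivative v' x) (at x)"
    and "(u' has_real_derivative \<alpha> * u' x + \<sigma> * u x) (at x)" "(v' has_real_derivative \<alpha> * v' x + \<tau> * v x) (at x)"
    and "u x > 0" "v x > 0"
  shows "((\<lambda>x. exp (- \<alpha> * x) * (v' x * u x - u' x * v x) * ((v x - u x) * \<bar>v x - u x\<bar> / (u x * v x))) has_real_derivative
     exp (- \<alpha> * x) * ((\<tau> - \<sigma>) * ((v x - u x) * \<bar>v x - u x\<bar>) +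
        \<bar>v x - u x\<bar> * (u x + v x) * (v' x * u x - u' x * v x)\<^sup>2 / (u x * v x)\<^sup>2)) (at x)"
proof -
  have 1: "((\<lambda>x. exp (- \<alpha> * x) * (v' x * u x - u' x * v x)) has_real_derivative
     exp (- \<alpha> * x) * ((\<tau> - \<sigma>) * (v x * u x))) (at x)"
    by (rule wronskian_deriv[of v v' x u u', OF assms(2,1,4,3)])
  have abs: "((\<lambda>y. y * \<bar>y\<bar>) has_real_derivative 2 * \<bar>y\<bar>) (at y)" for y :: real
  proof (cases "y = 0")
    case True
    have "((\<lambda>h. h * \<bar>h\<bar> / h) \<longlongrightarrow> 0) (at (0::real))"
    proof (rule Lim_transform_eventually)
      show "((\<lambda>h. \<bar>h\<bar>) \<longlongrightarrow> 0) (at (0::real))" by (rule tendsto_eq_intros refl)+ simp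
      show "\<forall>\<^sub>F h in at (0::real). \<bar>h\<bar> = h * \<bar>h\<bar> / h" by (auto simp: eventually_at_filter)
    qed
    then show ?thesis using True by (simp add: DERIV_def)
  next
    case False
    then consider "y > 0" | "y < 0" by linarith
    then show ?thesis
    proof cases
      case 1
      have "((\<lambda>y. y * y) has_real_derivative 2 * \<bar>y\<bar>) (at y)" using 1 by (auto intro!: derivative_eq_intros)
      then show ?thesis by (rule has_field_derivative_transform_within_open[of _ _ _ "{0<..}"]) (use 1 in auto)
    next
      case 2
      have "((\<lambda>y. - (y * y)) has_real_derivative 2 * \<bar>y\<bar>) (at y)" using 2 by (auto intro!: derivative_eq_intros)
      then show ?thesis by (rule has_field_derivative_transform_within_open[of _ _ _ "{..<0}"]) (use 2 in auto)
    qed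
  qed
  have dA: "((\<lambda>x. v x - u x) has_real_derivative v' x - u' x) (at x)" by (intro DERIV_diff assms)
  have 2: "((\<lambda>x. (v x - u x) * \<bar>v x - u x\<bar>) has_real_derivative 2 * \<bar>v x - u x\<bar> * (v' x - u' x)) (at x)"
    using DERIV_chain2[OF abs dA] by simp
  have 3: "((\<lambda>x. u x * v x) has_real_derivative u' x * v x + v' x * u x) (at x)" by (intro DERIV_mult assms)
  have ne: "u x * v x \<noteq> 0" using assms by simp
  have 4: "((\<lambda>x. (v x - u x) * \<bar>v x - u x\<bar> / (u x * v x)) has_real_derivative
     (2 * \<bar>v x - u x\<bar> * (v' x - u' x) * (u x * v x) - (v x - u x) * \<bar>v x - u x\<bar> * (u' x * v x + v' x * u x))
       / ((u x * v x) * (u x * v x))) (at x)"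
    by (rule DERIV_divide[OF 2 3 ne])
  have num: "2 * \<bar>v x - u x\<bar> * (v' x - u' x) * (u x * v x) - (v x - u x) * \<bar>v x - u x\<bar> * (u' x * v x + v' x * u x)
     = \<bar>v x - u x\<bar> * (u x + v x) * (v' x * u x - u' x * v x)" by (simp add: algebra_simps)
  from DERIV_mult[OF 1 4[unfolded num]]
  show ?thesis
    by (rule back_subst[where P = "\<lambda>D. (_ has_real_derivative D) (at x)"])
       (use ne in \<open>simp add: power2_eq_square field_simps\<close>)
qed

lemma cubic_form_definite:
  fixes A B K K' \<eta> m p :: real
  assumes "0 < K" "K \<le> K'" "m > 0" "p > 0" "m * p * K' \<le> K" "\<eta> > 1"
  defines "E \<equiv> K * (A * \<bar>A\<bar> * (A - m * B)) + K' * m^3 * (B * \<bar>B\<bar> * (\<eta> * B - p * A))"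
  shows "E \<ge> 0" "E = 0 \<Longrightarrow> A = 0 \<and> B = 0"
proof -
  define z where "z = m * B"
  have abz: "\<bar>z\<bar> = m * \<bar>B\<bar>" using assms by (simp add: z_def abs_mult)
  have E: "E = K * (A * \<bar>A\<bar> * A) - K * (A * \<bar>A\<bar> * z) + \<eta> * (K' * (z * \<bar>z\<bar> * z)) - (m * p * K') * (z * \<bar>z\<bar> * A)"
    unfolding E_def abz unfolding z_def by (simp add: power3_eq_cube algebra_simps)
  have cube: "y * \<bar>y\<bar> * y = \<bar>y\<bar>^3" for y :: real by (simp add: power3_eq_cube abs_if)
  have le: "A * \<bar>A\<bar> * z \<le> \<bar>A\<bar>^2 * \<bar>z\<bar>" "z * \<bar>z\<bar> * A \<le> \<bar>z\<bar>^2 * \<bar>A\<bar>"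
    using abs_ge_self[of "A * \<bar>A\<bar> * z"] abs_ge_self[of "z * \<bar>z\<bar> * A"] by (simp_all add: abs_mult power2_eq_square)
  have t1: "K * (A * \<bar>A\<bar> * z) \<le> K * (\<bar>A\<bar>^2 * \<bar>z\<bar>)" using le assms by (intro mult_left_mono) auto
  have "(m * p * K') * (z * \<bar>z\<bar> * A) \<le> (m * p * K') * (\<bar>z\<bar>^2 * \<bar>A\<bar>)"
    using le assms by (intro mult_left_mono) auto
  also have "\<dots> \<le> K * (\<bar>z\<bar>^2 * \<bar>A\<bar>)" using assms by (intro mult_right_mono) auto
  finally have t2: "(m * p * K') * (z * \<bar>z\<bar> * A) \<le> K * (\<bar>z\<bar>^2 * \<bar>A\<bar>)" .
  have t3: "K' * \<bar>z\<bar>^3 \<ge> K * \<bar>z\<bar>^3" using assms by (intro mult_right_mono) auto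
  have fact: "K * \<bar>A\<bar>^3 - K * (\<bar>A\<bar>^2 * \<bar>z\<bar>) + K * \<bar>z\<bar>^3 - K * (\<bar>z\<bar>^2 * \<bar>A\<bar>) = K * ((\<bar>A\<bar> + \<bar>z\<bar>) * (\<bar>A\<bar> - \<bar>z\<bar>)\<^sup>2)"
  proof -
    have "K * y^3 - K * (y^2 * w) + K * w^3 - K * (w^2 * y) = K * ((y + w) * (y - w)\<^sup>2)" for y w
      by (simp add: power2_eq_square power3_eq_cube algebra_simps)
    then show ?thesis .
  qed
  have q1: "K * ((\<bar>A\<bar> + \<bar>z\<bar>) * (\<bar>A\<bar> - \<bar>z\<bar>)\<^sup>2) \<ge> 0" using assms by simp
  have q2: "(\<eta> - 1) * (K' * \<bar>z\<bar>^3) \<ge> 0" using assms by simp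
  have split: "\<eta> * (K' * \<bar>z\<bar>^3) = K' * \<bar>z\<bar>^3 + (\<eta> - 1) * (K' * \<bar>z\<bar>^3)" by (simp add: algebra_simps)
  have lower: "E \<ge> K * ((\<bar>A\<bar> + \<bar>z\<bar>) * (\<bar>A\<bar> - \<bar>z\<bar>)\<^sup>2) + (\<eta> - 1) * (K' * \<bar>z\<bar>^3)"
    unfolding E cube using t1 t2 t3 fact split by linarith
  show "E \<ge> 0" using lower q1 q2 by linarith
  assume "E = 0"
  then have "(\<eta> - 1) * (K' * \<bar>z\<bar>^3) = 0" using lower q1 q2 by linarith
  then have z0: "z = 0" using assms by auto
  then have "K * (\<bar>A\<bar> * \<bar>A\<bar>\<^sup>2) \<le> 0" using lower \<open>E = 0\<close> by simp
  then have "A = 0" using assms by (simp add: mult_le_0_iff)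
  then show "A = 0 \<and> B = 0" using z0 assms by (simp add: z_def)
qed

lemma bvp_derivs:
  assumes "bvp d a A B c s Z" "d > 0" "\<And>x. x \<in> {A<..<B} - {c} \<Longrightarrow> s x = g x * Z x"
  obtains Z' where "continuous_on {A..B} Z" "continuous_on {A..B} Z'"
    "\<And>x. x \<in> {A<..<B} \<Longrightarrow> (Z has_real_derivative Z' x) (at x)"
    "\<And>x. x \<in> {A<..<B} - {c} \<Longrightarrow> (Z' has_real_derivative (a / d) * Z' x + (- g x / d) * Z x) (at x)"
    "Z' A = (a / d) * Z A" "Z' B = 0"
proof -
  obtain Z' where Z': "\<forall>x\<in>{A..B}. (Z has_real_derivative Z' x) (at x within {A..B})"
     "continuous_on {A..B} Z'"
     "\<forall>x\<in>{A<..<B} - {c}. (Z' has_real_derivative (a * Z' x - s x) / d) (at x)"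
     "d * Z' A = a * Z A" "Z' B = 0"
    using assms unfolding bvp_def by blast
  show thesis
  proof (rule that[of Z'])
    show "continuous_on {A..B} Z" using assms(1) by (rule bvp_continuous)
    show "(Z has_real_derivative Z' x) (at x)" if "x \<in> {A<..<B}" for x
    proof -
      have "at x within {A..B} = at x" using that by (intro at_within_Icc_at) auto
      then show ?thesis using Z'(1) that by (metis atLeastAtMost_iff greaterThanLessThan_iff less_imp_le)
    qed
    show "(Z' has_real_derivative (a / d) * Z' x + (- g x / d) * Z x) (at x)" if x: "x \<in> {A<..<B} - {c}" for x
    proof -
      have "(a * Z' x - s x) / d = (a / d) * Z' x + (- g x / d) * Z x"
        unfolding assms(3)[OF x] using assms(2) by (simp add: field_simps)
      then show ?thesis using Z'(3) x by metis
    qed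
    show "Z' A = (a / d) * Z A" using Z'(4) assms(2) by (simp add: field_simps)
  qed (use Z' in auto)
qed

lemma resource_less_w_tilde:
  assumes "d > 0" "a \<ge> 0" "h > 0" "q > 0" "A < B" "p > 0"
    and W: "bvp d a A B A (\<lambda>x. h - q * W x - p * U x * W x) W"
    and pos: "\<And>x. x \<in> {A..B} \<Longrightarrow> W x > 0" "\<And>x. x \<in> {A..B} \<Longrightarrow> U x > 0"
  shows "x \<in> {A..B} \<Longrightarrow> W x \<le> w_tilde d a h q B A x"
    and "x \<in> {A<..<B} \<Longrightarrow> W x < w_tilde d a h q B A x"
proof -
  define wt where "wt = w_tilde d a h q B A"
  have bw: "bvp d a A B A (\<lambda>x. h - q * wt x) wt" using w_tilde_props(2)[OF assms(1-5)] by (simp add: wt_def)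
  have sup: "supersol d a A B A 0 (\<lambda>x t. 1 * (h - q * wt x) + (- 1) * (h - q * W x - p * U x * W x)) (\<lambda>x t. 1 * wt x + (- 1) * W x)"
    by (rule supersol_add[OF bvp_supersol[OF bw assms(1)] bvp_supersol[OF W assms(1)]])
  have UW: "p * U x * W x > 0" if "x \<in> {A..B}" for x using pos that assms by simp
  have le: "1 * wt x + (- 1) * W x \<ge> 0" if x: "x \<in> {A..B}" for x
  proof (rule stationary_comparison[OF assms(1,2) order.refl assms(5,4) sup _ x])
    fix x assume "x \<in> {A<..<B} - {A}"
    then show "1 * (h - q * wt x) + (- 1) * (h - q * W x - p * U x * W x) \<ge> - q * (1 * wt x + (- 1) * W x)"
      using UW[of x] by (simp add: algebra_simps)
  qed
  show "x \<in> {A..B} \<Longrightarrow> W x \<le> w_tilde d a h q B A x" using le[of x] by (simp add: wt_def)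
  show "W x < w_tilde d a h q B A x" if x: "x \<in> {A<..<B}"
  proof (rule ccontr)
    assume n: "\<not> ?thesis"
    have eqx: "wt x - W x = 0" using le[of x] n x by (simp add: wt_def)
    obtain V where V: "\<forall>x\<in>{A..B}. (W has_real_derivative V x) (at x within {A..B})"
      "\<forall>x\<in>{A<..<B} - {A}. (V has_real_derivative (a * V x - (h - q * W x - p * U x * W x)) / d) (at x)"
      using W unfolding bvp_def by blast
    obtain w' where w': "\<forall>x\<in>{A..B}. (wt has_real_derivative w' x) (at x within {A..B})"
      "\<forall>x\<in>{A<..<B} - {A}. (w' has_real_derivative (a * w' x - (h - q * wt x)) / d) (at x)"
      using bw unfolding bvp_def by blast
    have d1: "((\<lambda>x. wt x - W x) has_real_derivative w' y - V y) (at y)" if "y \<in> {A<..<B}" for y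
    proof -
      have "at y within {A..B} = at y" using that by (intro at_within_Icc_at) auto
      then show ?thesis using V(1) w'(1) that by (intro DERIV_diff) (metis atLeastAtMost_iff greaterThanLessThan_iff less_imp_le)+
    qed
    have d2: "((\<lambda>x. w' x - V x) has_real_derivative (a * w' x - (h - q * wt x)) / d - (a * V x - (h - q * W x - p * U x * W x)) / d) (at x)"
      using V(2) w'(2) x by (intro DERIV_diff) auto
    have min: "wt x - W x \<le> wt y - W y" if "y \<in> {A<..<B}" for y using le[of y] that eqx by simp
    have "w' x - V x = 0" "(a * w' x - (h - q * wt x)) / d - (a * V x - (h - q * W x - p * U x * W x)) / d \<ge> 0"
      using interior_min_derivs[OF _ _ d1 d2 min] x by auto
    then have "((a * w' x - (h - q * wt x)) - (a * V x - (h - q * W x - p * U x * W x))) / d \<ge> 0"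
      by (simp only: diff_divide_distrib[symmetric])
    then have "(a * w' x - (h - q * wt x)) - (a * V x - (h - q * W x - p * U x * W x)) \<ge> 0"
      using assms(1) by (simp add: zero_le_divide_iff)
    moreover have "w' x = V x" "wt x = W x" using \<open>w' x - V x = 0\<close> eqx by auto
    ultimately show False using UW[of x] x by simp
  qed
qed

lemma coexistence_unique:
  fixes d1 d2 a1 a2 r m p q h L c :: real
  assumes pos: "d1 > 0" "d2 > 0" "m > 0" "p > 0" "q > 0" "h > 0" "a2 \<ge> 0" "0 \<le> c" "c < L"
    and mp: "m \<le> exp (- \<bar>a1 / d1 - a2 / d2\<bar> * L) / p"
    and wt: "(w_tilde d2 a2 h q L c L)\<^sup>2 \<le> h"
    and U1: "bvp d1 a1 0 L c (\<lambda>x. U1 x * (r - U1 x - m * chi c L x * W1 x)) U1"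
    and U2: "bvp d1 a1 0 L c (\<lambda>x. U2 x * (r - U2 x - m * chi c L x * W2 x)) U2"
    and W1: "bvp d2 a2 c L c (\<lambda>x. h - q * W1 x - p * U1 x * W1 x) W1"
    and W2: "bvp d2 a2 c L c (\<lambda>x. h - q * W2 x - p * U2 x * W2 x) W2"
    and posU: "\<And>x. x \<in> {0..L} \<Longrightarrow> U1 x > 0" "\<And>x. x \<in> {0..L} \<Longrightarrow> U2 x > 0"
    and posW: "\<And>x. x \<in> {c..L} \<Longrightarrow> W1 x > 0" "\<And>x. x \<in> {c..L} \<Longrightarrow> W2 x > 0"
  shows "\<forall>x\<in>{0..L}. U1 x = U2 x" "\<forall>x\<in>{c..L}. W1 x = W2 x"
proof -
  define \<alpha> where "\<alpha> = a1 / d1"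
  define \<beta> where "\<beta> = a2 / d2"
  define \<kappa> where "\<kappa> = exp (max 0 (\<beta> - \<alpha>) * L)"
  have L0: "L > 0" using pos by simp
  obtain U1' where u1: "continuous_on {0..L} U1" "continuous_on {0..L} U1'"
    "\<And>x. x \<in> {0<..<L} \<Longrightarrow> (U1 has_real_derivative U1' x) (at x)"
    "\<And>x. x \<in> {0<..<L} - {c} \<Longrightarrow> (U1' has_real_derivative (a1 / d1) * U1' x + (- (r - U1 x - m * chi c L x * W1 x) / d1) * U1 x) (at x)"
    "U1' 0 = (a1 / d1) * U1 0" "U1' L = 0"
    by (rule bvp_derivs[OF U1 pos(1), where g = "\<lambda>x. r - U1 x - m * chi c L x * W1 x"], simp, rule that)
  obtain U2' where u2: "continuous_on {0..L} U2" "continuous_on {0..L} U2'"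
    "\<And>x. x \<in> {0<..<L} \<Longrightarrow> (U2 has_real_derivative U2' x) (at x)"
    "\<And>x. x \<in> {0<..<L} - {c} \<Longrightarrow> (U2' has_real_derivative (a1 / d1) * U2' x + (- (r - U2 x - m * chi c L x * W2 x) / d1) * U2 x) (at x)"
    "U2' 0 = (a1 / d1) * U2 0" "U2' L = 0"
    by (rule bvp_derivs[OF U2 pos(1), where g = "\<lambda>x. r - U2 x - m * chi c L x * W2 x"], simp, rule that)
  have gW: "h - q * w - p * u * w = (h / w - q - p * u) * w" if "w > 0" for w u :: real
    using that by (simp add: field_simps)
  obtain W1' where w1: "continuous_on {c..L} W1" "continuous_on {c..L} W1'"
    "\<And>x. x \<in> {c<..<L} \<Longrightarrow> (W1 has_real_derivative W1' x) (at x)"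
    "\<And>x. x \<in> {c<..<L} - {c} \<Longrightarrow> (W1' has_real_derivative (a2 / d2) * W1' x + (- (h / W1 x - q - p * U1 x) / d2) * W1 x) (at x)"
    "W1' c = (a2 / d2) * W1 c" "W1' L = 0"
    by (rule bvp_derivs[OF W1 pos(2), where g = "\<lambda>x. h / W1 x - q - p * U1 x"], rule gW, rule posW, simp, rule that)
  obtain W2' where w2: "continuous_on {c..L} W2" "continuous_on {c..L} W2'"
    "\<And>x. x \<in> {c<..<L} \<Longrightarrow> (W2 has_real_derivative W2' x) (at x)"
    "\<And>x. x \<in> {c<..<L} - {c} \<Longrightarrow> (W2' has_real_derivative (a2 / d2) * W2' x + (- (h / W2 x - q - p * U2 x) / d2) * W2 x) (at x)"
    "W2' c = (a2 / d2) * W2 c" "W2' L = 0"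
    by (rule bvp_derivs[OF W2 pos(2), where g = "\<lambda>x. h / W2 x - q - p * U2 x"], rule gW, rule posW, simp, rule that)
  define A where "A x = U2 x - U1 x" for x
  define B where "B x = W1 x - W2 x" for x
  define Fu where "Fu x = exp (- \<alpha> * x) * (U2' x * U1 x - U1' x * U2 x) * ((U2 x - U1 x) * \<bar>U2 x - U1 x\<bar> / (U1 x * U2 x))" for x
  define Fw where "Fw x = exp (- \<beta> * x) * (W1' x * W2 x - W2' x * W1 x) * ((W1 x - W2 x) * \<bar>W1 x - W2 x\<bar> / (W2 x * W1 x))" for x
  define Ru where "Ru x = exp (- \<alpha> * x) * (\<bar>A x\<bar> * (U1 x + U2 x) * (U2' x * U1 x - U1' x * U2 x)\<^sup>2 / (U1 x * U2 x)\<^sup>2)" for x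
  define Rw where "Rw x = exp (- \<beta> * x) * (\<bar>B x\<bar> * (W2 x + W1 x) * (W1' x * W2 x - W2' x * W1 x)\<^sup>2 / (W2 x * W1 x)\<^sup>2)" for x
  define Su where "Su x = exp (- \<alpha> * x) * (A x * \<bar>A x\<bar> * (A x - m * chi c L x * B x))" for x
  define Sw where "Sw x = exp (- \<beta> * x) * (B x * \<bar>B x\<bar> * (h / (W1 x * W2 x) * B x - p * A x))" for x
  have regroup: "e * (x / d * y + z) = e * (y * x) / d + e * z" for e x y z d :: real
    by (simp add: algebra_simps)
  have dFu: "(Fu has_real_derivative Su x / d1 + Ru x) (at x)" if x: "x \<in> {0<..<L} - {c}" for x
  proof -
    have "x \<in> {0<..<L}" "U1 x > 0" "U2 x > 0" using x posU by auto
    note D = cubic_wronskian_deriv[OF u1(3)[OF this(1)] u2(3)[OF this(1)] u1(4)[OF x] u2(4)[OF x] this(2,3)]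
    have e: "- (r - U2 x - m * chi c L x * W2 x) / d1 - - (r - U1 x - m * chi c L x * W1 x) / d1 = (A x - m * chi c L x * B x) / d1"
      by (simp add: A_def B_def diff_divide_distrib[symmetric] algebra_simps)
    show ?thesis unfolding Fu_def[abs_def] \<alpha>_def
      by (rule DERIV_cong[OF D[unfolded e]]) (unfold Su_def Ru_def \<alpha>_def A_def, rule regroup)
  qed
  have dFw: "(Fw has_real_derivative Sw x / d2 + Rw x) (at x)" if x: "x \<in> {c<..<L}" for x
  proof -
    have x': "x \<in> {c<..<L} - {c}" "W2 x > 0" "W1 x > 0" using x posW by auto
    note D = cubic_wronskian_deriv[OF w2(3)[OF x] w1(3)[OF x] w2(4)[OF x'(1)] w1(4)[OF x'(1)] x'(2,3)]
    have e: "- (h / W1 x - q - p * U1 x) / d2 - - (h / W2 x - q - p * U2 x) / d2 = (h / (W1 x * W2 x) * B x - p * A x) / d2"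
    proof -
      have "h / W2 x - h / W1 x = h / (W1 x * W2 x) * B x" using x'(2,3) by (simp add: B_def field_simps)
      then show ?thesis by (simp add: A_def diff_divide_distrib[symmetric] algebra_simps)
    qed
    show ?thesis unfolding Fw_def[abs_def] \<beta>_def
      by (rule DERIV_cong[OF D[unfolded e]]) (unfold Sw_def Rw_def \<beta>_def B_def, rule regroup)
  qed
  have Ru: "Ru x \<ge> 0" if "x \<in> {0..L}" for x
    unfolding Ru_def using posU[OF that] by (intro mult_nonneg_nonneg divide_nonneg_nonneg add_nonneg_nonneg) auto
  have Rw: "Rw x \<ge> 0" if "x \<in> {c..L}" for x
    unfolding Rw_def using posW[OF that] by (intro mult_nonneg_nonneg divide_nonneg_nonneg add_nonneg_nonneg) auto
  have cFu: "continuous_on {0..L} Fu" unfolding Fu_def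
    using posU by (intro continuous_intros u1 u2) (force simp: less_imp_neq[symmetric])
  have cFw: "continuous_on {c..L} Fw" unfolding Fw_def
    using posW by (intro continuous_intros w1 w2) (force simp: less_imp_neq[symmetric])
  have ends: "Fu 0 = 0" "Fu L = 0" "Fw c = 0" "Fw L = 0"
    using u1(5,6) u2(5,6) w1(5,6) w2(5,6) by (simp_all add: Fu_def Fw_def)
  define K where "K x = exp (- \<alpha> * x)" for x
  define K' where "K' x = \<kappa> * exp (- \<beta> * x)" for x
  have Kpos: "K x > 0" for x by (simp add: K_def)
  have KK': "K x \<le> K' x" if "x \<in> {0..L}" for x
  proof -
    have "(\<beta> - \<alpha>) * x \<le> max 0 (\<beta> - \<alpha>) * L" using that by (intro mult_mono) auto
    then show ?thesis unfolding K_def K'_def \<kappa>_def exp_add[symmetric] by (simp add: algebra_simps)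
  qed
  have mpK: "m * p * K' x \<le> K x" if "x \<in> {0..L}" for x
  proof -
    have "m * p \<le> exp (- \<bar>\<alpha> - \<beta>\<bar> * L)" using mp pos by (simp add: \<alpha>_def \<beta>_def pos_le_divide_eq)
    then have "m * p * K' x \<le> exp (- \<bar>\<alpha> - \<beta>\<bar> * L) * K' x" by (intro mult_right_mono) (auto simp: K'_def \<kappa>_def)
    also have "\<dots> = exp (- \<bar>\<alpha> - \<beta>\<bar> * L + max 0 (\<beta> - \<alpha>) * L - \<beta> * x)" unfolding K'_def \<kappa>_def by (simp add: exp_add[symmetric])
    also have "\<dots> \<le> K x"
    proof -
      have "\<bar>\<alpha> - \<beta>\<bar> * L - max 0 (\<beta> - \<alpha>) * L = max 0 (\<alpha> - \<beta>) * L" by (simp add: max_def abs_if algebra_simps)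
      moreover have "(\<alpha> - \<beta>) * x \<le> max 0 (\<alpha> - \<beta>) * L" using that by (intro mult_mono) auto
      ultimately show ?thesis unfolding K_def by (simp add: algebra_simps)
    qed
    finally show ?thesis .
  qed
  have eta: "h / (W1 x * W2 x) > 1" if x: "x \<in> {c<..<L}" for x
  proof -
    define wL where "wL = w_tilde d2 a2 h q L c L"
    have xx: "x \<in> {c..L}" using x by auto
    have sub: "\<And>y. y \<in> {c..L} \<Longrightarrow> y \<in> {0..L}" using pos by auto
    have "W1 x < w_tilde d2 a2 h q L c x"
      by (rule resource_less_w_tilde(2)[OF pos(2,7,6,5,9,4) W1 posW(1) posU(1)[OF sub] x])
    moreover have "W2 x < w_tilde d2 a2 h q L c x"
      by (rule resource_less_w_tilde(2)[OF pos(2,7,6,5,9,4) W2 posW(2) posU(2)[OF sub] x])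
    moreover have "w_tilde d2 a2 h q L c x \<le> wL" unfolding wL_def by (rule w_tilde_le_end[OF pos(2,7,6,5,9) xx])
    ultimately have "W1 x * W2 x < wL * wL" using posW[OF xx] by (intro mult_strict_mono) auto
    also have "\<dots> \<le> h" using wt by (simp add: wL_def power2_eq_square)
    finally show ?thesis using posW[OF xx] by simp
  qed
  define Psi where "Psi x = d1 * Fu x + \<kappa> * m^3 * d2 * Fw x" for x
  define dPsi where "dPsi x = (Su x + \<kappa> * m^3 * Sw x) + (d1 * Ru x + \<kappa> * m^3 * d2 * Rw x)" for x
  have cPsi: "continuous_on {c..L} Psi"
    unfolding Psi_def using pos by (intro continuous_intros cFw continuous_on_subset[OF cFu]) auto
  have DPsi: "(Psi has_real_derivative dPsi x) (at x)" if "x \<in> {c<..<L} - {}" for x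
  proof -
    have x: "x \<in> {0<..<L} - {c}" "x \<in> {c<..<L}" using that pos by auto
    have "(Psi has_real_derivative d1 * (Su x / d1 + Ru x) + \<kappa> * m^3 * d2 * (Sw x / d2 + Rw x)) (at x)"
      unfolding Psi_def by (intro DERIV_add DERIV_cmult dFu dFw x)
    moreover have "d1 * (Su x / d1 + Ru x) + \<kappa> * m^3 * d2 * (Sw x / d2 + Rw x) = dPsi x"
      using pos(1,2) by (simp add: dPsi_def field_simps)
    ultimately show ?thesis by simp
  qed
  have form: "Su x + \<kappa> * m^3 * Sw x = K x * (A x * \<bar>A x\<bar> * (A x - m * B x)) + K' x * m^3 * (B x * \<bar>B x\<bar> * (h / (W1 x * W2 x) * B x - p * A x))"
    if "x \<in> {c<..<L}" for x
    using that by (simp add: Su_def Sw_def K_def K'_def chi_def mult_ac)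
  have sub: "x \<in> {0..L}" if "x \<in> {c..L}" for x using that pos by auto
  have rest: "d1 * Ru x + \<kappa> * m^3 * d2 * Rw x \<ge> 0" if "x \<in> {c<..<L}" for x
    using Ru[of x] Rw[of x] sub[of x] that pos by (intro add_nonneg_nonneg mult_nonneg_nonneg) (auto simp: \<kappa>_def)
  note cubic = cubic_form_definite[OF Kpos KK' pos(3,4) mpK eta]
  have E0: "Su x + \<kappa> * m^3 * Sw x \<ge> 0" if "x \<in> {c<..<L}" for x
    unfolding form[OF that] using cubic(1)[of x x "A x" "B x"] sub[of x] that by auto
  have "dPsi x \<ge> 0" if "x \<in> {c<..<L} - {}" for x using E0[of x] rest[of x] that by (auto simp: dPsi_def)
  note mono = le_of_deriv_nonneg_off_finite[OF less_imp_le[OF pos(9)] finite.emptyI cPsi DPsi this]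
    and zero = deriv_zero_of_nonneg_off_finite[OF finite.emptyI cPsi DPsi this]
  have dFu': "((\<lambda>x. d1 * Fu x) has_real_derivative exp (- \<alpha> * x) * \<bar>A x\<bar>^3 + d1 * Ru x) (at x)" if "x \<in> {0<..<c} - {}" for x
  proof -
    have x: "x \<in> {0<..<L} - {c}" using that pos by auto
    have "((\<lambda>x. d1 * Fu x) has_real_derivative d1 * (Su x / d1 + Ru x)) (at x)" by (intro DERIV_cmult dFu x)
    moreover have "Su x = exp (- \<alpha> * x) * \<bar>A x\<bar>^3" using that by (simp add: Su_def chi_def power3_eq_cube abs_if)
    then have "d1 * (Su x / d1 + Ru x) = exp (- \<alpha> * x) * \<bar>A x\<bar>^3 + d1 * Ru x" using pos(1) by (simp add: field_simps)
    ultimately show ?thesis by simp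
  qed
  have cFu': "continuous_on {0..c} (\<lambda>x. d1 * Fu x)" using pos by (intro continuous_intros continuous_on_subset[OF cFu]) auto
  have nn: "0 \<le> exp (- \<alpha> * x) * \<bar>A x\<bar>^3 + d1 * Ru x" if "x \<in> {0<..<c} - {}" for x
    using Ru[of x] that pos by (intro add_nonneg_nonneg mult_nonneg_nonneg) auto
  have "d1 * Fu 0 \<le> d1 * Fu c" by (rule le_of_deriv_nonneg_off_finite[OF pos(8) finite.emptyI cFu' dFu' nn])
  then have Psic: "Psi c \<ge> 0" "d1 * Fu c \<le> Psi c" using ends by (auto simp: Psi_def)
  have PsiL: "Psi L = 0" using ends by (simp add: Psi_def)
  have A0r: "A x = 0 \<and> B x = 0" if x: "x \<in> {c<..<L}" for x
  proof -
    have "dPsi x = 0" by (rule zero) (use x PsiL Psic in auto)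
    then have "Su x + \<kappa> * m^3 * Sw x = 0" using E0[OF x] rest[OF x] unfolding dPsi_def by linarith
    then show ?thesis using cubic(2)[of x x "A x" "B x"] sub[of x] x unfolding form[OF x] by auto
  qed
  have A0l: "A x = 0" if x: "x \<in> {0<..<c}" for x
  proof -
    have "Psi c \<le> Psi L" by (rule mono)
    then have "d1 * Fu c \<le> d1 * Fu 0" using Psic PsiL ends by simp
    then have "exp (- \<alpha> * x) * \<bar>A x\<bar>^3 + d1 * Ru x = 0"
      by (intro deriv_zero_of_nonneg_off_finite[OF finite.emptyI cFu' dFu' nn]) (use x in auto)
    moreover have "exp (- \<alpha> * x) * \<bar>A x\<bar>^3 \<ge> 0" "d1 * Ru x \<ge> 0" using Ru[of x] x pos by auto
    ultimately have "exp (- \<alpha> * x) * \<bar>A x\<bar>^3 = 0" by linarith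
    then show ?thesis by simp
  qed
  have ext: "f x = 0" if "continuous_on {l..u} f" "l < u" "\<And>x. x \<in> {l<..<u} \<Longrightarrow> f x = 0" "x \<in> {l..u}" for f :: "real \<Rightarrow> real" and l u x
    using continuous_constant_on_closure[of "{l<..<u}" f 0 x] that by (simp add: closure_greaterThanLessThan)
  have cA: "continuous_on {0..L} A" unfolding A_def by (intro continuous_intros u1 u2)
  have cB: "continuous_on {c..L} B" unfolding B_def by (intro continuous_intros w1 w2)
  have Br: "B x = 0" if "x \<in> {c..L}" for x by (rule ext[OF cB pos(9)]) (use A0r that in auto)
  have Ar: "A x = 0" if "x \<in> {c..L}" for x
    by (rule ext[OF continuous_on_subset[OF cA] pos(9)]) (use A0r that sub in auto)
  have Al: "A x = 0" if "x \<in> {0..<c}" for x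
    by (rule ext[of 0 c A x]) (use A0l that pos in \<open>auto intro: continuous_on_subset[OF cA]\<close>)
  have "A x = 0" if "x \<in> {0..L}" for x using Al[of x] Ar[of x] that by (cases "x < c") auto
  then show "\<forall>x\<in>{0..L}. U1 x = U2 x" by (auto simp: A_def)
  show "\<forall>x\<in>{c..L}. W1 x = W2 x" using Br by (auto simp: B_def)
qed

section \<open>Monotone iteration\<close>

lemma bvp_cong:
  assumes "bvp d a A B c s Z" "\<And>x. x \<in> {A..B} \<Longrightarrow> Z x = Y x" "\<And>x. x \<in> {A<..<B} - {c} \<Longrightarrow> s x = t x" "A \<le> B"
  shows "bvp d a A B c t Y"
proof -
  obtain Z' where Z': "\<forall>x\<in>{A..B}. (Z has_real_derivative Z' x) (at x within {A..B})"
     "continuous_on {A..B} Z'"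
     "\<forall>x\<in>{A<..<B} - {c}. (Z' has_real_derivative (a * Z' x - s x) / d) (at x)"
     "d * Z' A = a * Z A" "Z' B = 0"
    using assms unfolding bvp_def by blast
  have "(Y has_real_derivative Z' x) (at x within {A..B})" if "x \<in> {A..B}" for x
    by (rule has_field_derivative_transform_within[of Z _ x _ 1]) (use Z'(1) that assms(2) in auto)
  moreover have "(Z' has_real_derivative (a * Z' x - t x) / d) (at x)" if "x \<in> {A<..<B} - {c}" for x
    using Z'(3) assms(3)[OF that] that by metis
  moreover have "d * Z' A = a * Y A" using Z'(4) assms(2)[of A] assms(4) by simp
  ultimately show ?thesis unfolding bvp_def using Z'(2,5) by blast
qed

definition coex where
  "coex d1 d2 a1 a2 r m p q h L c U W \<longleftrightarrow>
     bvp d1 a1 0 L c (\<lambda>x. U x * (r - U x - m * chi c L x * W x)) U \<and>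
     bvp d2 a2 c L c (\<lambda>x. h - q * W x - p * U x * W x) W \<and>
     (\<forall>x\<in>{0..L}. U x > 0) \<and> (\<forall>x\<in>{c..L}. W x > 0)"

text \<open>\<open>\<sigma> = 1\<close> propagates lower bounds for \<open>u\<close> and upper bounds for \<open>w\<close>, and \<open>\<sigma> = - 1\<close> the opposite ones.\<close>
lemma consumer_source_order:
  fixes u U w W X k r m M b \<sigma> \<epsilon> :: real
  assumes "0 \<le> u" "u \<le> M" "0 \<le> U" "U \<le> M" "2 * M + m * b \<le> k" "r \<ge> 0" "m \<ge> 0" "\<epsilon> \<ge> 0"
    and "X = 0 \<or> X = 1 \<and> 0 \<le> w \<and> w \<le> b \<and> \<sigma> * (W - w) \<ge> - \<epsilon>" "b \<ge> 0"
    and "\<sigma> * (u - U) \<ge> - \<epsilon>"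
  shows "\<sigma> * (u * (k + r - u - m * X * w) - U * (k + r - U - m * X * W)) \<ge> - (k + r + M * m) * \<epsilon>"
proof -
  define f where "f = k + r - u - U - m * X * w"
  have "m * X * w \<le> m * b" "m * X * w \<ge> 0" using assms by (auto intro: mult_left_mono)
  then have f: "0 \<le> f" "f \<le> k + r" using assms by (auto simp: f_def)
  have eq: "\<sigma> * (u * (k + r - u - m * X * w) - U * (k + r - U - m * X * W)) = f * (\<sigma> * (u - U)) + U * m * (X * (\<sigma> * (W - w)))"
    by (simp add: f_def algebra_simps)
  have "f * (\<sigma> * (u - U)) \<ge> f * (- \<epsilon>)" using f assms by (intro mult_left_mono) auto
  moreover have "f * \<epsilon> \<le> (k + r) * \<epsilon>" using f assms by (intro mult_right_mono) auto
  moreover have "U * m * (X * (\<sigma> * (W - w))) \<ge> U * m * (- \<epsilon>)" using assms by (intro mult_left_mono) auto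
  moreover have "U * m * \<epsilon> \<le> M * m * \<epsilon>" using assms by (intro mult_right_mono) auto
  ultimately show ?thesis unfolding eq by (simp add: algebra_simps)
qed

lemma resource_source_order:
  fixes u U w W k h p q M b \<sigma> \<epsilon> :: real
  assumes "0 \<le> u" "u \<le> M" "q + p * M \<le> k" "p \<ge> 0" "q \<ge> 0" "\<epsilon> \<ge> 0" "0 \<le> W" "W \<le> b"
    and "\<sigma> * (u - U) \<ge> - \<epsilon>" "\<sigma> * (W - w) \<ge> - \<epsilon>"
  shows "\<sigma> * ((h + (k - q - p * U) * W) - (h + (k - q - p * u) * w)) \<ge> - (k + p * b) * \<epsilon>"
proof -
  define f where "f = k - q - p * u"
  have "p * u \<le> p * M" "p * u \<ge> 0" using assms by (auto intro: mult_left_mono)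
  then have f: "0 \<le> f" "f \<le> k" using assms(3,5) unfolding f_def by linarith+
  have eq: "\<sigma> * ((h + (k - q - p * U) * W) - (h + (k - q - p * u) * w)) = f * (\<sigma> * (W - w)) + p * W * (\<sigma> * (u - U))"
    by (simp add: f_def algebra_simps)
  have "f * (\<sigma> * (W - w)) \<ge> f * (- \<epsilon>)" using f assms by (intro mult_left_mono) auto
  moreover have "f * \<epsilon> \<le> k * \<epsilon>" using f assms by (intro mult_right_mono) auto
  moreover have "p * W * (\<sigma> * (u - U)) \<ge> p * W * (- \<epsilon>)" using assms by (intro mult_left_mono) auto
  moreover have "p * W * \<epsilon> \<le> p * b * \<epsilon>" using assms by (intro mult_right_mono mult_left_mono) auto
  ultimately show ?thesis unfolding eq by (simp add: algebra_simps)
qed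

lemma bounded_monotone_limit:
  fixes f :: "nat \<Rightarrow> real"
  assumes "\<sigma> = 1 \<or> \<sigma> = - 1" "\<And>n. \<sigma> * (f (Suc n) - f n) \<ge> 0" "\<And>n. \<bar>f n\<bar> \<le> K"
  shows "\<exists>l. f \<longlonglongrightarrow> l \<and> (\<forall>n. \<bar>f (Suc n) - l\<bar> \<le> \<bar>f n - l\<bar>)"
proof -
  define g where "g n = \<sigma> * f n" for n
  have inc: "incseq g" using assms(2) by (intro incseq_SucI) (simp add: g_def algebra_simps)
  have bd: "\<bar>g n\<bar> \<le> K" for n using assms(1) assms(3)[of n] by (auto simp: g_def abs_mult)
  have "\<forall>n. g n \<le> K" using bd by (auto intro: abs_le_D1)
  then obtain l where l: "g \<longlonglongrightarrow> l" "\<And>n. g n \<le> l"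
    using incseq_convergent[OF inc] by blast
  have \<sigma>: "\<sigma> * \<sigma> = 1" using assms(1) by auto
  have f: "f n = \<sigma> * g n" for n by (simp add: g_def mult.assoc[symmetric] \<sigma>)
  have "f \<longlonglongrightarrow> \<sigma> * l" unfolding f[abs_def] by (intro tendsto_intros l)
  moreover have "\<bar>f (Suc n) - \<sigma> * l\<bar> \<le> \<bar>f n - \<sigma> * l\<bar>" for n
  proof -
    have "\<bar>f n - \<sigma> * l\<bar> = l - g n" for n
      using l(2)[of n] assms(1) unfolding f right_diff_distrib[symmetric] abs_mult by auto
    moreover have "g n \<le> g (Suc n)" using inc by (simp add: incseq_SucD)
    ultimately show ?thesis by simp
  qed
  ultimately show ?thesis by blast
qed

locale persistent_system =
  fixes d1 d2 a1 a2 r m p q h L c lam :: real and \<phi> :: "real \<Rightarrow> real"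
  assumes d1: "d1 > 0" and d2: "d2 > 0" and r: "r > 0" and m: "m > 0" and p: "p > 0" and q: "q > 0"
    and h: "h > 0" and a1: "a1 > 0" and a2: "a2 \<ge> 0" and c0: "0 \<le> c" and cL: "c < L"
    and eig: "eigenpair d1 a1 (\<lambda>x. r - m * chi c L x * w_tilde d2 a2 h q L c x) L c lam \<phi>"
    and lam: "lam > 0"
begin

definition wt where "wt = w_tilde d2 a2 h q L c"

lemma L0: "L > 0" using c0 cL by simp

lemma a1': "a1 \<ge> 0" using a1 by simp

lemma wt_pos: "x \<in> {c..L} \<Longrightarrow> wt x > 0"
  using w_tilde_props(1)[OF d2 a2 h q cL] by (simp add: wt_def)

lemma wt_bvp: "bvp d2 a2 c L c (\<lambda>x. h - q * wt x) wt"
  using w_tilde_props(2)[OF d2 a2 h q cL] by (simp add: wt_def)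

lemma wt_cont: "continuous_on {c..L} wt" by (rule bvp_continuous[OF wt_bvp])

lemma phi_pos: "x \<in> {0..L} \<Longrightarrow> \<phi> x > 0" using eig by (simp add: eigenpair_def)

lemma phi_bvp: "bvp d1 a1 0 L c (\<lambda>x. (r - m * chi c L x * wt x - lam) * \<phi> x) \<phi>"
  using eig by (simp add: eigenpair_def wt_def)

lemma phi_cont: "continuous_on {0..L} \<phi>" by (rule bvp_continuous[OF phi_bvp])

abbreviation coexistence where "coexistence \<equiv> coex d1 d2 a1 a2 r m p q h L c"

end

locale iteration = persistent_system +
  fixes \<delta> M b k :: real and P1 P1' Q1 Q1' :: "real \<Rightarrow> real" and \<omega>1 :: real
    and P2 P2' Q2 Q2' :: "real \<Rightarrow> real" and \<omega>2 :: real
  assumes \<delta>: "\<delta> > 0" "\<And>x. x \<in> {0..L} \<Longrightarrow> \<delta> * \<phi> x \<le> lam" "\<And>x. x \<in> {0..L} \<Longrightarrow> \<delta> * \<phi> x \<le> M"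
    and M: "r \<le> M"
    and b: "\<And>x. x \<in> {c..L} \<Longrightarrow> wt x \<le> b"
    and k: "2 * M + m * b \<le> k" "q + p * M \<le> k"
    and fp1: "fundamental_pair d1 a1 k 0 L P1 P1' Q1 Q1' \<omega>1"
    and fp2: "fundamental_pair d2 a2 k c L P2 P2' Q2 Q2' \<omega>2"
begin

definition FU where "FU U W x = U x * (k + r - U x - m * chi c L x * W x)" for U W :: "real \<Rightarrow> real"
definition FW where "FW U W x = h + (k - q - p * U x) * W x" for U W :: "real \<Rightarrow> real"

definition admissible where
  "admissible U W \<longleftrightarrow> continuous_on {0..L} U \<and> continuous_on {c..L} W \<and>
     (\<forall>x\<in>{0..L}. \<delta> * \<phi> x \<le> U x \<and> U x \<le> M) \<and> (\<forall>x\<in>{c..L}. 0 \<le> W x \<and> W x \<le> wt x)"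

definition stepU where "stepU U W = green d1 a1 0 L P1 Q1 \<omega>1 (FU U W)"
definition stepW where "stepW U W = green d2 a2 c L P2 Q2 \<omega>2 (FW U W)"

lemma M0: "M > 0" using M r by simp

lemma b0: "b > 0" using b[of c] wt_pos[of c] cL by force

lemma k0: "k > 0" using k(1) M0 b0 m by (smt (verit) mult_pos_pos)

lemma FU_pc:
  assumes "continuous_on {0..L} U" "continuous_on {c..L} W" shows "pc 0 L c (FU U W)"
proof -
  have "pc 0 L c (\<lambda>x. U x * (k + r - U x - m * (chi c L x * W x)))"
    using c0 cL by (intro pc_mult pc_diff pc_chi pc_continuous_on continuous_intros assms) auto
  then show ?thesis by (simp add: FU_def[abs_def] mult.assoc)
qed

lemma FW_cont:
  assumes "continuous_on {0..L} U" "continuous_on {c..L} W" shows "continuous_on {c..L} (FW U W)"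
proof -
  have "continuous_on {c..L} U" by (rule continuous_on_subset[OF assms(1)]) (use c0 in auto)
  then show ?thesis unfolding FW_def[abs_def] using assms(2) by (intro continuous_intros)
qed

lemma FW_pc:
  assumes "continuous_on {0..L} U" "continuous_on {c..L} W" shows "pc c L c (FW U W)"
  using FW_cont[OF assms] cL by (intro pc_continuous_on) auto

lemma stepU_bvp:
  assumes "admissible U W"
  shows "bvp d1 a1 0 L c (\<lambda>x. FU U W x - k * stepU U W x) (stepU U W)"
  unfolding stepU_def using assms by (intro green_bvp[OF d1 c0 cL fp1] FU_pc) (auto simp: admissible_def)

lemma stepW_bvp:
  assumes "admissible U W"
  shows "bvp d2 a2 c L c (\<lambda>x. FW U W x - k * stepW U W x) (stepW U W)"
  unfolding stepW_def using assms by (intro green_bvp[OF d2 order.refl cL fp2] FW_pc) (auto simp: admissible_def)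

lemma admissibleD:
  assumes "admissible U W"
  shows "x \<in> {0..L} \<Longrightarrow> \<delta> * \<phi> x \<le> U x" "x \<in> {0..L} \<Longrightarrow> U x \<le> M" "x \<in> {0..L} \<Longrightarrow> 0 < U x"
    "x \<in> {c..L} \<Longrightarrow> 0 \<le> W x" "x \<in> {c..L} \<Longrightarrow> W x \<le> wt x" "x \<in> {c..L} \<Longrightarrow> W x \<le> b"
proof -
  show 1: "x \<in> {0..L} \<Longrightarrow> \<delta> * \<phi> x \<le> U x" "x \<in> {0..L} \<Longrightarrow> U x \<le> M"
    "x \<in> {c..L} \<Longrightarrow> 0 \<le> W x" and 2: "x \<in> {c..L} \<Longrightarrow> W x \<le> wt x"
    using assms unfolding admissible_def by blast+
  show "0 < U x" if "x \<in> {0..L}"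
    using mult_pos_pos[OF \<delta>(1) phi_pos[OF that]] 1(1)[OF that] by linarith
  show "W x \<le> b" if "x \<in> {c..L}" using 2[OF that] b[OF that] by linarith
qed

lemma FU_order:
  assumes "admissible U W" "x \<in> {0..L}" "0 \<le> u" "u \<le> M" "\<epsilon> \<ge> 0" "\<sigma> * (u - U x) \<ge> - \<epsilon>"
    and "x \<in> {c<..L} \<Longrightarrow> 0 \<le> w \<and> w \<le> b \<and> \<sigma> * (W x - w) \<ge> - \<epsilon>"
  shows "\<sigma> * (u * (k + r - u - m * chi c L x * w) - FU U W x) \<ge> - (k + r + M * m) * \<epsilon>"
  unfolding FU_def
proof (rule consumer_source_order[where b = b])
  show "0 \<le> U x" "U x \<le> M" using admissibleD(2,3)[OF assms(1,2)] by auto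
  show "chi c L x = 0 \<or> chi c L x = 1 \<and> 0 \<le> w \<and> w \<le> b \<and> \<sigma> * (W x - w) \<ge> - \<epsilon>"
    using assms(7) by (auto simp: chi_def)
qed (use assms k r m b0 in auto)

lemma FW_order:
  assumes "admissible U W" "x \<in> {c..L}" "0 \<le> u" "u \<le> M" "\<epsilon> \<ge> 0" "\<sigma> * (u - U x) \<ge> - \<epsilon>" "\<sigma> * (W x - w) \<ge> - \<epsilon>"
  shows "\<sigma> * (FW U W x - (h + (k - q - p * u) * w)) \<ge> - (k + p * b) * \<epsilon>"
  unfolding FW_def
proof (rule resource_source_order[where M = M])
  show "0 \<le> W x" "W x \<le> b" using admissibleD(4,6)[OF assms(1,2)] by auto
qed (use assms k p q in auto)

lemma step_admissible:
  assumes adm: "admissible U W"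
  shows "admissible (stepU U W) (stepW U W)" "\<And>x. x \<in> {c..L} \<Longrightarrow> stepW U W x > 0"
proof -
  have U: "\<delta> * \<phi> x \<le> U x" "U x \<le> M" "U x > 0" if "x \<in> {0..L}" for x
    using admissibleD(1-3)[OF adm that] by auto
  have W: "0 \<le> W x" "W x \<le> wt x" "W x \<le> b" if "x \<in> {c..L}" for x
    using admissibleD(4-6)[OF adm that] by auto
  have sub: "x \<in> {0..L}" if "x \<in> {c..L}" for x using that c0 by auto
  have pU: "p * U x \<le> p * M" "p * U x \<ge> 0" if "x \<in> {c..L}" for x
    using U[OF sub[OF that]] p by auto
  have low: "stepU U W x \<ge> \<delta> * \<phi> x" if x: "x \<in> {0..L}" for x
  proof -
    have "1 * stepU U W x + (- \<delta>) * \<phi> x \<ge> 0"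
    proof (rule stationary_comparison[OF d1 a1' c0 cL k0 supersol_add[OF bvp_supersol[OF stepU_bvp[OF adm] d1] bvp_supersol[OF phi_bvp d1]] _ x])
      fix x assume x: "x \<in> {0<..<L} - {c}"
      then have x': "x \<in> {0..L}" by auto
      have "(- 1) * (\<delta> * \<phi> x * (k + r - \<delta> * \<phi> x - m * chi c L x * wt x) - FU U W x) \<ge> - (k + r + M * m) * 0"
      proof (rule FU_order[OF adm x'])
        show "x \<in> {c<..L} \<Longrightarrow> 0 \<le> wt x \<and> wt x \<le> b \<and> (- 1) * (W x - wt x) \<ge> - 0"
          using W[of x] wt_pos[of x] b[of x] by auto
      qed (use U[OF x'] \<delta> x' phi_pos in \<open>auto intro: less_imp_le\<close>)
      then have "FU U W x \<ge> \<delta> * \<phi> x * (k + r - \<delta> * \<phi> x - m * chi c L x * wt x)" by simp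
      moreover have "\<delta> * \<phi> x * (\<delta> * \<phi> x) \<le> \<delta> * \<phi> x * lam" using \<delta> x' phi_pos[OF x'] by (intro mult_left_mono) auto
      ultimately show "1 * (FU U W x - k * stepU U W x) + (- \<delta>) * ((r - m * chi c L x * wt x - lam) * \<phi> x)
         \<ge> - k * (1 * stepU U W x + (- \<delta>) * \<phi> x)" by (simp add: algebra_simps)
    qed
    then show ?thesis by simp
  qed
  have up: "stepU U W x \<le> M" if x: "x \<in> {0..L}" for x
  proof -
    have supM: "supersol d1 a1 0 L c 0 (\<lambda>x t. 0) (\<lambda>x t. M)"
      by (rule supersol_time_only[OF a1']) (use M0 in \<open>auto intro!: continuous_intros\<close>)
    have "M + (- 1) * stepU U W x \<ge> 0"
    proof (rule stationary_comparison[OF d1 a1' c0 cL k0 supersol_add[OF supM bvp_supersol[OF stepU_bvp[OF adm] d1]] _ x])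
      fix x assume x: "x \<in> {0<..<L} - {c}"
      then have x': "x \<in> {0..L}" by auto
      have "1 * (M * (k + r - M - m * chi c L x * 0) - FU U W x) \<ge> - (k + r + M * m) * 0"
      proof (rule FU_order[OF adm x'])
        show "x \<in> {c<..L} \<Longrightarrow> 0 \<le> (0::real) \<and> 0 \<le> b \<and> 1 * (W x - 0) \<ge> - 0"
          using W[of x] b0 by auto
      qed (use U[OF x'] M0 in auto)
      then have "FU U W x \<le> M * (k + r - M)" by simp
      also have "\<dots> \<le> M * k" using M M0 by (intro mult_left_mono) auto
      finally show "0 + (- 1) * (FU U W x - k * stepU U W x) \<ge> - k * (M + (- 1) * stepU U W x)"
        by (simp add: algebra_simps)
    qed
    then show ?thesis by simp
  qed
  have FWh: "FW U W x \<ge> h" if "x \<in> {c..L}" for x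
    using W[OF that] pU[OF that] k(2) by (simp add: FW_def)
  show Wpos: "stepW U W x > 0" if "x \<in> {c..L}" for x
    unfolding stepW_def
    by (rule green_pos[OF d2 order.refl cL fp2 FW_pc FWh h that]) (use adm in \<open>auto simp: admissible_def\<close>)
  have upW: "stepW U W x \<le> wt x" if x: "x \<in> {c..L}" for x
  proof -
    have "1 * wt x + (- 1) * stepW U W x \<ge> 0"
    proof (rule stationary_comparison[OF d2 a2 order.refl cL k0 supersol_add[OF bvp_supersol[OF wt_bvp d2] bvp_supersol[OF stepW_bvp[OF adm] d2]] _ x])
      fix x assume "x \<in> {c<..<L} - {c}"
      then have x': "x \<in> {c..L}" by auto
      have "(k - q - p * U x) * W x \<le> (k - q) * W x" using W[OF x'] pU[OF x'] by (intro mult_right_mono) auto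
      also have "\<dots> \<le> (k - q) * wt x" using W[OF x'] k(2) p M0 by (intro mult_left_mono) (auto intro: order_trans[rotated, OF k(2)])
      finally show "1 * (h - q * wt x) + (- 1) * (FW U W x - k * stepW U W x) \<ge> - k * (1 * wt x + (- 1) * stepW U W x)"
        by (simp add: FW_def algebra_simps)
    qed
    then show ?thesis by simp
  qed
  show "admissible (stepU U W) (stepW U W)"
    unfolding admissible_def
    using low up upW Wpos bvp_continuous[OF stepU_bvp[OF adm]] bvp_continuous[OF stepW_bvp[OF adm]]
    by (auto intro: less_imp_le)
qed

fun chain :: "(real \<Rightarrow> real) \<times> (real \<Rightarrow> real) \<Rightarrow> nat \<Rightarrow> (real \<Rightarrow> real) \<times> (real \<Rightarrow> real)" where
  "chain UW 0 = UW"
| "chain UW (Suc n) = (stepU (fst (chain UW n)) (snd (chain UW n)), stepW (fst (chain UW n)) (snd (chain UW n)))"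

lemma chain_admissible:
  assumes "admissible U0 W0" shows "admissible (fst (chain (U0, W0) n)) (snd (chain (U0, W0) n))"
  by (induction n) (use assms step_admissible in auto)

lemma chain_mono:
  fixes \<sigma> :: real
  assumes adm: "admissible U0 W0"
    and start: "\<And>x. x \<in> {0..L} \<Longrightarrow> \<sigma> * (stepU U0 W0 x - U0 x) \<ge> 0" "\<And>x. x \<in> {c..L} \<Longrightarrow> \<sigma> * (W0 x - stepW U0 W0 x) \<ge> 0"
  shows "(\<forall>x\<in>{0..L}. \<sigma> * (fst (chain (U0, W0) (Suc n)) x - fst (chain (U0, W0) n) x) \<ge> 0) \<and>
     (\<forall>x\<in>{c..L}. \<sigma> * (snd (chain (U0, W0) n) x - snd (chain (U0, W0) (Suc n)) x) \<ge> 0)"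
proof (induction n)
  case 0
  then show ?case using start by simp
next
  case (Suc n)
  define U where "U = fst (chain (U0, W0) n)"
  define W where "W = snd (chain (U0, W0) n)"
  define V where "V = stepU U W"
  define Z where "Z = stepW U W"
  have aUW: "admissible U W" unfolding U_def W_def by (rule chain_admissible[OF adm])
  have aVZ: "admissible V Z" unfolding V_def Z_def by (rule step_admissible(1)[OF aUW])
  have ihU: "\<sigma> * (V x - U x) \<ge> 0" if "x \<in> {0..L}" for x using Suc that by (simp add: V_def U_def W_def)
  have ihW: "\<sigma> * (W x - Z x) \<ge> 0" if "x \<in> {c..L}" for x using Suc that by (simp add: Z_def U_def W_def)
  have V: "0 \<le> V x" "V x \<le> M" if "x \<in> {0..L}" for x
    using admissibleD(2,3)[OF aVZ that] by auto
  have Z: "0 \<le> Z x \<and> Z x \<le> b" if "x \<in> {c..L}" for x using admissibleD(4,6)[OF aVZ that] by auto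
  have "\<sigma> * stepU V Z x + (- \<sigma>) * stepU U W x \<ge> 0" if x: "x \<in> {0..L}" for x
  proof (rule stationary_comparison[OF d1 a1' c0 cL k0 supersol_add[OF bvp_supersol[OF stepU_bvp[OF aVZ] d1] bvp_supersol[OF stepU_bvp[OF aUW] d1]] _ x])
    fix x assume "x \<in> {0<..<L} - {c}"
    then have x': "x \<in> {0..L}" by auto
    have "\<sigma> * (V x * (k + r - V x - m * chi c L x * Z x) - FU U W x) \<ge> - (k + r + M * m) * 0"
      by (rule FU_order[OF aUW x']) (use V[OF x'] Z ihU[OF x'] ihW in auto)
    then have "\<sigma> * (FU V Z x - FU U W x) \<ge> 0" by (simp add: FU_def)
    then show "\<sigma> * (FU V Z x - k * stepU V Z x) + (- \<sigma>) * (FU U W x - k * stepU U W x)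
      \<ge> - k * (\<sigma> * stepU V Z x + (- \<sigma>) * stepU U W x)" by (simp add: algebra_simps)
  qed
  moreover have "\<sigma> * stepW U W x + (- \<sigma>) * stepW V Z x \<ge> 0" if x: "x \<in> {c..L}" for x
  proof (rule stationary_comparison[OF d2 a2 order.refl cL k0 supersol_add[OF bvp_supersol[OF stepW_bvp[OF aUW] d2] bvp_supersol[OF stepW_bvp[OF aVZ] d2]] _ x])
    fix x assume "x \<in> {c<..<L} - {c}"
    then have x': "x \<in> {c..L}" "x \<in> {0..L}" using c0 by auto
    have "\<sigma> * (FW U W x - (h + (k - q - p * V x) * Z x)) \<ge> - (k + p * b) * 0"
      by (rule FW_order[OF aUW x'(1)]) (use V[OF x'(2)] ihU[OF x'(2)] ihW[OF x'(1)] in auto)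
    then have "\<sigma> * (FW U W x - FW V Z x) \<ge> 0" by (simp add: FW_def)
    then show "\<sigma> * (FW U W x - k * stepW U W x) + (- \<sigma>) * (FW V Z x - k * stepW V Z x)
      \<ge> - k * (\<sigma> * stepW U W x + (- \<sigma>) * stepW V Z x)" by (simp add: algebra_simps)
  qed
  ultimately show ?case by (simp add: U_def[symmetric] W_def[symmetric] V_def[symmetric] Z_def[symmetric] algebra_simps)
qed

lemma chain_limit:
  fixes \<sigma> :: real
  assumes adm: "admissible U0 W0" and \<sigma>: "\<sigma> = 1 \<or> \<sigma> = - 1"
    and start: "\<And>x. x \<in> {0..L} \<Longrightarrow> \<sigma> * (stepU U0 W0 x - U0 x) \<ge> 0" "\<And>x. x \<in> {c..L} \<Longrightarrow> \<sigma> * (W0 x - stepW U0 W0 x) \<ge> 0"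
  shows "\<exists>U W. coexistence U W \<and> (\<forall>\<epsilon>>0. \<exists>n. (\<forall>x\<in>{0..L}. \<bar>fst (chain (U0, W0) n) x - U x\<bar> < \<epsilon>) \<and>
     (\<forall>x\<in>{c..L}. \<bar>snd (chain (U0, W0) n) x - W x\<bar> < \<epsilon>))"
proof -
  define u where "u n = fst (chain (U0, W0) n)" for n
  define w where "w n = snd (chain (U0, W0) n)" for n
  have au: "admissible (u n) (w n)" for n unfolding u_def w_def by (rule chain_admissible[OF adm])
  have Suc: "u (Suc n) = stepU (u n) (w n)" "w (Suc n) = stepW (u n) (w n)" for n by (simp_all add: u_def w_def)
  have ubd: "\<delta> * \<phi> x \<le> u n x" "u n x \<le> M" "0 < u n x" if "x \<in> {0..L}" for n x
    using admissibleD(1-3)[OF au that] by auto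
  have wbd: "0 \<le> w n x" "w n x \<le> wt x" "w n x \<le> b" if "x \<in> {c..L}" for n x
    using admissibleD(4-6)[OF au that] by auto
  note mono = chain_mono[OF adm start]
  have "\<forall>x\<in>{0..L}. \<exists>l. (\<lambda>n. u n x) \<longlonglongrightarrow> l \<and> (\<forall>n. \<bar>u (Suc n) x - l\<bar> \<le> \<bar>u n x - l\<bar>)"
  proof
    fix x assume x: "x \<in> {0..L}"
    show "\<exists>l. (\<lambda>n. u n x) \<longlonglongrightarrow> l \<and> (\<forall>n. \<bar>u (Suc n) x - l\<bar> \<le> \<bar>u n x - l\<bar>)"
    proof (rule bounded_monotone_limit[OF \<sigma>])
      show "\<sigma> * (u (Suc n) x - u n x) \<ge> 0" for n using mono[of n] x by (simp add: u_def w_def)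
      show "\<bar>u n x\<bar> \<le> M" for n using ubd[OF x, of n] by simp
    qed
  qed
  then obtain U where U: "\<And>x. x \<in> {0..L} \<Longrightarrow> (\<lambda>n. u n x) \<longlonglongrightarrow> U x" "\<And>x n. x \<in> {0..L} \<Longrightarrow> \<bar>u (Suc n) x - U x\<bar> \<le> \<bar>u n x - U x\<bar>"
    by metis
  have "\<forall>x\<in>{c..L}. \<exists>l. (\<lambda>n. w n x) \<longlonglongrightarrow> l \<and> (\<forall>n. \<bar>w (Suc n) x - l\<bar> \<le> \<bar>w n x - l\<bar>)"
  proof
    fix x assume x: "x \<in> {c..L}"
    have \<sigma>': "- \<sigma> = 1 \<or> - \<sigma> = - 1" using \<sigma> by auto
    show "\<exists>l. (\<lambda>n. w n x) \<longlonglongrightarrow> l \<and> (\<forall>n. \<bar>w (Suc n) x - l\<bar> \<le> \<bar>w n x - l\<bar>)"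
    proof (rule bounded_monotone_limit[OF \<sigma>'])
      show "- \<sigma> * (w (Suc n) x - w n x) \<ge> 0" for n using mono[of n] x by (simp add: u_def w_def algebra_simps)
      show "\<bar>w n x\<bar> \<le> b" for n using wbd[OF x, of n] by simp
    qed
  qed
  then obtain W where W: "\<And>x. x \<in> {c..L} \<Longrightarrow> (\<lambda>n. w n x) \<longlonglongrightarrow> W x" "\<And>x n. x \<in> {c..L} \<Longrightarrow> \<bar>w (Suc n) x - W x\<bar> \<le> \<bar>w n x - W x\<bar>"
    by metis
  have Ub: "\<delta> * \<phi> x \<le> U x" "U x \<le> M" if "x \<in> {0..L}" for x
    using LIMSEQ_le_const[OF U(1)[OF that], of "\<delta> * \<phi> x"] LIMSEQ_le_const2[OF U(1)[OF that], of M] ubd[OF that] by auto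
  have Wb: "0 \<le> W x" "W x \<le> wt x" if "x \<in> {c..L}" for x
    using LIMSEQ_le_const[OF W(1)[OF that], of 0] LIMSEQ_le_const2[OF W(1)[OF that], of "wt x"] wbd[OF that] by auto
  have limFU: "(\<lambda>n. FU (u n) (w n) x) \<longlonglongrightarrow> FU U W x" if x: "x \<in> {0..L}" for x
  proof (cases "x \<le> c")
    case True
    then have "chi c L x = 0" by (simp add: chi_def)
    then show ?thesis unfolding FU_def by (auto intro!: tendsto_intros U(1) x)
  next
    case False
    then show ?thesis unfolding FU_def using x by (intro tendsto_intros U(1) W(1)) auto
  qed
  have limFW: "(\<lambda>n. FW (u n) (w n) x) \<longlonglongrightarrow> FW U W x" if x: "x \<in> {c..L}" for x
    unfolding FW_def using x c0 by (intro tendsto_intros U(1) W(1)) auto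
  have cont: "continuous_on {0..L} (u n)" "continuous_on {c..L} (w n)" for n using au[of n] by (auto simp: admissible_def)
  have bdFU: "\<bar>FU (u n) (w n) x\<bar> \<le> M * (k + r + M + m * b)" if x: "x \<in> {0..L}" for n x
  proof -
    have "\<bar>m * chi c L x * w n x\<bar> \<le> m * b" using wbd[of x n] x m b0 by (auto simp: chi_def abs_mult)
    then have "\<bar>k + r - u n x - m * chi c L x * w n x\<bar> \<le> k + r + M + m * b" using ubd[OF x, of n] k0 r by linarith
    then show ?thesis unfolding FU_def abs_mult using ubd[OF x, of n] M0 by (intro mult_mono) auto
  qed
  have bdFW: "\<bar>FW (u n) (w n) x\<bar> \<le> h + (k + q + p * M) * b" if x: "x \<in> {c..L}" for n x
  proof -
    have x': "x \<in> {0..L}" using x c0 by auto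
    have "0 \<le> p * u n x" "p * u n x \<le> p * M" using ubd[OF x', of n] p by auto
    then have "\<bar>k - q - p * u n x\<bar> \<le> k + q + p * M" using k0 q by linarith
    then have "\<bar>(k - q - p * u n x) * w n x\<bar> \<le> (k + q + p * M) * b" unfolding abs_mult using wbd[OF x, of n] by (intro mult_mono) auto
    then show ?thesis unfolding FW_def using h by linarith
  qed
  have eqU: "U x = stepU U W x" if x: "x \<in> {0..L}" for x
  proof (rule LIMSEQ_unique)
    show "(\<lambda>n. u (Suc n) x) \<longlonglongrightarrow> U x" using U(1)[OF x] by (rule LIMSEQ_Suc)
    show "(\<lambda>n. u (Suc n) x) \<longlonglongrightarrow> stepU U W x" unfolding Suc stepU_def
      by (rule green_tendsto(2)[OF d1 c0 cL fp1 FU_pc[OF cont] bdFU limFU x])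
  qed
  have eqW: "W x = stepW U W x" if x: "x \<in> {c..L}" for x
  proof (rule LIMSEQ_unique)
    show "(\<lambda>n. w (Suc n) x) \<longlonglongrightarrow> W x" using W(1)[OF x] by (rule LIMSEQ_Suc)
    show "(\<lambda>n. w (Suc n) x) \<longlonglongrightarrow> stepW U W x" unfolding Suc stepW_def
      by (rule green_tendsto(2)[OF d2 order.refl cL fp2 FW_pc[OF cont] bdFW limFW x])
  qed
  have "continuous_on {0..L} (stepU U W)" unfolding stepU_def
    by (rule green_tendsto(1)[OF d1 c0 cL fp1 FU_pc[OF cont] bdFU limFU])
  then have cU: "continuous_on {0..L} U" by (subst continuous_on_cong[OF refl eqU]) 
  have "continuous_on {c..L} (stepW U W)" unfolding stepW_def
    by (rule green_tendsto(1)[OF d2 order.refl cL fp2 FW_pc[OF cont] bdFW limFW])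
  then have cW: "continuous_on {c..L} W" by (subst continuous_on_cong[OF refl eqW])
  have admUW: "admissible U W" using cU cW Ub Wb by (auto simp: admissible_def)
  have "bvp d1 a1 0 L c (\<lambda>x. U x * (r - U x - m * chi c L x * W x)) U"
    by (rule bvp_cong[OF stepU_bvp[OF admUW]]) (use eqU L0 in \<open>auto simp: FU_def algebra_simps\<close>)
  moreover have "bvp d2 a2 c L c (\<lambda>x. h - q * W x - p * U x * W x) W"
    by (rule bvp_cong[OF stepW_bvp[OF admUW]]) (use eqW cL in \<open>auto simp: FW_def algebra_simps\<close>)
  moreover have "U x > 0" if "x \<in> {0..L}" for x
    using Ub(1)[OF that] \<delta>(1) phi_pos[OF that] by (meson less_le_trans mult_pos_pos)
  moreover have "W x > 0" if "x \<in> {c..L}" for x using step_admissible(2)[OF admUW that] eqW[OF that] by simp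
  ultimately have "coexistence U W" by (simp add: coex_def)
  moreover have "\<exists>n. (\<forall>x\<in>{0..L}. \<bar>u n x - U x\<bar> < \<epsilon>) \<and> (\<forall>x\<in>{c..L}. \<bar>w n x - W x\<bar> < \<epsilon>)" if \<epsilon>: "\<epsilon> > 0" for \<epsilon>
  proof -
    obtain n1 where n1: "\<And>x. x \<in> {0..L} \<Longrightarrow> \<bar>u n1 x - U x\<bar> < \<epsilon>"
      using monotone_convergence_uniform_on_interval[OF cont(1) cU U(2,1) \<epsilon>] by blast
    obtain n2 where n2: "\<And>x. x \<in> {c..L} \<Longrightarrow> \<bar>w n2 x - W x\<bar> < \<epsilon>"
      using monotone_convergence_uniform_on_interval[OF cont(2) cW W(2,1) \<epsilon>] by blast
    have "\<bar>u (max n1 n2) x - U x\<bar> < \<epsilon>" if x: "x \<in> {0..L}" for x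
      using lift_Suc_antimono_le[of "\<lambda>n. \<bar>u n x - U x\<bar>" n1 "max n1 n2"] U(2)[OF x] n1[OF x] by force
    moreover have "\<bar>w (max n1 n2) x - W x\<bar> < \<epsilon>" if x: "x \<in> {c..L}" for x
      using lift_Suc_antimono_le[of "\<lambda>n. \<bar>w n x - W x\<bar>" n2 "max n1 n2"] W(2)[OF x] n2[OF x] by force
    ultimately show ?thesis by blast
  qed
  ultimately show ?thesis unfolding u_def w_def by blast
qed

lemma lower_start:
  shows "admissible (\<lambda>x. \<delta> * \<phi> x) wt"
    and "\<And>x. x \<in> {0..L} \<Longrightarrow> 1 * (stepU (\<lambda>x. \<delta> * \<phi> x) wt x - \<delta> * \<phi> x) \<ge> 0"
    and "\<And>x. x \<in> {c..L} \<Longrightarrow> 1 * (wt x - stepW (\<lambda>x. \<delta> * \<phi> x) wt x) \<ge> 0"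
proof -
  show adm: "admissible (\<lambda>x. \<delta> * \<phi> x) wt" unfolding admissible_def
    using \<delta>(3) wt_pos by (auto intro!: continuous_intros phi_cont wt_cont intro: less_imp_le)
  show "1 * (stepU (\<lambda>x. \<delta> * \<phi> x) wt x - \<delta> * \<phi> x) \<ge> 0" if "x \<in> {0..L}" for x
    using step_admissible(1)[OF adm] that by (auto simp: admissible_def)
  show "1 * (wt x - stepW (\<lambda>x. \<delta> * \<phi> x) wt x) \<ge> 0" if "x \<in> {c..L}" for x
    using step_admissible(1)[OF adm] that by (auto simp: admissible_def)
qed

lemma upper_start:
  shows "admissible (\<lambda>x. M) (\<lambda>x. 0)"
    and "\<And>x. x \<in> {0..L} \<Longrightarrow> (- 1) * (stepU (\<lambda>x. M) (\<lambda>x. 0) x - M) \<ge> 0"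
    and "\<And>x. x \<in> {c..L} \<Longrightarrow> (- 1) * (0 - stepW (\<lambda>x. M) (\<lambda>x. 0) x) \<ge> 0"
proof -
  show adm: "admissible (\<lambda>x. M) (\<lambda>x. 0)" unfolding admissible_def
    using \<delta>(3) wt_pos by (auto intro: less_imp_le)
  show "(- 1) * (stepU (\<lambda>x. M) (\<lambda>x. 0) x - M) \<ge> 0" if "x \<in> {0..L}" for x
    using step_admissible(1)[OF adm] that by (auto simp: admissible_def)
  show "(- 1) * (0 - stepW (\<lambda>x. M) (\<lambda>x. 0) x) \<ge> 0" if "x \<in> {c..L}" for x
    using step_admissible(1)[OF adm] that by (auto simp: admissible_def)
qed

end

section \<open>A priori estimates for the evolution problem\<close>

lemma u_solution_supersol:
  assumes "u_solution d1 a1 r m L c u w"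
  shows "supersol d1 a1 0 L c 0 (\<lambda>x t. \<sigma> * (u x t * (r - u x t - m * chi c L x * w x t))) (\<lambda>x t. \<sigma> * u x t)"
proof -
  obtain ux uxx ut where U:
     "\<forall>t>0. \<forall>x\<in>{0..L}. ((\<lambda>y. u y t) has_real_derivative ux x t) (at x within {0..L})"
     "\<forall>t>0. \<forall>x\<in>{0<..<L} - {c}. ((\<lambda>y. ux y t) has_real_derivative uxx x t) (at x) \<and>
            ((\<lambda>s. u x s) has_real_derivative ut x t) (at t) \<and>
            ut x t = d1 * uxx x t - a1 * ux x t + u x t * (r - u x t - m * chi c L x * w x t)"
     "\<forall>t>0. d1 * ux 0 t - a1 * u 0 t = 0 \<and> ux L t = 0"
    and cu: "continuous_on ({0..L} \<times> {0..}) (\<lambda>(x, t). u x t)"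
    using assms unfolding u_solution_def by blast
  show ?thesis
  proof (rule supersolI[where zx = "\<lambda>x t. \<sigma> * ux x t" and zxx = "\<lambda>x t. \<sigma> * uxx x t" and zt = "\<lambda>x t. \<sigma> * ut x t"])
    show "continuous_on ({0..L} \<times> {0..}) (\<lambda>(x, t). \<sigma> * u x t)"
      using continuous_on_mult_left[OF cu, of \<sigma>] by (simp add: case_prod_beta')
    fix t :: real assume t: "t > 0"
    show "((\<lambda>y. \<sigma> * u y t) has_real_derivative \<sigma> * ux x t) (at x within {0..L})" if "x \<in> {0..L}" for x
      using U(1) t that by (intro DERIV_cmult) auto
    show "((\<lambda>y. \<sigma> * ux y t) has_real_derivative \<sigma> * uxx x t) (at x)"
         "((\<lambda>\<tau>. \<sigma> * u x \<tau>) has_real_derivative \<sigma> * ut x t) (at t)" if "x \<in> {0<..<L} - {c}" for x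
      using U(2) t that by (intro DERIV_cmult; blast)+
    show "\<sigma> * ut x t \<ge> d1 * (\<sigma> * uxx x t) - a1 * (\<sigma> * ux x t) + \<sigma> * (u x t * (r - u x t - m * chi c L x * w x t))"
      if "x \<in> {0<..<L} - {c}" for x
    proof -
      have e: "ut x t = d1 * uxx x t - a1 * ux x t + u x t * (r - u x t - m * chi c L x * w x t)" using U(2) t that by blast
      show ?thesis unfolding e by (simp add: algebra_simps)
    qed
    have "d1 * ux 0 t = a1 * u 0 t" "ux L t = 0" using U(3) t by auto
    then show "d1 * (\<sigma> * ux 0 t) \<le> a1 * (\<sigma> * u 0 t)" "\<sigma> * ux L t \<ge> 0" 
      by (simp_all add: mult.left_commute[of d1] mult.left_commute[of a1])
  qed
qed

lemma w_solution_supersol: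
  assumes "w_solution d2 a2 p q h L c u w"
  shows "supersol d2 a2 c L c 0 (\<lambda>x t. \<sigma> * (h - q * w x t - p * u x t * w x t)) (\<lambda>x t. \<sigma> * w x t)"
proof -
  obtain wx wxx wt where W:
     "\<forall>t>0. \<forall>x\<in>{c..L}. ((\<lambda>y. w y t) has_real_derivative wx x t) (at x within {c..L})"
     "\<forall>t>0. \<forall>x\<in>{c<..<L}. ((\<lambda>y. wx y t) has_real_derivative wxx x t) (at x) \<and>
            ((\<lambda>s. w x s) has_real_derivative wt x t) (at t) \<and>
            wt x t = d2 * wxx x t - a2 * wx x t + h - q * w x t - p * u x t * w x t"
     "\<forall>t>0. d2 * wx c t - a2 * w c t = 0 \<and> wx L t = 0"
    and cw: "continuous_on ({c..L} \<times> {0..}) (\<lambda>(x, t). w x t)"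
    using assms unfolding w_solution_def by blast
  show ?thesis
  proof (rule supersolI[where zx = "\<lambda>x t. \<sigma> * wx x t" and zxx = "\<lambda>x t. \<sigma> * wxx x t" and zt = "\<lambda>x t. \<sigma> * wt x t"])
    show "continuous_on ({c..L} \<times> {0..}) (\<lambda>(x, t). \<sigma> * w x t)"
      using continuous_on_mult_left[OF cw, of \<sigma>] by (simp add: case_prod_beta')
    fix t :: real assume t: "t > 0"
    show "((\<lambda>y. \<sigma> * w y t) has_real_derivative \<sigma> * wx x t) (at x within {c..L})" if "x \<in> {c..L}" for x
      using W(1) t that by (intro DERIV_cmult) auto
    show "((\<lambda>y. \<sigma> * wx y t) has_real_derivative \<sigma> * wxx x t) (at x)"
         "((\<lambda>\<tau>. \<sigma> * w x \<tau>) has_real_derivative \<sigma> * wt x t) (at t)" if "x \<in> {c<..<L} - {c}" for x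
      using W(2) t that by (intro DERIV_cmult; blast)+
    show "\<sigma> * wt x t \<ge> d2 * (\<sigma> * wxx x t) - a2 * (\<sigma> * wx x t) + \<sigma> * (h - q * w x t - p * u x t * w x t)"
      if "x \<in> {c<..<L} - {c}" for x
    proof -
      have e: "wt x t = d2 * wxx x t - a2 * wx x t + h - q * w x t - p * u x t * w x t" using W(2) t that by blast
      show ?thesis unfolding e by (simp add: algebra_simps)
    qed
    have "d2 * wx c t = a2 * w c t" "wx L t = 0" using W(3) t by auto
    then show "d2 * (\<sigma> * wx c t) \<le> a2 * (\<sigma> * w c t)" "\<sigma> * wx L t \<ge> 0"
      by (simp_all add: mult.left_commute[of d2] mult.left_commute[of a2])
  qed
qed

lemma bounded_on_strip:
  fixes z :: "real \<Rightarrow> real \<Rightarrow> real"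
  assumes "continuous_on ({A..B} \<times> {0..}) (\<lambda>(x, t). z x t)"
  obtains K where "K > 0" "\<And>x t. x \<in> {A..B} \<Longrightarrow> t \<in> {0..T} \<Longrightarrow> \<bar>z x t\<bar> \<le> K"
proof -
  have "continuous_on ({A..B} \<times> {0..T}) (\<lambda>(x, t). z x t)" by (rule continuous_on_subset[OF assms]) auto
  then have "compact ((\<lambda>(x, t). z x t) ` ({A..B} \<times> {0..T}))"
    by (intro compact_continuous_image compact_Times) auto
  then obtain K where K: "\<forall>y\<in>(\<lambda>(x, t). z x t) ` ({A..B} \<times> {0..T}). norm y \<le> K"
    using compact_imp_bounded bounded_iff by metis
  have "\<bar>z x t\<bar> \<le> max K 1" if "x \<in> {A..B}" "t \<in> {0..T}" for x t
  proof -
    have "(x, t) \<in> {A..B} \<times> {0..T}" using that by simp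
    then have "norm ((\<lambda>(x, t). z x t) (x, t)) \<le> K" using K by blast
    then show ?thesis by simp
  qed
  then show thesis using that[of "max K 1"] by simp
qed

lemma pos_part_power_deriv:
  "((\<lambda>y::real. (max 0 y)^3) has_real_derivative 3 * (max 0 y)\<^sup>2) (at y)"
  "((\<lambda>y::real. (max 0 y)\<^sup>2) has_real_derivative 2 * max 0 y) (at y)"
proof -
  consider "y > 0" | "y < 0" | "y = 0" by linarith
  then have "((\<lambda>y::real. (max 0 y)^3) has_real_derivative 3 * (max 0 y)\<^sup>2) (at y) \<and>
     ((\<lambda>y::real. (max 0 y)\<^sup>2) has_real_derivative 2 * max 0 y) (at y)"
  proof cases
    case 1
    have "((\<lambda>y::real. y^3) has_real_derivative 3 * (max 0 y)\<^sup>2) (at y)"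
      "((\<lambda>y::real. y\<^sup>2) has_real_derivative 2 * max 0 y) (at y)"
      using 1 by (auto intro!: derivative_eq_intros)
    then show ?thesis
      by (intro conjI; elim has_field_derivative_transform_within_open[of _ _ _ "{0<..}"]) (use 1 in auto)
  next
    case 2
    have "((\<lambda>y::real. 0) has_real_derivative 3 * (max 0 y)\<^sup>2) (at y)"
      "((\<lambda>y::real. 0) has_real_derivative 2 * max 0 y) (at y)"
      using 2 by (auto intro!: derivative_eq_intros)
    then show ?thesis
      by (intro conjI; elim has_field_derivative_transform_within_open[of _ _ _ "{..<0}"]) (use 2 in auto)
  next
    case 3
    have sq: "((\<lambda>h. (max 0 h)\<^sup>2 / h) \<longlongrightarrow> 0) (at (0::real))"
    proof (rule Lim_transform_eventually)
      show "((\<lambda>h. max 0 h) \<longlongrightarrow> 0) (at (0::real))" by (rule tendsto_eq_intros refl)+ simp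
      show "\<forall>\<^sub>F h in at (0::real). max 0 h = (max 0 h)\<^sup>2 / h"
        by (auto simp: eventually_at_filter max_def power2_eq_square)
    qed
    have cu: "((\<lambda>h. (max 0 h)^3 / h) \<longlongrightarrow> 0) (at (0::real))"
    proof (rule Lim_transform_eventually)
      show "((\<lambda>h. (max 0 h)\<^sup>2) \<longlongrightarrow> 0) (at (0::real))" by (rule tendsto_eq_intros refl)+ simp
      show "\<forall>\<^sub>F h in at (0::real). (max 0 h)\<^sup>2 = (max 0 h)^3 / h"
        by (auto simp: eventually_at_filter max_def power2_eq_square power3_eq_cube)
    qed
    show ?thesis using 3 sq cu by (simp add: DERIV_def)
  qed
  then show "((\<lambda>y::real. (max 0 y)^3) has_real_derivative 3 * (max 0 y)\<^sup>2) (at y)"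
     "((\<lambda>y::real. (max 0 y)\<^sup>2) has_real_derivative 2 * max 0 y) (at y)" by auto
qed

locale evolution = persistent_system +
  fixes u w :: "real \<Rightarrow> real \<Rightarrow> real"
  assumes sol: "is_solution d1 d2 a1 a2 r m p q h L c u w"
    and u_init: "\<And>x. x \<in> {0..L} \<Longrightarrow> u x 0 \<ge> 0" "\<exists>x\<in>{0..L}. u x 0 \<noteq> 0"
    and w_init: "\<And>x. x \<in> {c..L} \<Longrightarrow> w x 0 \<ge> 0"
begin

lemma cont_u: "continuous_on ({0..L} \<times> {0..}) (\<lambda>(x, t). u x t)"
  using sol by (simp add: is_solution_def u_solution_def)

lemma cont_w: "continuous_on ({c..L} \<times> {0..}) (\<lambda>(x, t). w x t)"
  using sol by (simp add: is_solution_def w_solution_def)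

lemma sup_u: "supersol d1 a1 0 L c 0 (\<lambda>x t. \<sigma> * (u x t * (r - u x t - m * chi c L x * w x t))) (\<lambda>x t. \<sigma> * u x t)"
  using sol by (intro u_solution_supersol) (simp add: is_solution_def)

lemma sup_w: "supersol d2 a2 c L c 0 (\<lambda>x t. \<sigma> * (h - q * w x t - p * u x t * w x t)) (\<lambda>x t. \<sigma> * w x t)"
  using sol by (intro w_solution_supersol) (simp add: is_solution_def)

lemma growth_rate_bounded:
  obtains K where "K > 0" "\<And>x t. x \<in> {0..L} \<Longrightarrow> t \<in> {0..T} \<Longrightarrow> \<bar>r - u x t - m * chi c L x * w x t\<bar> \<le> K"
proof -
  obtain K1 where K1: "K1 > 0" "\<And>x t. x \<in> {0..L} \<Longrightarrow> t \<in> {0..T} \<Longrightarrow> \<bar>u x t\<bar> \<le> K1"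
    by (rule bounded_on_strip[OF cont_u], rule that)
  obtain K2 where K2: "K2 > 0" "\<And>x t. x \<in> {c..L} \<Longrightarrow> t \<in> {0..T} \<Longrightarrow> \<bar>w x t\<bar> \<le> K2"
    by (rule bounded_on_strip[OF cont_w], rule that)
  show thesis
  proof (rule that[of "r + K1 + m * K2"])
    show "r + K1 + m * K2 > 0" using r K1(1) K2(1) m by (simp add: add_pos_pos)
    fix x t assume x: "x \<in> {0..L}" and t: "t \<in> {0..T}"
    have "\<bar>m * chi c L x * w x t\<bar> \<le> m * K2" using K2(1) K2(2)[of x t] m x t by (auto simp: chi_def abs_mult)
    then show "\<bar>r - u x t - m * chi c L x * w x t\<bar> \<le> r + K1 + m * K2" using K1(2)[OF x t] r by linarith
  qed
qed

lemma u_nonneg: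
  assumes "x \<in> {0..L}" "t \<ge> 0" shows "u x t \<ge> 0"
proof -
  obtain K where K: "K > 0" "\<And>x s. x \<in> {0..L} \<Longrightarrow> s \<in> {0..t} \<Longrightarrow> \<bar>r - u x s - m * chi c L x * w x s\<bar> \<le> K"
    by (rule growth_rate_bounded, rule that)
  have "1 * u x t \<ge> 0"
  proof (rule weak_maximum_principle[OF d1 a1' c0 cL less_imp_le[OF K(1)] sup_u[of 1], of t])
    fix x s assume h: "x \<in> {0<..<L} - {c}" "0 < s" "s \<le> t" "1 * u x s < 0"
    have "r - u x s - m * chi c L x * w x s \<le> K" using K(2)[of x s] h by auto
    then have "u x s * (r - u x s - m * chi c L x * w x s) \<ge> u x s * K" using h by (intro mult_left_mono_neg) auto
    then show "K * (1 * u x s) \<le> 1 * (u x s * (r - u x s - m * chi c L x * w x s))" by (simp add: mult.commute)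
  qed (use assms u_init in auto)
  then show ?thesis by simp
qed

lemma w_nonneg:
  assumes "x \<in> {c..L}" "t \<ge> 0" shows "w x t \<ge> 0"
proof -
  have "1 * w x t \<ge> 0"
  proof (rule weak_maximum_principle[OF d2 a2 order.refl cL order.refl sup_w[of 1], of t])
    fix x s assume hh: "x \<in> {c<..<L} - {c}" "0 < s" "s \<le> t" "1 * w x s < 0"
    have "u x s \<ge> 0" using hh c0 by (intro u_nonneg) auto
    then have "p * u x s * w x s \<le> 0" "q * w x s \<le> 0" using hh p q by (auto intro: mult_nonneg_nonpos)
    then show "0 * (1 * w x s) \<le> 1 * (h - q * w x s - p * u x s * w x s)" using h by simp
  qed (use assms w_init in auto)
  then show ?thesis by simp
qed

lemma u_le:
  assumes M: "M \<ge> r" "\<And>x. x \<in> {0..L} \<Longrightarrow> u x 0 \<le> M" and "x \<in> {0..L}" "t \<ge> 0"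
  shows "u x t \<le> M"
proof -
  have supM: "supersol d1 a1 0 L c 0 (\<lambda>x t. 0) (\<lambda>x t. M)"
    by (rule supersol_time_only[OF a1']) (use M r in \<open>auto intro!: continuous_intros\<close>)
  have "M + (- 1) * u x t \<ge> 0"
  proof (rule weak_maximum_principle[OF d1 a1' c0 cL order.refl supersol_add[OF supM sup_u[of "- 1"]], of t])
    fix x s assume hh: "x \<in> {0<..<L} - {c}" "0 < s" "s \<le> t" "M + (- 1) * u x s < 0"
    have "m * chi c L x * w x s \<ge> 0" using w_nonneg[of x s] hh m by (auto simp: chi_def)
    then have "u x s * (r - u x s - m * chi c L x * w x s) \<le> 0"
      using hh M r by (intro mult_nonneg_nonpos) auto
    then show "0 * (M + (- 1) * u x s) \<le> 0 + (- 1) * (u x s * (r - u x s - m * chi c L x * w x s))" by simp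
  qed (use assms in auto)
  then show ?thesis by simp
qed

lemma w_eventually_le:
  assumes "e > 0" shows "\<exists>T. \<forall>t\<ge>T. \<forall>x\<in>{c..L}. w x t \<le> wt x + e"
proof -
  have "\<exists>T. \<forall>t\<ge>T. \<forall>x\<in>{c..L}. 1 * wt x + (- 1) * w x t \<ge> - (0 / q) - e"
  proof (rule supersol_eventually_ge[OF d2 a2 order.refl cL q order.refl assms supersol_add[OF bvp_supersol[OF wt_bvp d2] sup_w]])
    fix x s :: real assume hh: "x \<in> {c<..<L} - {c}" "0 < s"
    have "p * u x s * w x s \<ge> 0" using hh c0 p u_nonneg[of x s] w_nonneg[of x s] by auto
    then show "- q * (1 * wt x + (- 1) * w x s) - 0 \<le> 1 * (h - q * wt x) + (- 1) * (h - q * w x s - p * u x s * w x s)"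
      by (simp add: algebra_simps)
  qed
  then show ?thesis by fastforce
qed

text \<open>Strong positivity: the bump \<open>(\<rho>\<^sup>2 + L\<^sup>2 t - (x - \<xi>)\<^sup>2)\<^sub>+\<^sup>3\<close> starts inside the support of \<open>u(\<cdot>, 0)\<close>
  and has spread over the whole interval at time \<open>1\<close>; times \<open>\<phi> exp (- \<Lambda> t)\<close> it is a subsolution.\<close>
lemma u_positive:
  assumes T: "T \<ge> 1"
  shows "\<exists>\<mu>>0. \<forall>x\<in>{0..L}. u x T \<ge> \<mu> * \<phi> x"
proof -
  obtain \<xi> where \<xi>: "\<xi> \<in> {0..L}" "u \<xi> 0 > 0" using u_init by (metis order_le_less)
  have cu0: "continuous_on {0..L} (\<lambda>x. u x 0)"
  proof -
    have "continuous_on {0..L} (\<lambda>x. (\<lambda>(x, t). u x t) (x, 0))"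
      by (rule continuous_on_compose2[OF cont_u]) (auto intro!: continuous_intros)
    then show ?thesis by simp
  qed
  obtain \<rho> where \<rho>: "\<rho> > 0" "\<And>x. x \<in> {0..L} \<Longrightarrow> \<bar>x - \<xi>\<bar> < \<rho> \<Longrightarrow> u x 0 \<ge> u \<xi> 0 / 2"
  proof -
    have "u \<xi> 0 / 2 > 0" using \<xi> by simp
    then obtain \<rho> where \<rho>: "\<rho> > 0" "\<And>x. x \<in> {0..L} \<Longrightarrow> \<bar>x - \<xi>\<bar> < \<rho> \<Longrightarrow> \<bar>u x 0 - u \<xi> 0\<bar> < u \<xi> 0 / 2"
      using cu0 \<xi>(1) unfolding continuous_on_iff dist_real_def by blast
    show thesis
    proof (rule that[OF \<rho>(1)])
      show "u x 0 \<ge> u \<xi> 0 / 2" if "x \<in> {0..L}" "\<bar>x - \<xi>\<bar> < \<rho>" for x using \<rho>(2)[OF that] by linarith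
    qed
  qed
  obtain K where K: "K > 0" "\<And>x s. x \<in> {0..L} \<Longrightarrow> s \<in> {0..T} \<Longrightarrow> \<bar>r - u x s - m * chi c L x * w x s\<bar> \<le> K"
    by (rule growth_rate_bounded, rule that)
  obtain \<phi>' where \<phi>': "\<forall>x\<in>{0..L}. (\<phi> has_real_derivative \<phi>' x) (at x within {0..L})" "continuous_on {0..L} \<phi>'"
     "\<forall>x\<in>{0<..<L} - {c}. (\<phi>' has_real_derivative (a1 * \<phi>' x - (r - m * chi c L x * wt x - lam) * \<phi> x) / d1) (at x)"
     "d1 * \<phi>' 0 = a1 * \<phi> 0" "\<phi>' L = 0"
    using phi_bvp unfolding bvp_def by blast
  have "continuous_on {0..L} (\<lambda>x. (2 * d1 * \<phi>' x - a1 * \<phi> x) / \<phi> x)"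
    using phi_pos by (intro continuous_intros \<phi>' phi_cont) (force simp: less_imp_neq[symmetric])
  then obtain \<kappa> where \<kappa>: "\<kappa> > 0" "\<And>x. x \<in> {0..L} \<Longrightarrow> \<bar>(2 * d1 * \<phi>' x - a1 * \<phi> x) / \<phi> x\<bar> \<le> \<kappa>"
    using continuous_on_Icc_bounded by blast
  have \<kappa>': "\<bar>2 * d1 * \<phi>' x - a1 * \<phi> x\<bar> \<le> \<kappa> * \<phi> x" if "x \<in> {0..L}" for x
    using \<kappa>(2)[OF that] phi_pos[OF that] by (simp add: abs_divide pos_divide_le_eq)
  obtain \<Phi> where \<Phi>: "\<Phi> > 0" "\<And>x. x \<in> {0..L} \<Longrightarrow> \<bar>\<phi> x\<bar> \<le> \<Phi>" using continuous_on_Icc_bounded[OF phi_cont] by blast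
  obtain S where S: "S > 0" "\<And>x. x \<in> {0..L} \<Longrightarrow> \<bar>r - m * chi c L x * wt x - lam\<bar> \<le> S"
  proof -
    have "pc 0 L c (\<lambda>x. r - m * (chi c L x * wt x) - lam)"
      using c0 cL by (intro pc_diff pc_mult pc_chi pc_continuous_on continuous_intros wt_cont) auto
    from pc_bounded[OF c0 less_imp_le[OF cL] this] obtain S
      where "S > 0" "\<And>x. x \<in> {0..L} \<Longrightarrow> \<bar>r - m * (chi c L x * wt x) - lam\<bar> \<le> S" by blast
    then show thesis by (intro that[of S]) (simp_all add: mult.assoc)
  qed
  define \<delta> where "\<delta> = u \<xi> 0 / 2 / (\<rho>^6 * \<Phi>)"
  have \<delta>: "\<delta> > 0" using \<xi> \<rho>(1) \<Phi>(1) by (simp add: \<delta>_def)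
  define C where "C = L\<^sup>2"
  define Z where "Z = 3 * C + 30 * d1 + 6 * L * \<kappa>"
  define E where "E = Z\<^sup>2 / (96 * d1 * \<rho>\<^sup>2)"
  define \<Lambda> where "\<Lambda> = K + S + E"
  define Y where "Y x t = max 0 (\<rho>\<^sup>2 + C * t - (x - \<xi>)\<^sup>2)" for x t
  define g where "g t = \<delta> * exp (- \<Lambda> * t)" for t
  have gpos: "g t > 0" for t using \<delta> by (simp add: g_def)
  define B where "B x t = g t * ((Y x t)^3 * \<phi> x)" for x t
  define Bx where "Bx x t = g t * ((- 6 * (x - \<xi>) * (Y x t)\<^sup>2) * \<phi> x + (Y x t)^3 * \<phi>' x)" for x t
  define Bxx where "Bxx x t = g t * ((- 6 * (Y x t)\<^sup>2 + 24 * (x - \<xi>)\<^sup>2 * Y x t) * \<phi> x + 2 * (- 6 * (x - \<xi>) * (Y x t)\<^sup>2) * \<phi>' x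
     + (Y x t)^3 * ((a1 * \<phi>' x - (r - m * chi c L x * wt x - lam) * \<phi> x) / d1))" for x t
  define Bt where "Bt x t = g t * ((3 * C * (Y x t)\<^sup>2 - \<Lambda> * (Y x t)^3) * \<phi> x)" for x t
  have Yx: "((\<lambda>x. (Y x t)^3) has_real_derivative - 6 * (x - \<xi>) * (Y x t)\<^sup>2) (at x within X)"
    "((\<lambda>x. (Y x t)\<^sup>2) has_real_derivative - 4 * (x - \<xi>) * Y x t) (at x within X)" for x t X
  proof -
    have i: "((\<lambda>x. \<rho>\<^sup>2 + C * t - (x - \<xi>)\<^sup>2) has_real_derivative - 2 * (x - \<xi>)) (at x within X)"
      by (auto intro!: derivative_eq_intros)
    show "((\<lambda>x. (Y x t)^3) has_real_derivative - 6 * (x - \<xi>) * (Y x t)\<^sup>2) (at x within X)"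
      unfolding Y_def by (rule DERIV_cong[OF DERIV_chain2[OF pos_part_power_deriv(1) i]]) simp
    show "((\<lambda>x. (Y x t)\<^sup>2) has_real_derivative - 4 * (x - \<xi>) * Y x t) (at x within X)"
      unfolding Y_def by (rule DERIV_cong[OF DERIV_chain2[OF pos_part_power_deriv(2) i]]) simp
  qed
  have Yt: "((\<lambda>t. (Y x t)^3) has_real_derivative 3 * C * (Y x t)\<^sup>2) (at t)" for x t
  proof -
    have i: "((\<lambda>t. \<rho>\<^sup>2 + C * t - (x - \<xi>)\<^sup>2) has_real_derivative C) (at t)"
      by (auto intro!: derivative_eq_intros)
    show ?thesis unfolding Y_def by (rule DERIV_cong[OF DERIV_chain2[OF pos_part_power_deriv(1) i]]) simp
  qed
  have dB: "((\<lambda>x. B x t) has_real_derivative Bx x t) (at x within {0..L})" if "x \<in> {0..L}" for x t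
    unfolding B_def Bx_def
    by (rule DERIV_cong[OF DERIV_cmult[OF DERIV_mult[OF Yx(1) \<phi>'(1)[rule_format, OF that]]]]) (simp add: algebra_simps)
  have dBx: "((\<lambda>x. Bx x t) has_real_derivative Bxx x t) (at x)" if x: "x \<in> {0<..<L} - {c}" for x t
  proof -
    have at: "at x within {0..L} = at x" using x by (intro at_within_Icc_at) auto
    have 1: "(\<phi> has_real_derivative \<phi>' x) (at x)" using \<phi>'(1) x at by (metis Diff_iff atLeastAtMost_iff greaterThanLessThan_iff less_imp_le)
    have 2: "(\<phi>' has_real_derivative (a1 * \<phi>' x - (r - m * chi c L x * wt x - lam) * \<phi> x) / d1) (at x)" using \<phi>'(3) x by blast
    have 3: "((\<lambda>x. - 6 * (x - \<xi>)) has_real_derivative - 6) (at x)" by (auto intro!: derivative_eq_intros)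
    have 4: "((\<lambda>x. - 6 * (x - \<xi>) * (Y x t)\<^sup>2) has_real_derivative - 6 * (Y x t)\<^sup>2 + 24 * (x - \<xi>)\<^sup>2 * Y x t) (at x)"
      by (rule DERIV_cong[OF DERIV_mult[OF 3 Yx(2)[of t x UNIV]]]) (simp add: power2_eq_square algebra_simps)
    show ?thesis unfolding Bx_def Bxx_def
      by (rule DERIV_cong[OF DERIV_cmult[OF DERIV_add[OF DERIV_mult[OF 4 1] DERIV_mult[OF Yx(1)[of t x UNIV] 2]]]])
         (simp add: distrib_left)
  qed
  have dBt: "((\<lambda>t. B x t) has_real_derivative Bt x t) (at t)" for x t
  proof -
    have 1: "(g has_real_derivative - \<Lambda> * g t) (at t)" unfolding g_def by (auto intro!: derivative_eq_intros)
    have 2: "((\<lambda>t. (Y x t)^3 * \<phi> x) has_real_derivative 3 * C * (Y x t)\<^sup>2 * \<phi> x) (at t)"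
      by (rule DERIV_cmult_right[OF Yt])
    show ?thesis unfolding B_def Bt_def
      by (rule DERIV_cong[OF DERIV_mult[OF 1 2]]) (simp add: algebra_simps)
  qed
  have cB: "continuous_on ({0..L} \<times> {0..}) (\<lambda>(x, t). - B x t)"
  proof -
    have "continuous_on ({0..L} \<times> {0..}) (\<lambda>p. \<phi> (fst p))"
      by (rule continuous_on_compose2[OF phi_cont]) (auto intro!: continuous_intros)
    then show ?thesis unfolding case_prod_beta' B_def g_def Y_def by (intro continuous_intros)
  qed
  have Y0: "Y x t \<ge> 0" for x t by (simp add: Y_def)
  have supB: "supersol d1 a1 0 L c 0 (\<lambda>x t. - Bt x t + d1 * Bxx x t - a1 * Bx x t) (\<lambda>x t. - B x t)"
  proof (rule supersolI[where zx = "\<lambda>x t. - Bx x t" and zxx = "\<lambda>x t. - Bxx x t" and zt = "\<lambda>x t. - Bt x t"])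
    show "continuous_on ({0..L} \<times> {0..}) (\<lambda>(x, t). - B x t)" by (rule cB)
    show "((\<lambda>y. - B y t) has_real_derivative - Bx x t) (at x within {0..L})" if "x \<in> {0..L}" for x t
      by (intro DERIV_minus dB that)
    show "((\<lambda>y. - Bx y t) has_real_derivative - Bxx x t) (at x)" if "x \<in> {0<..<L} - {c}" for x t
      by (intro DERIV_minus dBx that)
    show "((\<lambda>\<tau>. - B x \<tau>) has_real_derivative - Bt x t) (at t)" for x t by (intro DERIV_minus dBt)
    show "- Bt x t \<ge> d1 * - Bxx x t - a1 * - Bx x t + (- Bt x t + d1 * Bxx x t - a1 * Bx x t)" for x t by simp
    have "\<phi> 0 > 0" "\<phi> L > 0" using phi_pos L0 by auto
    show "d1 * - Bx 0 t \<le> a1 * - B 0 t" for t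
    proof -
      have "d1 * Bx 0 t - a1 * B 0 t = g t * (6 * \<xi> * (Y 0 t)\<^sup>2 * \<phi> 0 * d1) + g t * (Y 0 t)^3 * (d1 * \<phi>' 0 - a1 * \<phi> 0)"
        by (simp add: Bx_def B_def algebra_simps)
      also have "\<dots> = g t * (6 * \<xi> * (Y 0 t)\<^sup>2 * \<phi> 0 * d1)" using \<phi>'(4) by simp
      also have "\<dots> \<ge> 0" using gpos[of t] \<xi> \<open>\<phi> 0 > 0\<close> d1 by (intro mult_nonneg_nonneg) (auto intro: less_imp_le)
      finally show ?thesis by simp
    qed
    show "- Bx L t \<ge> 0" for t
    proof -
      have "- Bx L t = g t * (6 * (L - \<xi>) * (Y L t)\<^sup>2 * \<phi> L)" using \<phi>'(5) by (simp add: Bx_def algebra_simps)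
      also have "\<dots> \<ge> 0" using gpos[of t] \<xi> \<open>\<phi> L > 0\<close> by (intro mult_nonneg_nonneg) (auto intro: less_imp_le)
      finally show ?thesis .
    qed
  qed
  have sub: "- Bt x t + d1 * Bxx x t - a1 * Bx x t - K * B x t \<ge> 0" if x: "x \<in> {0..L}" and t: "t \<ge> 0" for x t
  proof -
    define y where "y = Y x t"
    define R where "R = r - m * chi c L x * wt x - lam"
    have y0: "y \<ge> 0" using Y0 by (simp add: y_def)
    have ysq: "(x - \<xi>)\<^sup>2 * y = (\<rho>\<^sup>2 + C * t) * y - y\<^sup>2"
      by (auto simp: y_def Y_def max_def power2_eq_square algebra_simps)
    have f0: "\<phi> x > 0" using phi_pos[OF x] .
    have dd: "d1 * ((a1 * \<phi>' x - R * \<phi> x) / d1) = a1 * \<phi>' x - R * \<phi> x" using d1 by simp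
    have "d1 * Bxx x t - a1 * Bx x t = g t * (d1 * (- 6 * y\<^sup>2 + 24 * ((x - \<xi>)\<^sup>2 * y)) * \<phi> x + (- 6 * (x - \<xi>) * y\<^sup>2) * (2 * d1 * \<phi>' x - a1 * \<phi> x)
       + y^3 * (d1 * ((a1 * \<phi>' x - R * \<phi> x) / d1) - a1 * \<phi>' x))"
      by (simp add: Bxx_def Bx_def y_def R_def algebra_simps)
    also have "\<dots> = g t * (d1 * (24 * (\<rho>\<^sup>2 + C * t) * y - 30 * y\<^sup>2) * \<phi> x + (- 6 * (x - \<xi>) * y\<^sup>2) * (2 * d1 * \<phi>' x - a1 * \<phi> x) - y^3 * R * \<phi> x)"
      unfolding dd ysq by (simp add: algebra_simps)
    finally have D: "- Bt x t + d1 * Bxx x t - a1 * Bx x t - K * B x t = g t * (d1 * (24 * (\<rho>\<^sup>2 + C * t) * y - 30 * y\<^sup>2) * \<phi> x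
       + (- 6 * (x - \<xi>) * y\<^sup>2) * (2 * d1 * \<phi>' x - a1 * \<phi> x) - y^3 * R * \<phi> x - 3 * C * y\<^sup>2 * \<phi> x + \<Lambda> * y^3 * \<phi> x - K * y^3 * \<phi> x)"
      by (simp add: Bt_def B_def y_def algebra_simps)
    have e1: "d1 * (24 * (\<rho>\<^sup>2 + C * t) * y - 30 * y\<^sup>2) * \<phi> x \<ge> d1 * (24 * \<rho>\<^sup>2 * y - 30 * y\<^sup>2) * \<phi> x"
    proof -
      have "C * t * y \<ge> 0" using t y0 by (simp add: C_def)
      then have "24 * \<rho>\<^sup>2 * y - 30 * y\<^sup>2 \<le> 24 * (\<rho>\<^sup>2 + C * t) * y - 30 * y\<^sup>2" by (simp add: algebra_simps)
      then show ?thesis using d1 f0 by (intro mult_right_mono mult_left_mono) auto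
    qed
    have e2: "(- 6 * (x - \<xi>) * y\<^sup>2) * (2 * d1 * \<phi>' x - a1 * \<phi> x) \<ge> - (6 * L * y\<^sup>2 * (\<kappa> * \<phi> x))"
    proof -
      have "\<bar>- 6 * (x - \<xi>) * y\<^sup>2\<bar> \<le> 6 * L * y\<^sup>2" using x \<xi>(1) unfolding abs_mult by (intro mult_mono) auto
      then have "\<bar>(- 6 * (x - \<xi>) * y\<^sup>2) * (2 * d1 * \<phi>' x - a1 * \<phi> x)\<bar> \<le> 6 * L * y\<^sup>2 * (\<kappa> * \<phi> x)"
        unfolding abs_mult[of "- 6 * (x - \<xi>) * y\<^sup>2"] using \<kappa>'[OF x] L0 by (intro mult_mono) auto
      then show ?thesis by linarith
    qed
    have e3: "y^3 * R * \<phi> x \<le> y^3 * S * \<phi> x"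
      using S(2)[OF x] y0 f0 unfolding R_def by (intro mult_right_mono mult_left_mono) auto
    have quad: "24 * d1 * \<rho>\<^sup>2 - Z * y + E * y\<^sup>2 \<ge> 0"
    proof -
      define v where "v = 96 * d1 * \<rho>\<^sup>2"
      have v: "v > 0" using d1 \<rho>(1) by (simp add: v_def)
      have "v * (v / 4 - Z * y + E * y\<^sup>2) = (v / 2 - Z * y)\<^sup>2"
        using v unfolding E_def v_def[symmetric] by (simp add: power2_eq_square field_simps)
      then have "v * (v / 4 - Z * y + E * y\<^sup>2) \<ge> 0" by simp
      then have "v / 4 - Z * y + E * y\<^sup>2 \<ge> 0" using v by (simp add: zero_le_mult_iff)
      then show ?thesis by (simp add: v_def)
    qed
    have "d1 * (24 * \<rho>\<^sup>2 * y - 30 * y\<^sup>2) * \<phi> x - (6 * L * y\<^sup>2 * (\<kappa> * \<phi> x)) - y^3 * S * \<phi> x - 3 * C * y\<^sup>2 * \<phi> x + \<Lambda> * y^3 * \<phi> x - K * y^3 * \<phi> x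
      = y * \<phi> x * (24 * d1 * \<rho>\<^sup>2 - Z * y + E * y\<^sup>2)"
      by (simp add: Z_def \<Lambda>_def power2_eq_square power3_eq_cube algebra_simps)
    also have "\<dots> \<ge> 0" using y0 f0 quad by (intro mult_nonneg_nonneg) auto
    finally have "d1 * (24 * (\<rho>\<^sup>2 + C * t) * y - 30 * y\<^sup>2) * \<phi> x
       + (- 6 * (x - \<xi>) * y\<^sup>2) * (2 * d1 * \<phi>' x - a1 * \<phi> x) - y^3 * R * \<phi> x - 3 * C * y\<^sup>2 * \<phi> x + \<Lambda> * y^3 * \<phi> x - K * y^3 * \<phi> x \<ge> 0"
      using e1 e2 e3 by linarith
    then show ?thesis unfolding D using gpos[of t] by (intro mult_nonneg_nonneg) auto
  qed
  have "1 * u x T + - B x T \<ge> 0" if x: "x \<in> {0..L}" for x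
  proof (rule weak_maximum_principle[OF d1 a1' c0 cL less_imp_le[OF K(1)] supersol_add[OF sup_u[of 1] supB], of T])
    fix x assume x: "x \<in> {0..L}"
    show "0 \<le> 1 * u x 0 + - B x 0"
    proof (cases "\<bar>x - \<xi>\<bar> < \<rho>")
      case True
      have "Y x 0 \<le> \<rho>\<^sup>2" by (simp add: Y_def)
      then have "(Y x 0)^3 \<le> (\<rho>\<^sup>2)^3" using Y0 by (intro power_mono) auto
      then have "(Y x 0)^3 * \<phi> x \<le> \<rho>^6 * \<Phi>"
        using \<Phi>(2)[OF x] phi_pos[OF x] Y0[of x 0] by (intro mult_mono) (auto simp: power_mult[symmetric])
      then have "B x 0 \<le> \<delta> * (\<rho>^6 * \<Phi>)" using \<delta> by (simp add: B_def g_def)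
      also have "\<dots> = u \<xi> 0 / 2" using \<rho>(1) \<Phi>(1) by (simp add: \<delta>_def)
      finally show ?thesis using \<rho>(2)[OF x True] by simp
    next
      case False
      then have "\<rho>\<^sup>2 \<le> (x - \<xi>)\<^sup>2" using \<rho>(1) by (metis abs_le_square_iff abs_of_pos not_less)
      then have "Y x 0 = 0" by (simp add: Y_def)
      then show ?thesis using u_init(1)[OF x] by (simp add: B_def)
    qed
  next
    fix x s assume hh: "x \<in> {0<..<L} - {c}" "0 < s" "s \<le> T" "1 * u x s + - B x s < 0"
    then have x: "x \<in> {0..L}" by auto
    define R where "R = r - u x s - m * chi c L x * w x s"
    have R: "\<bar>R\<bar> \<le> K" using K(2)[OF x, of s] hh by (auto simp: R_def)
    have "(u x s - B x s) * R \<ge> (u x s - B x s) * K" using R hh by (intro mult_left_mono_neg) auto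
    moreover have "B x s \<ge> 0" using gpos[of s] Y0 phi_pos[OF x] by (simp add: B_def less_imp_le)
    then have "B x s * R \<ge> B x s * (- K)" using R by (intro mult_left_mono) auto
    moreover have "- Bt x s + d1 * Bxx x s - a1 * Bx x s - K * B x s \<ge> 0" using sub[OF x] hh by auto
    ultimately have "u x s * R + (- Bt x s + d1 * Bxx x s - a1 * Bx x s) \<ge> K * (u x s - B x s)"
      by (simp add: algebra_simps)
    then show "K * (1 * u x s + - B x s) \<le> 1 * (u x s * (r - u x s - m * chi c L x * w x s)) + (- Bt x s + d1 * Bxx x s - a1 * Bx x s)"
      by (simp add: R_def)
  qed (use x T in auto)
  moreover have "B x T \<ge> (g T * \<rho>^6) * \<phi> x" if x: "x \<in> {0..L}" for x
  proof -
    have "(x - \<xi>)\<^sup>2 \<le> L\<^sup>2" using x \<xi>(1) by (subst abs_le_square_iff[symmetric]) auto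
    moreover have "C * T \<ge> C * 1" using T by (intro mult_left_mono) (auto simp: C_def)
    ultimately have "Y x T \<ge> \<rho>\<^sup>2" by (simp add: Y_def C_def)
    then have "(Y x T)^3 \<ge> (\<rho>\<^sup>2)^3" by (intro power_mono) auto
    then have "(Y x T)^3 * \<phi> x \<ge> \<rho>^6 * \<phi> x" using phi_pos[OF x] by (intro mult_right_mono) (auto simp: power_mult[symmetric])
    then show ?thesis using gpos[of T] by (simp add: B_def mult.assoc)
  qed
  ultimately have "\<forall>x\<in>{0..L}. u x T \<ge> (g T * \<rho>^6) * \<phi> x" by force
  moreover have "g T * \<rho>^6 > 0" using gpos \<rho>(1) by simp
  ultimately show ?thesis by blast
qed

lemma u_persists:
  assumes "\<delta>0 > 0"
  shows "\<exists>\<delta> T. 0 < \<delta> \<and> \<delta> \<le> \<delta>0 \<and> (\<forall>t\<ge>T. \<forall>x\<in>{0..L}. u x t \<ge> \<delta> * \<phi> x)"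
proof -
  define e where "e = lam / (2 * m)"
  have e: "e > 0" "m * e = lam / 2" using lam m by (auto simp: e_def)
  obtain T0 where T0: "\<And>t x. t \<ge> T0 \<Longrightarrow> x \<in> {c..L} \<Longrightarrow> w x t \<le> wt x + e" using w_eventually_le[OF e(1)] by blast
  define T where "T = max T0 1"
  obtain \<mu> where \<mu>: "\<mu> > 0" "\<And>x. x \<in> {0..L} \<Longrightarrow> u x T \<ge> \<mu> * \<phi> x" using u_positive[of T] by (auto simp: T_def)
  obtain \<Phi> where \<Phi>: "\<Phi> > 0" "\<And>x. x \<in> {0..L} \<Longrightarrow> \<bar>\<phi> x\<bar> \<le> \<Phi>" using continuous_on_Icc_bounded[OF phi_cont] by blast
  define \<delta> where "\<delta> = min (min \<mu> \<delta>0) (lam / (2 * \<Phi>))"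
  have \<delta>: "\<delta> > 0" "\<delta> \<le> \<mu>" "\<delta> \<le> \<delta>0" "\<delta> \<le> lam / (2 * \<Phi>)" using \<mu> assms lam \<Phi> by (auto simp: \<delta>_def)
  have \<delta>\<phi>: "\<delta> * \<phi> x \<le> lam / 2" if "x \<in> {0..L}" for x
  proof -
    have "\<delta> * \<phi> x \<le> lam / (2 * \<Phi>) * \<Phi>" using \<Phi>(2)[OF that] phi_pos[OF that] \<delta> lam \<Phi>(1) by (intro mult_mono) auto
    then show ?thesis using \<Phi>(1) by simp
  qed
  have sup: "supersol d1 a1 0 L c T (\<lambda>x t. 1 * (u x t * (r - u x t - m * chi c L x * w x t)) + (- \<delta>) * ((r - m * chi c L x * wt x - lam) * \<phi> x))
     (\<lambda>x t. 1 * u x t + (- \<delta>) * \<phi> x)"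
    by (rule supersol_later[OF supersol_add[OF sup_u[of 1] bvp_supersol[OF phi_bvp d1]]]) (simp add: T_def)
  have "1 * u x t + (- \<delta>) * \<phi> x \<ge> 0" if x: "x \<in> {0..L}" and t: "t \<ge> T" for x t
  proof (rule weak_maximum_principle[OF d1 a1' c0 cL less_imp_le[OF r] sup, of t])
    show "0 \<le> 1 * u x T + (- \<delta>) * \<phi> x" if "x \<in> {0..L}" for x
    proof -
      have "\<delta> * \<phi> x \<le> \<mu> * \<phi> x" using phi_pos[OF that] by (intro mult_right_mono \<delta>(2)) auto
      then show ?thesis using \<mu>(2)[OF that] by simp
    qed
    fix x s assume hh: "x \<in> {0<..<L} - {c}" "T < s" "s \<le> t" "1 * u x s + (- \<delta>) * \<phi> x < 0"
    then have x: "x \<in> {0..L}" and s0: "s \<ge> 0" by (auto simp: T_def)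
    define R where "R = r - m * chi c L x * wt x"
    define z where "z = \<delta> * \<phi> x"
    define v where "v = u x s"
    have v: "0 \<le> v" "v < z" using u_nonneg[OF x s0] hh by (auto simp: v_def z_def)
    have "m * chi c L x * w x s \<le> m * chi c L x * wt x + lam / 2"
    proof (cases "x > c")
      case True
      have "w x s \<le> wt x + e" using True x hh by (intro T0) (auto simp: T_def)
      then have "m * w x s \<le> m * (wt x + e)" using m by (intro mult_left_mono) auto
      then show ?thesis using True x e(2) by (simp add: chi_def distrib_left)
    qed (use lam in \<open>auto simp: chi_def\<close>)
    then have "r - v - m * chi c L x * w x s \<ge> R - z - lam / 2" using v by (simp add: R_def)
    then have "v * (r - v - m * chi c L x * w x s) \<ge> v * (R - z - lam / 2)" using v by (intro mult_left_mono) auto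
    moreover have "z * (z + lam / 2) \<le> z * lam" using \<delta>\<phi>[OF x] v by (intro mult_left_mono) (auto simp: z_def)
    moreover have "v * (z + lam / 2) \<le> z * (z + lam / 2)" using v lam by (intro mult_right_mono) auto
    moreover have "R \<le> r" using m wt_pos[of x] x by (auto simp: R_def chi_def)
    then have "(v - z) * R \<ge> (v - z) * r" using v by (intro mult_left_mono_neg) auto
    ultimately have "v * (r - v - m * chi c L x * w x s) - z * (R - lam) \<ge> r * (v - z)"
      by (simp add: algebra_simps)
    then show "r * (1 * u x s + (- \<delta>) * \<phi> x) \<le> 1 * (u x s * (r - u x s - m * chi c L x * w x s)) + (- \<delta>) * ((r - m * chi c L x * wt x - lam) * \<phi> x)"
      by (simp add: v_def z_def R_def algebra_simps)
  qed (use x t in \<open>auto simp: T_def\<close>)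
  then show ?thesis using \<delta>(1,3) by (intro exI[of _ \<delta>] exI[of _ T]) auto
qed

end

section \<open>Convergence\<close>

locale trapped = iteration + evolution +
  assumes u_upper: "\<And>x t. x \<in> {0..L} \<Longrightarrow> t \<ge> 0 \<Longrightarrow> u x t \<le> M"
    and w_upper: "\<exists>T. \<forall>t\<ge>T. \<forall>x\<in>{c..L}. w x t \<le> b"
    and u_lower: "\<exists>T. \<forall>t\<ge>T. \<forall>x\<in>{0..L}. u x t \<ge> \<delta> * \<phi> x"
begin

definition traps where
  "traps \<sigma> U W \<longleftrightarrow> (\<forall>\<epsilon>>0. \<exists>T. \<forall>t\<ge>T. (\<forall>x\<in>{0..L}. \<sigma> * (u x t - U x) \<ge> - \<epsilon>) \<and>
     (\<forall>x\<in>{c..L}. \<sigma> * (W x - w x t) \<ge> - \<epsilon>))"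
  for \<sigma> :: real

lemma traps_step:
  assumes adm: "admissible U W" and tr: "traps \<sigma> U W"
  shows "traps \<sigma> (stepU U W) (stepW U W)"
  unfolding traps_def
proof (intro allI impI)
  fix e :: real assume e: "e > 0"
  define C where "C = (k + r + M * m) + (k + p * b)"
  have C: "C > 0" "k + r + M * m \<le> C" "k + p * b \<le> C"
    using k0 r M0 m p b0 by (auto simp: C_def add_pos_pos add_nonneg_nonneg less_imp_le)
  define \<epsilon> where "\<epsilon> = e * k / (2 * C)"
  have \<epsilon>: "\<epsilon> > 0" "C * \<epsilon> / k = e / 2" using e C k0 by (auto simp: \<epsilon>_def)
  have half: "- (C * \<epsilon> / k) - e / 2 = - e" unfolding \<epsilon>(2) by simp
  obtain T1 where T1: "\<And>t x. t \<ge> T1 \<Longrightarrow> x \<in> {0..L} \<Longrightarrow> \<sigma> * (u x t - U x) \<ge> - \<epsilon>"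
     "\<And>t x. t \<ge> T1 \<Longrightarrow> x \<in> {c..L} \<Longrightarrow> \<sigma> * (W x - w x t) \<ge> - \<epsilon>"
    using tr \<epsilon>(1) unfolding traps_def by blast
  obtain T2 where T2: "\<And>t x. t \<ge> T2 \<Longrightarrow> x \<in> {c..L} \<Longrightarrow> w x t \<le> b" using w_upper by blast
  define T where "T = max 0 (max T1 T2)"
  have T: "0 \<le> T" "T1 \<le> T" "T2 \<le> T" by (auto simp: T_def)
  have "\<exists>T'. \<forall>t\<ge>T'. \<forall>x\<in>{0..L}. \<sigma> * u x t + (- \<sigma>) * stepU U W x \<ge> - (C * \<epsilon> / k) - e / 2"
  proof (rule supersol_eventually_ge[OF d1 a1' c0 cL k0 _ _ supersol_later[OF supersol_add[OF sup_u bvp_supersol[OF stepU_bvp[OF adm] d1]] T(1)]])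
    fix x t assume hh: "x \<in> {0<..<L} - {c}" "T < t"
    then have x: "x \<in> {0..L}" by auto
    have "\<sigma> * (u x t * (k + r - u x t - m * chi c L x * w x t) - FU U W x) \<ge> - (k + r + M * m) * \<epsilon>"
    proof (rule FU_order[OF adm x])
      show "x \<in> {c<..L} \<Longrightarrow> 0 \<le> w x t \<and> w x t \<le> b \<and> \<sigma> * (W x - w x t) \<ge> - \<epsilon>"
        using w_nonneg[of x t] T1(2)[of t x] T2[of t x] hh T by auto
    qed (use u_nonneg[OF x] u_upper[OF x] T1(1)[OF _ x] hh T \<epsilon>(1) in auto)
    moreover have "(k + r + M * m) * \<epsilon> \<le> C * \<epsilon>" using C \<epsilon>(1) by (intro mult_right_mono) auto
    ultimately show "- k * (\<sigma> * u x t + (- \<sigma>) * stepU U W x) - C * \<epsilon>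
       \<le> \<sigma> * (u x t * (r - u x t - m * chi c L x * w x t)) + (- \<sigma>) * (FU U W x - k * stepU U W x)"
      by (simp add: algebra_simps)
  qed (use C \<epsilon>(1) e in auto)
  then obtain T3 where T3: "\<And>t x. t \<ge> T3 \<Longrightarrow> x \<in> {0..L} \<Longrightarrow> \<sigma> * u x t + (- \<sigma>) * stepU U W x \<ge> - e"
    unfolding half by blast
  have "\<exists>T'. \<forall>t\<ge>T'. \<forall>x\<in>{c..L}. \<sigma> * stepW U W x + (- \<sigma>) * w x t \<ge> - (C * \<epsilon> / k) - e / 2"
  proof (rule supersol_eventually_ge[OF d2 a2 order.refl cL k0 _ _ supersol_later[OF supersol_add[OF bvp_supersol[OF stepW_bvp[OF adm] d2] sup_w] T(1)]])
    fix x t assume hh: "x \<in> {c<..<L} - {c}" "T < t"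
    then have x: "x \<in> {c..L}" "x \<in> {0..L}" using c0 by auto
    have "\<sigma> * (FW U W x - (h + (k - q - p * u x t) * w x t)) \<ge> - (k + p * b) * \<epsilon>"
      by (rule FW_order[OF adm x(1)])
         (use u_nonneg[OF x(2)] u_upper[OF x(2)] T1(1)[OF _ x(2)] T1(2)[OF _ x(1)] hh T \<epsilon>(1) in auto)
    moreover have "(k + p * b) * \<epsilon> \<le> C * \<epsilon>" using C \<epsilon>(1) by (intro mult_right_mono) auto
    ultimately show "- k * (\<sigma> * stepW U W x + (- \<sigma>) * w x t) - C * \<epsilon>
       \<le> \<sigma> * (FW U W x - k * stepW U W x) + (- \<sigma>) * (h - q * w x t - p * u x t * w x t)"
      by (simp add: algebra_simps)
  qed (use C \<epsilon>(1) e in auto)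
  then obtain T4 where T4: "\<And>t x. t \<ge> T4 \<Longrightarrow> x \<in> {c..L} \<Longrightarrow> \<sigma> * stepW U W x + (- \<sigma>) * w x t \<ge> - e"
    unfolding half by blast
  show "\<exists>T. \<forall>t\<ge>T. (\<forall>x\<in>{0..L}. \<sigma> * (u x t - stepU U W x) \<ge> - e) \<and> (\<forall>x\<in>{c..L}. \<sigma> * (stepW U W x - w x t) \<ge> - e)"
    using T3 T4 by (intro exI[of _ "max T3 T4"]) (auto simp: algebra_simps)
qed

lemma traps_chain:
  assumes "admissible U0 W0" "traps \<sigma> U0 W0"
  shows "traps \<sigma> (fst (chain (U0, W0) n)) (snd (chain (U0, W0) n))"
  by (induction n) (use assms traps_step[OF chain_admissible[OF assms(1)]] in auto)

lemma traps_lower_start: "traps 1 (\<lambda>x. \<delta> * \<phi> x) wt"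
  unfolding traps_def
proof (intro allI impI)
  fix e :: real assume e: "e > 0"
  obtain T1 where T1: "\<And>t x. t \<ge> T1 \<Longrightarrow> x \<in> {0..L} \<Longrightarrow> u x t \<ge> \<delta> * \<phi> x" using u_lower by blast
  obtain T2 where T2: "\<And>t x. t \<ge> T2 \<Longrightarrow> x \<in> {c..L} \<Longrightarrow> w x t \<le> wt x + e" using w_eventually_le[OF e] by blast
  show "\<exists>T. \<forall>t\<ge>T. (\<forall>x\<in>{0..L}. 1 * (u x t - \<delta> * \<phi> x) \<ge> - e) \<and> (\<forall>x\<in>{c..L}. 1 * (wt x - w x t) \<ge> - e)"
  proof (intro exI[of _ "max T1 T2"] allI impI conjI ballI)
    fix t assume t: "t \<ge> max T1 T2"
    show "1 * (u x t - \<delta> * \<phi> x) \<ge> - e" if "x \<in> {0..L}" for x using T1[of t x] t that e by auto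
    show "1 * (wt x - w x t) \<ge> - e" if "x \<in> {c..L}" for x using T2[of t x] t that e by auto
  qed
qed

lemma traps_upper_start: "traps (- 1) (\<lambda>x. M) (\<lambda>x. 0)"
  unfolding traps_def
proof (intro allI impI exI[of _ 0] conjI ballI)
  fix e t x :: real assume e: "e > 0" and t: "t \<ge> 0"
  show "(- 1) * (u x t - M) \<ge> - e" if "x \<in> {0..L}" using u_upper[OF that t] e by simp
  show "(- 1) * (0 - w x t) \<ge> - e" if "x \<in> {c..L}" using w_nonneg[OF that t] e by simp
qed

lemma converges:
  assumes UW: "coexistence U W"
    and unique: "\<And>U' W'. coexistence U' W' \<Longrightarrow> (\<forall>x\<in>{0..L}. U' x = U x) \<and> (\<forall>x\<in>{c..L}. W' x = W x)"
    and \<epsilon>: "\<epsilon> > 0"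
  shows "\<exists>T. \<forall>t\<ge>T. (\<forall>x\<in>{0..L}. \<bar>u x t - U x\<bar> < \<epsilon>) \<and> (\<forall>x\<in>{c..L}. \<bar>w x t - W x\<bar> < \<epsilon>)"
proof -
  have one_sided: "\<exists>T. \<forall>t\<ge>T. (\<forall>x\<in>{0..L}. \<sigma> * (u x t - U x) > - \<epsilon>) \<and> (\<forall>x\<in>{c..L}. \<sigma> * (W x - w x t) > - \<epsilon>)"
    if \<sigma>: "\<sigma> = 1 \<or> \<sigma> = - 1" and adm: "admissible U0 W0"
      and start: "\<And>x. x \<in> {0..L} \<Longrightarrow> \<sigma> * (stepU U0 W0 x - U0 x) \<ge> 0" "\<And>x. x \<in> {c..L} \<Longrightarrow> \<sigma> * (W0 x - stepW U0 W0 x) \<ge> 0"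
      and tr: "traps \<sigma> U0 W0" for \<sigma> U0 W0
  proof -
    obtain U' W' where U': "coexistence U' W'"
      and lim: "\<And>\<epsilon>. \<epsilon> > 0 \<Longrightarrow> \<exists>n. (\<forall>x\<in>{0..L}. \<bar>fst (chain (U0, W0) n) x - U' x\<bar> < \<epsilon>) \<and> (\<forall>x\<in>{c..L}. \<bar>snd (chain (U0, W0) n) x - W' x\<bar> < \<epsilon>)"
      using chain_limit[OF adm \<sigma> start] by blast
    have eq: "U' x = U x" if "x \<in> {0..L}" for x using unique[OF U'] that by blast
    have eq': "W' x = W x" if "x \<in> {c..L}" for x using unique[OF U'] that by blast
    have e2: "\<epsilon> / 2 > 0" using \<epsilon> by simp
    obtain n where n': "\<forall>x\<in>{0..L}. \<bar>fst (chain (U0, W0) n) x - U' x\<bar> < \<epsilon> / 2" "\<forall>x\<in>{c..L}. \<bar>snd (chain (U0, W0) n) x - W' x\<bar> < \<epsilon> / 2"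
      using lim[OF e2] by blast
    have n: "\<bar>fst (chain (U0, W0) n) x - U x\<bar> < \<epsilon> / 2" if "x \<in> {0..L}" for x using n'(1)[rule_format, OF that] unfolding eq[OF that] .
    have nW: "\<bar>snd (chain (U0, W0) n) x - W x\<bar> < \<epsilon> / 2" if "x \<in> {c..L}" for x using n'(2)[rule_format, OF that] unfolding eq'[OF that] .
    obtain T where T: "\<And>t x. t \<ge> T \<Longrightarrow> x \<in> {0..L} \<Longrightarrow> \<sigma> * (u x t - fst (chain (U0, W0) n) x) \<ge> - (\<epsilon> / 2)"
      "\<And>t x. t \<ge> T \<Longrightarrow> x \<in> {c..L} \<Longrightarrow> \<sigma> * (snd (chain (U0, W0) n) x - w x t) \<ge> - (\<epsilon> / 2)"
      using traps_chain[OF adm tr, of n] e2 unfolding traps_def by blast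
    show ?thesis
    proof (intro exI[of _ T] allI impI conjI ballI)
      fix t x assume t: "t \<ge> T"
      show "\<sigma> * (u x t - U x) > - \<epsilon>" if "x \<in> {0..L}" using \<sigma>
      proof
        assume s: "\<sigma> = 1" show ?thesis using T(1)[OF t that] n[OF that] unfolding s abs_less_iff mult_minus1 mult_1_left by linarith
      next
        assume s: "\<sigma> = - 1" show ?thesis using T(1)[OF t that] n[OF that] unfolding s abs_less_iff mult_minus1 mult_1_left by linarith
      qed
      show "\<sigma> * (W x - w x t) > - \<epsilon>" if "x \<in> {c..L}" using \<sigma>
      proof
        assume s: "\<sigma> = 1" show ?thesis using T(2)[OF t that] nW[OF that] unfolding s abs_less_iff mult_minus1 mult_1_left by linarith
      next
        assume s: "\<sigma> = - 1" show ?thesis using T(2)[OF t that] nW[OF that] unfolding s abs_less_iff mult_minus1 mult_1_left by linarith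
      qed
    qed
  qed
  obtain T1 where T1: "\<And>t x. t \<ge> T1 \<Longrightarrow> x \<in> {0..L} \<Longrightarrow> 1 * (u x t - U x) > - \<epsilon>" "\<And>t x. t \<ge> T1 \<Longrightarrow> x \<in> {c..L} \<Longrightarrow> 1 * (W x - w x t) > - \<epsilon>"
    using one_sided[OF disjI1[OF refl] lower_start traps_lower_start] by blast
  obtain T2 where T2: "\<And>t x. t \<ge> T2 \<Longrightarrow> x \<in> {0..L} \<Longrightarrow> (- 1) * (u x t - U x) > - \<epsilon>" "\<And>t x. t \<ge> T2 \<Longrightarrow> x \<in> {c..L} \<Longrightarrow> (- 1) * (W x - w x t) > - \<epsilon>"
    using one_sided[OF disjI2[OF refl] upper_start traps_upper_start] by blast
  show ?thesis
  proof (intro exI[of _ "max T1 T2"] allI impI conjI ballI)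
    fix t x assume t: "t \<ge> max T1 T2"
    show "\<bar>u x t - U x\<bar> < \<epsilon>" if "x \<in> {0..L}" using T1(1)[OF _ that, of t] T2(1)[OF _ that, of t] t by auto
    show "\<bar>w x t - W x\<bar> < \<epsilon>" if "x \<in> {c..L}" using T1(2)[OF _ that, of t] T2(2)[OF _ that, of t] t by auto
  qed
qed

end

lemma coexistence_steady_state_imp_coex:
  assumes ss: "coexistence_steady_state d1 d2 a1 a2 r m p q h L c U W" and d: "d1 > 0" "d2 > 0"
  shows "coex d1 d2 a1 a2 r m p q h L c U W"
proof -
  have us: "u_solution d1 a1 r m L c (\<lambda>x t. U x) (\<lambda>x t. W x)"
    and ws: "w_solution d2 a2 p q h L c (\<lambda>x t. U x) (\<lambda>x t. W x)"
    and pos: "\<forall>x\<in>{0..L}. U x > 0" "\<forall>x\<in>{c..L}. W x > 0"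
    using ss by (auto simp: coexistence_steady_state_def is_solution_def)
  have slice: "continuous_on {A..B} (\<lambda>x. f x 1)" if "continuous_on ({A..B} \<times> {0<..}) (\<lambda>(x, t). f x t)"
    for f :: "real \<Rightarrow> real \<Rightarrow> real" and A B
  proof -
    have "continuous_on {A..B} (\<lambda>x. (\<lambda>(x, t). f x t) (x, 1))"
      by (rule continuous_on_compose2[OF that]) (auto intro!: continuous_intros)
    then show ?thesis by simp
  qed
  obtain ux uxx ut where U: "continuous_on ({0..L} \<times> {0<..}) (\<lambda>(x, t). ux x t)"
     "\<forall>t>0. \<forall>x\<in>{0..L}. (U has_real_derivative ux x t) (at x within {0..L})"
     "\<forall>t>0. \<forall>x\<in>{0<..<L} - {c}. ((\<lambda>y. ux y t) has_real_derivative uxx x t) (at x) \<and>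
            ((\<lambda>s. U x) has_real_derivative ut x t) (at t) \<and>
            ut x t = d1 * uxx x t - a1 * ux x t + U x * (r - U x - m * chi c L x * W x)"
     "\<forall>t>0. d1 * ux 0 t - a1 * U 0 = 0 \<and> ux L t = 0"
    using us unfolding u_solution_def by blast
  have "bvp d1 a1 0 L c (\<lambda>x. U x * (r - U x - m * chi c L x * W x)) U"
    unfolding bvp_def
  proof (intro exI[of _ "\<lambda>x. ux x 1"] conjI ballI)
    fix x assume x: "x \<in> {0<..<L} - {c}"
    have e: "((\<lambda>y. ux y 1) has_real_derivative uxx x 1) (at x)" "((\<lambda>s. U x) has_real_derivative ut x 1) (at 1)"
      "ut x 1 = d1 * uxx x 1 - a1 * ux x 1 + U x * (r - U x - m * chi c L x * W x)" using U(3)[rule_format, OF zero_less_one x] by blast+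
    have "ut x 1 = 0" using DERIV_unique[OF e(2) DERIV_const] .
    then have "uxx x 1 = (a1 * ux x 1 - U x * (r - U x - m * chi c L x * W x)) / d1" using e(3) d by (simp add: field_simps)
    then show "((\<lambda>y. ux y 1) has_real_derivative (a1 * ux x 1 - U x * (r - U x - m * chi c L x * W x)) / d1) (at x)" using e(1) by simp
  qed (use U slice[OF U(1)] in auto)
  moreover obtain wx wxx wt where V: "continuous_on ({c..L} \<times> {0<..}) (\<lambda>(x, t). wx x t)"
     "\<forall>t>0. \<forall>x\<in>{c..L}. (W has_real_derivative wx x t) (at x within {c..L})"
     "\<forall>t>0. \<forall>x\<in>{c<..<L}. ((\<lambda>y. wx y t) has_real_derivative wxx x t) (at x) \<and>
            ((\<lambda>s. W x) has_real_derivative wt x t) (at t) \<and>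
            wt x t = d2 * wxx x t - a2 * wx x t + h - q * W x - p * U x * W x"
     "\<forall>t>0. d2 * wx c t - a2 * W c = 0 \<and> wx L t = 0"
    using ws unfolding w_solution_def by blast
  have "bvp d2 a2 c L c (\<lambda>x. h - q * W x - p * U x * W x) W"
    unfolding bvp_def
  proof (intro exI[of _ "\<lambda>x. wx x 1"] conjI ballI)
    fix x assume x: "x \<in> {c<..<L} - {c}"
    have e: "((\<lambda>y. wx y 1) has_real_derivative wxx x 1) (at x)" "((\<lambda>s. W x) has_real_derivative wt x 1) (at 1)"
      "wt x 1 = d2 * wxx x 1 - a2 * wx x 1 + h - q * W x - p * U x * W x" using V(3)[rule_format, OF zero_less_one, of x] x by blast+
    have "wt x 1 = 0" using DERIV_unique[OF e(2) DERIV_const] .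
    then have "wxx x 1 = (a2 * wx x 1 - (h - q * W x - p * U x * W x)) / d2" using e(3) d by (simp add: field_simps)
    then show "((\<lambda>y. wx y 1) has_real_derivative (a2 * wx x 1 - (h - q * W x - p * U x * W x)) / d2) (at x)" using e(1) by simp
  qed (use V slice[OF V(1)] in auto)
  ultimately show ?thesis using pos by (simp add: coex_def)
qed

lemma coex_imp_coexistence_steady_state:
  assumes co: "coex d1 d2 a1 a2 r m p q h L c U W" and d: "d1 > 0" "d2 > 0" and c: "0 \<le> c" "c < L"
  shows "coexistence_steady_state d1 d2 a1 a2 r m p q h L c U W"
proof -
  have bU: "bvp d1 a1 0 L c (\<lambda>x. U x * (r - U x - m * chi c L x * W x)) U"
    and bW: "bvp d2 a2 c L c (\<lambda>x. h - q * W x - p * U x * W x) W"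
    and pos: "\<forall>x\<in>{0..L}. U x > 0" "\<forall>x\<in>{c..L}. W x > 0" using co by (auto simp: coex_def)
  note cU = bvp_continuous[OF bU] and cW = bvp_continuous[OF bW]
  have lift: "continuous_on (X \<times> Y) (\<lambda>(x, t). f x)" if "continuous_on X f" for X Y :: "real set" and f :: "real \<Rightarrow> real"
    unfolding case_prod_beta by (rule continuous_on_compose2[OF that]) (auto intro!: continuous_intros)
  obtain U' where U': "\<forall>x\<in>{0..L}. (U has_real_derivative U' x) (at x within {0..L})" "continuous_on {0..L} U'"
     "\<forall>x\<in>{0<..<L} - {c}. (U' has_real_derivative (a1 * U' x - U x * (r - U x - m * chi c L x * W x)) / d1) (at x)"
     "d1 * U' 0 = a1 * U 0" "U' L = 0"
    using bU unfolding bvp_def by blast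
  obtain W' where W': "\<forall>x\<in>{c..L}. (W has_real_derivative W' x) (at x within {c..L})" "continuous_on {c..L} W'"
     "\<forall>x\<in>{c<..<L} - {c}. (W' has_real_derivative (a2 * W' x - (h - q * W x - p * U x * W x)) / d2) (at x)"
     "d2 * W' c = a2 * W c" "W' L = 0"
    using bW unfolding bvp_def by blast
  have cU2: "continuous_on ({0<..<L} - {c}) (\<lambda>x. (a1 * U' x - U x * (r - U x - m * chi c L x * W x)) / d1)"
  proof -
    have "pc 0 L c (\<lambda>x. (a1 * U' x - U x * (r - U x - m * (chi c L x * W x))) * (1 / d1))"
      using c by (intro pc_diff pc_mult pc_chi pc_continuous_on continuous_intros cU cW U'(2)) auto
    from pc_isCont[OF this] show ?thesis by (intro continuous_at_imp_continuous_on ballI) (simp add: mult.assoc)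
  qed
  have subU: "continuous_on {c..L} U" by (rule continuous_on_subset[OF cU]) (use c in auto)
  have cW2: "continuous_on {c<..<L} (\<lambda>x. (a2 * W' x - (h - q * W x - p * U x * W x)) / d2)"
  proof (rule continuous_on_subset)
    show "continuous_on {c..L} (\<lambda>x. (a2 * W' x - (h - q * W x - p * U x * W x)) / d2)"
      using d by (intro continuous_intros cW subU W'(2)) auto
  qed auto
  have "u_solution d1 a1 r m L c (\<lambda>x t. U x) (\<lambda>x t. W x)"
    unfolding u_solution_def
  proof (rule conjI[OF lift[OF cU]], rule exI[of _ "\<lambda>x t. U' x"],
      rule exI[of _ "\<lambda>x t. (a1 * U' x - U x * (r - U x - m * chi c L x * W x)) / d1"], rule exI[of _ "\<lambda>x t. 0"],
      intro conjI lift[OF cU2] lift[OF U'(2)] lift[OF continuous_on_const] allI impI ballI)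
    fix t x :: real assume x: "x \<in> {0<..<L} - {c}"
    show "(U' has_real_derivative (a1 * U' x - U x * (r - U x - m * chi c L x * W x)) / d1) (at x)" using U'(3) x by blast
    show "0 = d1 * ((a1 * U' x - U x * (r - U x - m * chi c L x * W x)) / d1) - a1 * U' x + U x * (r - U x - m * chi c L x * W x)"
      using d by simp
  qed (use U' in auto)
  moreover have "w_solution d2 a2 p q h L c (\<lambda>x t. U x) (\<lambda>x t. W x)"
    unfolding w_solution_def
  proof (rule conjI[OF lift[OF cW]], rule exI[of _ "\<lambda>x t. W' x"],
      rule exI[of _ "\<lambda>x t. (a2 * W' x - (h - q * W x - p * U x * W x)) / d2"], rule exI[of _ "\<lambda>x t. 0"],
      intro conjI lift[OF cW2] lift[OF W'(2)] lift[OF continuous_on_const] allI impI ballI)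
    fix t x :: real assume x: "x \<in> {c<..<L}"
    show "(W' has_real_derivative (a2 * W' x - (h - q * W x - p * U x * W x)) / d2) (at x)" using W'(3) x by auto
    show "0 = d2 * ((a2 * W' x - (h - q * W x - p * U x * W x)) / d2) - a2 * W' x + h - q * W x - p * U x * W x"
      using d by simp
  qed (use W' in auto)
  ultimately show ?thesis using pos by (simp add: coexistence_steady_state_def is_solution_def)
qed

context persistent_system
begin

lemma iteration_exists:
  assumes "\<delta> > 0" "\<And>x. x \<in> {0..L} \<Longrightarrow> \<delta> * \<phi> x \<le> lam" "\<And>x. x \<in> {0..L} \<Longrightarrow> \<delta> * \<phi> x \<le> M" "r \<le> M"
    and "\<And>x. x \<in> {c..L} \<Longrightarrow> wt x \<le> b"
  shows "\<exists>k P1 P1' Q1 Q1' \<omega>1 P2 P2' Q2 Q2' \<omega>2.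
    iteration d1 d2 a1 a2 r m p q h L c lam \<phi> \<delta> M b k P1 P1' Q1 Q1' \<omega>1 P2 P2' Q2 Q2' \<omega>2"
proof -
  define k where "k = (2 * M + m * b) + (q + p * M)"
  have M0: "M > 0" using assms(4) r by simp
  have b0: "b > 0" using assms(5)[of c] wt_pos[of c] cL by force
  have k: "2 * M + m * b \<le> k" "q + p * M \<le> k" "k > 0"
    using M0 b0 m p q by (auto simp: k_def add_pos_pos add_nonneg_nonneg less_imp_le)
  obtain P1 P1' Q1 Q1' \<omega>1 where 1: "fundamental_pair d1 a1 k 0 L P1 P1' Q1 Q1' \<omega>1"
    using fundamental_pair_exists[OF d1 a1' k(3) L0] by blast
  obtain P2 P2' Q2 Q2' \<omega>2 where 2: "fundamental_pair d2 a2 k c L P2 P2' Q2 Q2' \<omega>2"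
    using fundamental_pair_exists[OF d2 a2 k(3) cL] by blast
  have "iteration d1 d2 a1 a2 r m p q h L c lam \<phi> \<delta> M b k P1 P1' Q1 Q1' \<omega>1 P2 P2' Q2 Q2' \<omega>2"
    by unfold_locales (use assms k 1 2 in auto)
  then show ?thesis by blast
qed

lemma small_multiple:
  obtains \<delta>0 where "\<delta>0 > 0" "\<And>\<delta> x. 0 < \<delta> \<Longrightarrow> \<delta> \<le> \<delta>0 \<Longrightarrow> x \<in> {0..L} \<Longrightarrow> \<delta> * \<phi> x \<le> lam \<and> \<delta> * \<phi> x \<le> r"
proof -
  obtain \<Phi> where \<Phi>: "\<Phi> > 0" "\<And>x. x \<in> {0..L} \<Longrightarrow> \<bar>\<phi> x\<bar> \<le> \<Phi>" using continuous_on_Icc_bounded[OF phi_cont] by blast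
  show thesis
  proof (rule that[of "min lam r / \<Phi>"])
    show "min lam r / \<Phi> > 0" using lam r \<Phi> by simp
    fix \<delta> x assume h: "0 < \<delta>" "\<delta> \<le> min lam r / \<Phi>" "x \<in> {0..L}"
    have "\<delta> * \<phi> x \<le> min lam r / \<Phi> * \<Phi>"
      using h \<Phi>(1) \<Phi>(2)[OF h(3)] phi_pos[OF h(3)] lam r by (intro mult_mono) auto
    then show "\<delta> * \<phi> x \<le> lam \<and> \<delta> * \<phi> x \<le> r" using \<Phi>(1) by simp
  qed
qed

lemma unique_globally_stable_coexistence:
  assumes mp: "m \<le> exp (- \<bar>a1 / d1 - a2 / d2\<bar> * L) / p" and w2: "(w_tilde d2 a2 h q L c L)\<^sup>2 \<le> h"
  shows "\<exists>U W. coexistence_steady_state d1 d2 a1 a2 r m p q h L c U W \<and>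
              (\<forall>U' W'. coexistence_steady_state d1 d2 a1 a2 r m p q h L c U' W' \<longrightarrow>
                  (\<forall>x\<in>{0..L}. U' x = U x) \<and> (\<forall>x\<in>{c..L}. W' x = W x)) \<and>
              globally_asymptotically_stable d1 d2 a1 a2 r m p q h L c U W"
proof -
  obtain \<delta>0 where \<delta>0: "\<delta>0 > 0" "\<And>\<delta> x. 0 < \<delta> \<Longrightarrow> \<delta> \<le> \<delta>0 \<Longrightarrow> x \<in> {0..L} \<Longrightarrow> \<delta> * \<phi> x \<le> lam \<and> \<delta> * \<phi> x \<le> r"
    by (rule small_multiple, rule that)
  obtain b0 where b0: "b0 > 0" "\<And>x. x \<in> {c..L} \<Longrightarrow> \<bar>wt x\<bar> \<le> b0" using continuous_on_Icc_bounded[OF wt_cont] by blast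
  define b where "b = b0 + 1"
  have b: "wt x + 1 \<le> b" if "x \<in> {c..L}" for x using b0(2)[OF that] by (simp add: b_def)
  have bb: "wt x \<le> b" if "x \<in> {c..L}" for x using b[OF that] by simp
  have unique: "(\<forall>x\<in>{0..L}. U' x = U x) \<and> (\<forall>x\<in>{c..L}. W' x = W x)" if "coexistence U W" "coexistence U' W'" for U W U' W'
  proof -
    note 1 = that(1)[unfolded coex_def] and 2 = that(2)[unfolded coex_def]
    note U = coexistence_unique[OF d1 d2 m p q h a2 c0 cL mp w2 2[THEN conjunct1] 1[THEN conjunct1]
        2[THEN conjunct2, THEN conjunct1] 1[THEN conjunct2, THEN conjunct1]]
    show ?thesis by (intro conjI U) (use 1 2 in blast)+
  qed
  obtain U W where UW: "coexistence U W"
  proof -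
    have \<delta>0': "\<delta>0 * \<phi> x \<le> lam" "\<delta>0 * \<phi> x \<le> r" if "x \<in> {0..L}" for x
      using \<delta>0(2)[OF \<delta>0(1) order.refl that] by auto
    obtain k P1 P1' Q1 Q1' \<omega>1 P2 P2' Q2 Q2' \<omega>2 where
      "iteration d1 d2 a1 a2 r m p q h L c lam \<phi> \<delta>0 r b k P1 P1' Q1 Q1' \<omega>1 P2 P2' Q2 Q2' \<omega>2"
      using iteration_exists[OF \<delta>0(1) \<delta>0' order.refl bb] by blast
    then interpret iteration d1 d2 a1 a2 r m p q h L c lam \<phi> \<delta>0 r b k P1 P1' Q1 Q1' \<omega>1 P2 P2' Q2 Q2' \<omega>2 .
    show thesis using chain_limit[OF lower_start(1) _ lower_start(2,3)] that by blast
  qed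
  have "globally_asymptotically_stable d1 d2 a1 a2 r m p q h L c U W"
    unfolding globally_asymptotically_stable_def
  proof (intro allI impI)
    fix u w and \<epsilon> :: real
    assume A: "is_solution d1 d2 a1 a2 r m p q h L c u w \<and> (\<forall>x\<in>{0..L}. u x 0 \<ge> 0) \<and> (\<exists>x\<in>{0..L}. u x 0 \<noteq> 0) \<and>
            (\<forall>x\<in>{c..L}. w x 0 \<ge> 0) \<and> (\<exists>x\<in>{c..L}. w x 0 \<noteq> 0)" and \<epsilon>: "\<epsilon> > 0"
    interpret E: evolution d1 d2 a1 a2 r m p q h L c lam \<phi> u w
      by unfold_locales (use A in auto)
    obtain K where K: "K > 0" "\<And>x t. x \<in> {0..L} \<Longrightarrow> t \<in> {0..0} \<Longrightarrow> \<bar>u x t\<bar> \<le> K"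
      by (rule bounded_on_strip[OF E.cont_u], rule that)
    define M where "M = max r K"
    have M: "r \<le> M" "\<And>x. x \<in> {0..L} \<Longrightarrow> u x 0 \<le> M" using K(2)[of _ 0] by (force simp: M_def)+
    obtain \<delta> T where \<delta>: "0 < \<delta>" "\<delta> \<le> \<delta>0" "\<forall>t\<ge>T. \<forall>x\<in>{0..L}. u x t \<ge> \<delta> * \<phi> x"
      using E.u_persists[OF \<delta>0(1)] by blast
    have \<delta>': "\<delta> * \<phi> x \<le> lam" "\<delta> * \<phi> x \<le> M" if "x \<in> {0..L}" for x using \<delta>0(2)[OF \<delta>(1,2) that] M(1) by auto
    obtain k P1 P1' Q1 Q1' \<omega>1 P2 P2' Q2 Q2' \<omega>2 where
      it: "iteration d1 d2 a1 a2 r m p q h L c lam \<phi> \<delta> M b k P1 P1' Q1 Q1' \<omega>1 P2 P2' Q2 Q2' \<omega>2"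
      using iteration_exists[OF \<delta>(1) \<delta>' M(1) bb] by blast
    interpret I: iteration d1 d2 a1 a2 r m p q h L c lam \<phi> \<delta> M b k P1 P1' Q1 Q1' \<omega>1 P2 P2' Q2 Q2' \<omega>2 by (rule it)
    interpret trapped d1 d2 a1 a2 r m p q h L c lam \<phi> \<delta> M b k P1 P1' Q1 Q1' \<omega>1 P2 P2' Q2 Q2' \<omega>2 u w
    proof unfold_locales
      show "u x t \<le> M" if "x \<in> {0..L}" "t \<ge> 0" for x t by (rule E.u_le[OF M that])
      obtain T' where T': "\<And>t x. t \<ge> T' \<Longrightarrow> x \<in> {c..L} \<Longrightarrow> w x t \<le> wt x + 1" using E.w_eventually_le[OF zero_less_one] by blast
      show "\<exists>T. \<forall>t\<ge>T. \<forall>x\<in>{c..L}. w x t \<le> b"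
        by (intro exI[of _ T'] allI impI ballI order_trans[OF T' b])
      show "\<exists>T. \<forall>t\<ge>T. \<forall>x\<in>{0..L}. u x t \<ge> \<delta> * \<phi> x" using \<delta>(3) by blast
    qed
    show "\<exists>T. \<forall>t\<ge>T. (\<forall>x\<in>{0..L}. \<bar>u x t - U x\<bar> < \<epsilon>) \<and> (\<forall>x\<in>{c..L}. \<bar>w x t - W x\<bar> < \<epsilon>)"
      by (rule converges[OF UW unique[OF UW] \<epsilon>])
  qed
  moreover have "coexistence_steady_state d1 d2 a1 a2 r m p q h L c U W"
    by (rule coex_imp_coexistence_steady_state[OF UW d1 d2 c0 cL])
  moreover have "(\<forall>x\<in>{0..L}. U' x = U x) \<and> (\<forall>x\<in>{c..L}. W' x = W x)"
    if "coexistence_steady_state d1 d2 a1 a2 r m p q h L c U' W'" for U' W'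
    by (rule unique[OF UW coexistence_steady_state_imp_coex[OF that d1 d2]])
  ultimately show ?thesis by blast
qed

end

lemma potential_pc:
  assumes "0 \<le> c" "c < L" "continuous_on {c..L} w"
  shows "pc 0 L c (\<lambda>x. r - m * chi c L x * w x)"
proof -
  have "pc 0 L c (\<lambda>x. r - m * (chi c L x * w x))"
    using assms by (intro pc_diff pc_mult pc_chi pc_continuous_on continuous_intros) auto
  then show ?thesis by (simp add: mult.assoc)
qed

lemma m_star_eigenpair:
  assumes "d1 > 0" "d2 > 0" "r > 0" "q > 0" "h > 0" "a1 > 0" "a2 \<ge> 0" "0 \<le> c" "c < L"
    and "a1 < sqrt (4 * d1 * r)" "L > L1_star d1 a1 r" "c < L_star d1 a1 r"
  shows "\<exists>\<phi>. eigenpair d1 a1 (\<lambda>x. r - m_star d1 d2 a1 a2 r q h L c * chi c L x * w_tilde d2 a2 h q L c x) L c 0 \<phi>"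
proof -
  define wt where "wt = w_tilde d2 a2 h q L c"
  have L0: "L > 0" using assms by simp
  have wpos: "wt x > 0" if "x \<in> {c..L}" for x
    using w_tilde_props(1)[OF assms(2,7,5,4,9) that] by (simp add: wt_def)
  have wcont: "continuous_on {c..L} wt"
    using bvp_continuous[OF w_tilde_props(2)[OF assms(2,7,5,4,9)]] by (simp add: wt_def)
  obtain m0 \<phi>0 where m0: "m0 > 0" "eigenpair d1 a1 (\<lambda>x. r - m0 * chi c L x * wt x) L c 0 \<phi>0"
    using critical_coefficient_exists[OF assms(1,6,3,10,8,9,11,12) wcont wpos] by blast
  have l1: "lambda1 d1 a1 (\<lambda>x. r - m * chi c L x * wt x) 0 L = lam" if "eigenpair d1 a1 (\<lambda>x. r - m * chi c L x * wt x) L c lam \<phi>" for m lam \<phi>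
    by (rule lambda1_eq[OF eigenpair_principal[OF that assms(1)] assms(1) L0])
  have strict: "lam1 > lam2" if "m1 < m2" "eigenpair d1 a1 (\<lambda>x. r - m1 * chi c L x * wt x) L c lam1 \<phi>1"
     "eigenpair d1 a1 (\<lambda>x. r - m2 * chi c L x * wt x) L c lam2 \<phi>2" for m1 m2 lam1 lam2 \<phi>1 \<phi>2
  proof (rule eigenpair_strict_mono[OF that(2,3) assms(1)])
    show "r - m2 * chi c L x * wt x \<le> r - m1 * chi c L x * wt x" if "x \<in> {0<..<L}" for x
      using wpos[of x] that \<open>m1 < m2\<close> by (auto simp: chi_def intro: mult_right_mono)
    show "(c + L) / 2 \<in> {0<..<L} - {c}" using assms by auto
    show "r - m2 * chi c L ((c + L) / 2) * wt ((c + L) / 2) < r - m1 * chi c L ((c + L) / 2) * wt ((c + L) / 2)"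
      using wpos[of "(c + L) / 2"] assms \<open>m1 < m2\<close> by (simp add: chi_def)
  qed
  have "m_star d1 d2 a1 a2 r q h L c = m0"
    unfolding m_star_def wt_def[symmetric]
  proof (rule the_equality)
    show "0 < m0 \<and> lambda1 d1 a1 (\<lambda>x. r - m0 * chi c L x * wt x) 0 L = 0" using m0 l1 by blast
    fix m assume m: "0 < m \<and> lambda1 d1 a1 (\<lambda>x. r - m * chi c L x * wt x) 0 L = 0"
    obtain lam \<phi> where e: "eigenpair d1 a1 (\<lambda>x. r - m * chi c L x * wt x) L c lam \<phi>"
      using eigenpair_exists[OF assms(1) less_imp_le[OF assms(6)] L0 assms(8) less_imp_le[OF assms(9)] potential_pc[OF assms(8,9) wcont]] by blast
    then have "lam = 0" using m l1[OF e] by simp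
    then show "m = m0" using strict[OF _ e m0(2)] strict[OF _ m0(2) e] by (cases m m0 rule: linorder_cases) auto
  qed
  then show ?thesis using m0 by (auto simp: wt_def)
qed

theorem theorem2p4:
  fixes d1 d2 a1 a2 r m p q h L x1 :: real
  assumes "d1 > 0" "d2 > 0" "r > 0" "m > 0" "p > 0" "q > 0" "h > 0" "L > 0"
    and "a1 > 0" "a2 \<ge> 0" "0 \<le> x1" "x1 < L"
    and "a1 < sqrt (4 * d1 * r)"
    and "L > L1_star d1 a1 r"
  shows
    "(x1 \<ge> L_star d1 a1 r \<and>
      m \<le> exp (- \<bar>a1 / d1 - a2 / d2\<bar> * L) / p \<and>
      (w_tilde d2 a2 h q L x1 L)^2 \<le> h
      \<longrightarrow> (\<exists>U W. coexistence_steady_state d1 d2 a1 a2 r m p q h L x1 U W \<and>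
              (\<forall>U' W'. coexistence_steady_state d1 d2 a1 a2 r m p q h L x1 U' W' \<longrightarrow>
                  (\<forall>x\<in>{0..L}. U' x = U x) \<and> (\<forall>x\<in>{x1..L}. W' x = W x)) \<and>
              globally_asymptotically_stable d1 d2 a1 a2 r m p q h L x1 U W))
   \<and>
     (x1 < L_star d1 a1 r \<and>
      m < min (m_star d1 d2 a1 a2 r q h L x1) (exp (- \<bar>a1 / d1 - a2 / d2\<bar> * L) / p) \<and>
      (w_tilde d2 a2 h q L x1 L)^2 \<le> h
      \<longrightarrow> (\<exists>U W. coexistence_steady_state d1 d2 a1 a2 r m p q h L x1 U W \<and>
              (\<forall>U' W'. coexistence_steady_state d1 d2 a1 a2 r m p q h L x1 U' W' \<longrightarrow>
                  (\<forall>x\<in>{0..L}. U' x = U x) \<and> (\<forall>x\<in>{x1..L}. W' x = W x)) \<and>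
              globally_asymptotically_stable d1 d2 a1 a2 r m p q h L x1 U W))"
proof -
  let ?wt = "w_tilde d2 a2 h q L x1"
  have wpos: "?wt x > 0" if "x \<in> {x1..L}" for x
    by (rule w_tilde_props(1)[OF assms(2,10,7,6,12) that])
  have wcont: "continuous_on {x1..L} ?wt"
    by (rule bvp_continuous[OF w_tilde_props(2)[OF assms(2,10,7,6,12)]])
  obtain lam \<phi> where e: "eigenpair d1 a1 (\<lambda>x. r - m * chi x1 L x * ?wt x) L x1 lam \<phi>"
    using eigenpair_exists[OF assms(1) less_imp_le[OF assms(9)] assms(8,11) less_imp_le[OF assms(12)] potential_pc[OF assms(11,12) wcont]] by blast
  have persistent: "persistent_system d1 d2 a1 a2 r m p q h L x1 lam \<phi>" if "lam > 0"
    by unfold_locales (use assms e that in auto)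
  note stable = persistent_system.unique_globally_stable_coexistence[OF persistent]
  have "lam > 0" if "x1 \<ge> L_star d1 a1 r"
    by (rule eigenvalue_pos_large_zone[OF assms(1,9,3,13) e that assms(12)]) (simp add: chi_def)
  moreover have "lam > 0" if z: "x1 < L_star d1 a1 r" "m < m_star d1 d2 a1 a2 r q h L x1"
  proof -
    obtain \<psi> where \<psi>: "eigenpair d1 a1 (\<lambda>x. r - m_star d1 d2 a1 a2 r q h L x1 * chi x1 L x * ?wt x) L x1 0 \<psi>"
      using m_star_eigenpair[OF assms(1,2,3,6,7,9,10,11,12,13,14) z(1)] by blast
    show "lam > 0"
    proof (rule eigenpair_strict_mono[OF e \<psi> assms(1)])
      show "r - m_star d1 d2 a1 a2 r q h L x1 * chi x1 L x * ?wt x \<le> r - m * chi x1 L x * ?wt x" if "x \<in> {0<..<L}" for x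
        using wpos[of x] that \<open>m < _\<close> by (auto simp: chi_def intro: mult_right_mono)
      show "(x1 + L) / 2 \<in> {0<..<L} - {x1}" using assms by auto
      show "r - m_star d1 d2 a1 a2 r q h L x1 * chi x1 L ((x1 + L) / 2) * ?wt ((x1 + L) / 2) < r - m * chi x1 L ((x1 + L) / 2) * ?wt ((x1 + L) / 2)"
        using wpos[of "(x1 + L) / 2"] assms(11,12) \<open>m < _\<close> by (simp add: chi_def)
    qed
  qed
  ultimately show ?thesis
    by (intro conjI impI stable) auto
qed

end
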